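(* Let $D\subset\mathbb{R}^d$ ($d\ge 1$) be a bounded domain with $C^\infty$ boundary (an open bounded interval if $d=1$), and let $\mathcal{L}=\sum_{i,j=1}^d a_{i,j}(x)\partial_{x_ix_j}+\sum_{i=1}^d\tilde b_i(x)\partial_{x_i}$ be a second-order linear uniformly elliptic operator on $D$ with $a_{i,j},\tilde b_i\in L^\infty(D)$ and $\tilde b_i\ge 0$. Let $G_{\mathcal{L}}$ be the Green function of $-\mathcal{L}$ on $D$ with Dirichlet boundary conditions, and suppose that there is a constant $C>0$ such that for all $x,y\in D$ with $x\ne y$: (i) if $d\ge 3$, $G_{\mathcal{L}}(x,y)\le C\|x-y\|_{\mathbb{R}^d}^{2-d}$; (ii) if $d\le 2$, $G_{\mathcal{L}}(x,y)\le C\,G_\Delta(x,y)$, where $G_\Delta$ is the Green function of $-\Delta$ on $D$ with Dirichlet boundary conditions. Let $\dot\xi$ be a symmetric Lévy white noise on $D$ with characteristic triplet $(b,\sigma,\nu)$. If $d\ge 4$, assume additionally that $\sigma=0$ and $$\int_{\{|z|\le 1\}}|z|^p\,\nu(dz)<\infty\quad\text{for some }p\in\Bigl(0,\tfrac{d}{d-2}\Bigr).$$ Then the problem $-\mathcal{L}u=\dot\xi$ in $D$, $u=0$ on $\partial D$, admits a unique mild solution $u=\{u(x);x\in D\}$. Moreover, $u$ is also a generalized solution, in the sense that for every test function $\varphi\in\mathcal{D}(D)$, $$\langle u,\varphi\rangle=\bigl\langle\dot\xi,\ G_{\mathcal{L}}\circledast\varphi\bigr\rangle,\qquad\text{where }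 (G_{\mathcal{L}}\circledast\varphi)(x)=\int_D G_{\mathcal{L}}(x,y)\,\varphi(y)\,dy .$$
   Context: $(\Omega,\mathcal{F},\mathbb{P})$ is a complete probability space. $\mathcal{D}(D)$ is the space of test functions on $D$. $\mathcal{B}(D)$ is the Borel $\sigma$-field and $|A|$ is the Lebesgue measure of $A$. For the process $u$ and $\varphi\in\mathcal{D}(D)$, $\langle u,\varphi\rangle=\int_D u(x)\varphi(x)\,dx$ is the distributional action of $u$ on $\varphi$; the same bracket $\langle\dot\xi,\cdot\rangle$ denotes the stochastic integral defined below. For $\varphi\in\mathcal{D}(D)$, $G_{\mathcal{L}}\circledast\varphi$ is the solution of the deterministic problem $-\mathcal{L}w=\varphi$ in $D$, $w=0$ on $\partial D$. Uniform ellipticity: there are constants $0<\kappa<\Lambda$ with $\kappa\|\zeta\|_{\mathbb{R}^d}^2\le\sum_{i,j}a_{i,j}(x)\zeta_i\zeta_j\le\Lambda\|\zeta\|_{\mathbb{R}^d}^2$ for all $\zeta\in\mathbb{R}^d$, $x\in D$. Symmetric Lévy white noise with characteristic triplet $(b,\sigma,\nu)$: an independently scattered random measure $\dot\xi=\{\xi(A)\}_{A\in\mathcal{B}(D)}$ (i.e. for pairwise disjoint $A_1,A_2,\dots$ the variables $\xi(A_n)$ are independent and $\xi(\bigcup_nA_n)=\sum_n\xi(A_n)$ a.s.) with $$\mathbb{E}[e^{iu\xi(A)}]=\exp(|A|\Psi(u)),\qquad \Psi(u)=ibu-\frac{\sigma^2u^2}{2}+\int_{\mathbb{R}_0}\bigl(e^{iuz}-1-iuz\mathbf{1}_{\{|z|\le1\}}\bigr)\nu(dz),$$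 where $b\in\mathbb{R}$, $\sigma\ge0$, $\mathbb{R}_0=\mathbb{R}\setminus\{0\}$, and $\nu$ is a measure on $\mathbb{R}_0$ with $\int(|z|^2\wedge1)\nu(dz)<\infty$ and $\nu(A)=\nu(-A)$ for all Borel $A\subset\mathbb{R}_0$. Stochastic integral: for a simple function $f=\sum_{i=1}^n\alpha_i1_{A_i}$ (disjoint $A_i\in\mathcal{B}(D)$, $\alpha_i\in\mathbb{R}$) and $A\in\mathcal{B}(D)$, $\langle\dot\xi,f1_A\rangle=\sum_i\alpha_i\xi(A\cap A_i)$. A Borel function $f:D\to\mathbb{R}$ is $\dot\xi$-integrable if there are simple functions $f_n\to f$ a.e. such that for every $A\in\mathcal{B}(D)$ the sequence $\langle\dot\xi,f_n1_A\rangle$ converges in probability; then $\langle\dot\xi,f\rangle=\int_Df(x)\,\xi(dx)$ is the limit in probability of $\langle\dot\xi,f_n\rangle$. Mild solution: a process $u=\{u(x);x\in D\}$, measurable with respect to the $\sigma$-field on $\Omega\times D$ generated by $\mathcal{F}\times\mathcal{B}(D)$, satisfying $u(x)=\int_DG_{\mathcal{L}}(x,y)\,\xi(dy)$ (in particular $G_{\mathcal{L}}(x,\cdot)$ is $\dot\xi$-integrable) for $x\in D$.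
   Formalization: The printed identity fails for non-symmetric Green functions; the formal theorem proves it with the transposed kernel, (G⊛φ)(y)=∫G(x,y)φ(x)dx, for every L, and as printed when G is a.e. symmetric. The Green function is taken to be nonnegative. *)

theory Defs
  imports "HOL-Probability.Probability"
begin

definition partial_deriv :: "'d \<Rightarrow> (real^'d \<Rightarrow> real) \<Rightarrow> real^'d \<Rightarrow> real" where
  "partial_deriv i f x = frechet_derivative f (at x) (axis i 1)"

text \<open>The next two notions are meant for open sets.\<close>

primrec Ck_on :: "nat \<Rightarrow> (real^'d) set \<Rightarrow> (real^'d \<Rightarrow> real) \<Rightarrow> bool" where
  "Ck_on 0 U f \<longleftrightarrow> continuous_on U f"
| "Ck_on (Suc k) U f \<longleftrightarrow>
     (\<forall>x\<in>U. f differentiable (at x)) \<and> (\<forall>i. Ck_on k U (partial_deriv i f))"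

definition smooth_on :: "(real^'d) set \<Rightarrow> (real^'d \<Rightarrow> real) \<Rightarrow> bool" where
  "smooth_on U f \<longleftrightarrow> (\<forall>k. Ck_on k U f)"

definition test_function :: "(real^'d) set \<Rightarrow> (real^'d \<Rightarrow> real) \<Rightarrow> bool" where
  "test_function D \<phi> \<longleftrightarrow>
     smooth_on UNIV \<phi> \<and> compact (closure {x. \<phi> x \<noteq> 0}) \<and> closure {x. \<phi> x \<noteq> 0} \<subseteq> D"

text \<open>The boundary is smooth if near each of its points \<^term>\<open>D\<close> is a strict sublevel set of a
  smooth function with non-vanishing gradient. In dimension one this holds for every
  bounded open interval, so the case of an interval needs no separate treatment.\<close>

definition smooth_boundary :: "(real^'d) set \<Rightarrow> bool" where
  "smooth_boundary D \<longleftrightarrow>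
     (\<forall>z\<in>frontier D. \<exists>U \<rho>. open U \<and> z \<in> U \<and> smooth_on U \<rho> \<and>
        (\<exists>i. partial_deriv i \<rho> z \<noteq> 0) \<and> D \<inter> U = {x\<in>U. \<rho> x < 0})"

definition smooth_bounded_domain :: "(real^'d) set \<Rightarrow> bool" where
  "smooth_bounded_domain D \<longleftrightarrow>
     D \<noteq> {} \<and> open D \<and> connected D \<and> bounded D \<and> smooth_boundary D"

definition Linf_on :: "(real^'d) set \<Rightarrow> (real^'d \<Rightarrow> real) \<Rightarrow> bool" where
  "Linf_on D f \<longleftrightarrow> f \<in> borel_measurable (lebesgue_on D) \<and> (\<exists>K. AE x in lebesgue_on D. \<bar>f x\<bar> \<le> K)"

definition uniformly_elliptic :: "(real^'d) set \<Rightarrow> ('d \<Rightarrow> 'd \<Rightarrow> real^'d \<Rightarrow> real) \<Rightarrow> bool" where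
  "uniformly_elliptic D a \<longleftrightarrow>
     (\<exists>\<kappa> \<Lambda>. 0 < \<kappa> \<and> \<kappa> < \<Lambda> \<and>
        (\<forall>x\<in>D. \<forall>\<zeta>. \<kappa> * (norm \<zeta>)\<^sup>2 \<le> (\<Sum>i\<in>UNIV. \<Sum>j\<in>UNIV. a i j x * \<zeta> $ i * \<zeta> $ j) \<and>
                    (\<Sum>i\<in>UNIV. \<Sum>j\<in>UNIV. a i j x * \<zeta> $ i * \<zeta> $ j) \<le> \<Lambda> * (norm \<zeta>)\<^sup>2))"

definition Lp_loc :: "nat \<Rightarrow> (real^'d) set \<Rightarrow> (real^'d \<Rightarrow> real) \<Rightarrow> bool" where
  "Lp_loc p D f \<longleftrightarrow>
     f \<in> borel_measurable (lebesgue_on D) \<and>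
     (\<forall>K. compact K \<and> K \<subseteq> D \<longrightarrow> set_integrable lebesgue K (\<lambda>x. \<bar>f x\<bar> ^ p))"

definition weak_partial :: "(real^'d) set \<Rightarrow> 'd \<Rightarrow> (real^'d \<Rightarrow> real) \<Rightarrow> (real^'d \<Rightarrow> real) \<Rightarrow> bool" where
  "weak_partial D i f g \<longleftrightarrow> Lp_loc 1 D f \<and> Lp_loc 1 D g \<and>
     (\<forall>\<phi>. test_function D \<phi> \<longrightarrow>
        (LINT x:D|lebesgue. f x * partial_deriv i \<phi> x) = - (LINT x:D|lebesgue. g x * \<phi> x))"

text \<open>The coefficients of the operator are only bounded and measurable and it is not in divergence
  form, so \<open>-Lw = f\<close> is understood in the usual strong sense: \<^term>\<open>w\<close> is continuous and belongs to
  the local Sobolev space \<open>W\<^sup>2\<^sup>,\<^sup>d\<close>, with \<open>d\<close> the dimension (the class in which the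
  Aleksandrov maximum principle gives uniqueness), and the equation holds almost everywhere.\<close>

definition dirichlet_solution ::
  "(real^'d) set \<Rightarrow> ('d \<Rightarrow> 'd \<Rightarrow> real^'d \<Rightarrow> real) \<Rightarrow> ('d \<Rightarrow> real^'d \<Rightarrow> real) \<Rightarrow>
     (real^'d \<Rightarrow> real) \<Rightarrow> (real^'d \<Rightarrow> real) \<Rightarrow> bool" where
  "dirichlet_solution D a bt f w \<longleftrightarrow>
     continuous_on D w \<and>
     (\<forall>z\<in>frontier D. (w \<longlongrightarrow> 0) (at z within D)) \<and>
     (\<exists>w1 w2. Lp_loc CARD('d) D w \<and>
        (\<forall>i. weak_partial D i w (w1 i) \<and> Lp_loc CARD('d) D (w1 i)) \<and>
        (\<forall>i j. weak_partial D j (w1 i) (w2 i j) \<and> Lp_loc CARD('d) D (w2 i j)) \<and>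
        (AE x in lebesgue_on D.
           - ((\<Sum>i\<in>UNIV. \<Sum>j\<in>UNIV. a i j x * w2 i j x) + (\<Sum>i\<in>UNIV. bt i x * w1 i x)) = f x))"

definition green_op ::
  "(real^'d) set \<Rightarrow> (real^'d \<Rightarrow> real^'d \<Rightarrow> real) \<Rightarrow> (real^'d \<Rightarrow> real) \<Rightarrow> real^'d \<Rightarrow> real" where
  "green_op D G \<phi> x = (LINT y:D|lborel. G x y * \<phi> y)"

text \<open>The Green function of \<open>-L\<close> with Dirichlet boundary conditions: the nonnegative kernel whose
  integral operator solves the Dirichlet problem. Positivity is the maximum principle in
  kernel form; it is required pointwise because the Dirichlet problem determines each \<^term>\<open>G x\<close> only
  almost everywhere. Values on the diagonal are irrelevant.\<close>

definition green_function ::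
  "(real^'d) set \<Rightarrow> ('d \<Rightarrow> 'd \<Rightarrow> real^'d \<Rightarrow> real) \<Rightarrow> ('d \<Rightarrow> real^'d \<Rightarrow> real) \<Rightarrow>
     (real^'d \<Rightarrow> real^'d \<Rightarrow> real) \<Rightarrow> bool" where
  "green_function D a bt G \<longleftrightarrow>
     (\<lambda>(x, y). G x y) \<in> borel_measurable (restrict_space borel (D \<times> D)) \<and>
     (\<forall>x\<in>D. \<forall>y\<in>D. x \<noteq> y \<longrightarrow> 0 \<le> G x y) \<and>
     (\<forall>x\<in>D. Lp_loc 1 D (G x)) \<and>
     (\<forall>\<phi>. test_function D \<phi> \<longrightarrow> dirichlet_solution D a bt \<phi> (green_op D G \<phi>))"

definition laplace_fundamental :: "real^'d \<Rightarrow> real" where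
  "laplace_fundamental x =
     (if CARD('d) = 1 then - norm x / 2
      else if CARD('d) = 2 then - ln (norm x) / (2 * pi)
      else norm x powr (2 - real CARD('d)) /
             (real CARD('d) * (real CARD('d) - 2) * measure lborel (ball (0 :: real^'d) 1)))"

text \<open>The Green function of \<open>-\<Delta>\<close> is taken in its classical sense, fundamental solution minus
  harmonic corrector. Unlike the almost everywhere characterisation above, this
  determines it at every pair of distinct points, as pointwise comparison with it requires.\<close>

definition laplace_green_function ::
  "(real^'d) set \<Rightarrow> (real^'d \<Rightarrow> real^'d \<Rightarrow> real) \<Rightarrow> bool" where
  "laplace_green_function D G \<longleftrightarrow>
     (\<forall>x\<in>D. \<exists>h. continuous_on (closure D) h \<and> Ck_on 2 D h \<and>
        (\<forall>y\<in>D. (\<Sum>i\<in>UNIV. partial_deriv i (partial_deriv i h) y) = 0) \<and>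
        (\<forall>y\<in>frontier D. h y = laplace_fundamental (y - x)) \<and>
        (\<forall>y\<in>D. y \<noteq> x \<longrightarrow> G x y = laplace_fundamental (y - x) - h y))"

definition symmetric_levy_measure :: "real measure \<Rightarrow> bool" where
  "symmetric_levy_measure \<nu> \<longleftrightarrow>
     sets \<nu> = sets (restrict_space borel (- {0})) \<and>
     (\<integral>\<^sup>+ z. ennreal (min (\<bar>z\<bar>\<^sup>2) 1) \<partial>\<nu>) < \<infinity> \<and>
     (\<forall>A\<in>sets \<nu>. emeasure \<nu> (uminus ` A) = emeasure \<nu> A)"

definition levy_exponent :: "real \<Rightarrow> real \<Rightarrow> real measure \<Rightarrow> real \<Rightarrow> complex" where
  "levy_exponent b \<sigma> \<nu> u =
     \<i> * complex_of_real (b * u) - complex_of_real (\<sigma>\<^sup>2 * u\<^sup>2 / 2) +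
     (CLINT z|\<nu>. exp (\<i> * complex_of_real (u * z)) - 1
                   - \<i> * complex_of_real (u * z * indicator {z. \<bar>z\<bar> \<le> 1} z))"

text \<open>A random measure is a family of random variables indexed by the Borel subsets of \<^term>\<open>D\<close>.\<close>

definition independently_scattered ::
  "'w measure \<Rightarrow> (real^'d) set \<Rightarrow> ((real^'d) set \<Rightarrow> 'w \<Rightarrow> real) \<Rightarrow> bool" where
  "independently_scattered M D \<xi> \<longleftrightarrow>
     (\<forall>A\<in>sets (restrict_space borel D). \<xi> A \<in> borel_measurable M) \<and>
     (\<forall>A :: nat \<Rightarrow> (real^'d) set.
        range A \<subseteq> sets (restrict_space borel D) \<and> disjoint_family A \<longrightarrow>
          prob_space.indep_vars M (\<lambda>_. borel) (\<lambda>n. \<xi> (A n)) UNIV \<and>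
          (AE \<omega> in M. (\<lambda>n. \<xi> (A n) \<omega>) sums \<xi> (\<Union>n. A n) \<omega>))"

definition symmetric_levy_white_noise ::
  "'w measure \<Rightarrow> (real^'d) set \<Rightarrow> real \<Rightarrow> real \<Rightarrow> real measure \<Rightarrow>
     ((real^'d) set \<Rightarrow> 'w \<Rightarrow> real) \<Rightarrow> bool" where
  "symmetric_levy_white_noise M D b \<sigma> \<nu> \<xi> \<longleftrightarrow>
     0 \<le> \<sigma> \<and> symmetric_levy_measure \<nu> \<and> independently_scattered M D \<xi> \<and>
     (\<forall>A\<in>sets (restrict_space borel D). \<forall>u.
        (CLINT \<omega>|M. exp (\<i> * complex_of_real (u * \<xi> A \<omega>)))
          = exp (complex_of_real (measure lborel A) * levy_exponent b \<sigma> \<nu> u))"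

text \<open>For a simple function \<^term>\<open>f\<close> this is \<open>\<langle>\<xi>, f 1\<^sub>A\<rangle>\<close>, computed with the representation of
  \<^term>\<open>f\<close> by its level sets; any other representation gives almost surely the same value.\<close>

definition simple_stoch_integral ::
  "(real^'d) set \<Rightarrow> ((real^'d) set \<Rightarrow> 'w \<Rightarrow> real) \<Rightarrow> (real^'d \<Rightarrow> real) \<Rightarrow> (real^'d) set \<Rightarrow> 'w \<Rightarrow> real" where
  "simple_stoch_integral D \<xi> f A \<omega> = (\<Sum>\<alpha>\<in>f ` D. \<alpha> * \<xi> (A \<inter> {x\<in>D. f x = \<alpha>}) \<omega>)"

definition tendsto_in_prob :: "'w measure \<Rightarrow> (nat \<Rightarrow> 'w \<Rightarrow> real) \<Rightarrow> ('w \<Rightarrow> real) \<Rightarrow> bool" where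
  "tendsto_in_prob M X Y \<longleftrightarrow>
     (\<forall>n. X n \<in> borel_measurable M) \<and> Y \<in> borel_measurable M \<and>
     (\<forall>\<epsilon>>0. (\<lambda>n. measure M {\<omega>\<in>space M. \<bar>X n \<omega> - Y \<omega>\<bar> > \<epsilon>}) \<longlonglongrightarrow> 0)"

text \<open>The stochastic integral is defined only up to null sets, so it is a relation:
  \<^term>\<open>Y\<close> is a version of \<open>\<langle>\<xi>, f\<rangle>\<close> (in particular \<^term>\<open>f\<close> is integrable).\<close>

definition has_stoch_integral ::
  "'w measure \<Rightarrow> (real^'d) set \<Rightarrow> ((real^'d) set \<Rightarrow> 'w \<Rightarrow> real) \<Rightarrow> (real^'d \<Rightarrow> real) \<Rightarrow>
     ('w \<Rightarrow> real) \<Rightarrow> bool" where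
  "has_stoch_integral M D \<xi> f Y \<longleftrightarrow>
     f \<in> borel_measurable (restrict_space borel D) \<and>
     (\<exists>F. (\<forall>n. simple_function (restrict_space borel D) (F n)) \<and>
          (AE x in lborel. x \<in> D \<longrightarrow> (\<lambda>n. F n x) \<longlonglongrightarrow> f x) \<and>
          (\<forall>A\<in>sets (restrict_space borel D).
             \<exists>Z. tendsto_in_prob M (\<lambda>n. simple_stoch_integral D \<xi> (F n) A) Z) \<and>
          tendsto_in_prob M (\<lambda>n. simple_stoch_integral D \<xi> (F n) D) Y)"

definition mild_solution ::
  "'w measure \<Rightarrow> (real^'d) set \<Rightarrow> (real^'d \<Rightarrow> real^'d \<Rightarrow> real) \<Rightarrow> ((real^'d) set \<Rightarrow> 'w \<Rightarrow> real) \<Rightarrow>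
     (real^'d \<Rightarrow> 'w \<Rightarrow> real) \<Rightarrow> bool" where
  "mild_solution M D G \<xi> u \<longleftrightarrow>
     (\<lambda>(\<omega>, x). u x \<omega>) \<in> borel_measurable (M \<Otimes>\<^sub>M restrict_space borel D) \<and>
     (\<forall>x\<in>D. has_stoch_integral M D \<xi> (G x) (u x))"

text \<open>The identity \<open>\<langle>u, \<phi>\<rangle> = \<langle>\<xi>, T \<phi>\<rangle>\<close> almost surely for all test functions, for an
  operator \<^term>\<open>T\<close> on test functions.\<close>

definition generalized_solution ::
  "'w measure \<Rightarrow> (real^'d) set \<Rightarrow> ((real^'d \<Rightarrow> real) \<Rightarrow> real^'d \<Rightarrow> real) \<Rightarrow>
     ((real^'d) set \<Rightarrow> 'w \<Rightarrow> real) \<Rightarrow> (real^'d \<Rightarrow> 'w \<Rightarrow> real) \<Rightarrow> bool" where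
  "generalized_solution M D T \<xi> u \<longleftrightarrow>
     (\<forall>\<phi>. test_function D \<phi> \<longrightarrow>
        (AE \<omega> in M. set_integrable lborel D (\<lambda>x. u x \<omega> * \<phi> x)) \<and>
        has_stoch_integral M D \<xi> (T \<phi>) (\<lambda>\<omega>. LINT x:D|lborel. u x \<omega> * \<phi> x))"

text \<open>Interchanging the integrals in \<open>\<langle>u, \<phi>\<rangle>\<close> yields the operator with the transposed
  kernel, \<^term>\<open>green_op D (\<lambda>x y. G y x)\<close>. On all test functions it agrees almost
  everywhere with \<^term>\<open>green_op D G\<close> exactly for almost everywhere symmetric kernels;
  the Green function of \<open>w'' + w'\<close> on an interval, for instance, is not symmetric.\<close>

definition symmetric_kernel :: "(real^'d) set \<Rightarrow> (real^'d \<Rightarrow> real^'d \<Rightarrow> real) \<Rightarrow> bool" where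
  "symmetric_kernel D G \<longleftrightarrow> (AE (x, y) in lborel. x \<in> D \<and> y \<in> D \<longrightarrow> G x y = G y x)"

end

theory Submission
  imports Defs
begin

text \<open>Put \<open>\<psi> = - Re \<Psi>\<close>. There is an exponent \<open>q \<in> [1, 2]\<close> such that on the one hand the kernels
  \<open>G x\<close> are bounded in \<open>L\<^sup>q(D)\<close> uniformly in \<open>x\<close>, and on the other hand the increments of the noise,
  truncated at level \<open>R\<close>, satisfy \<open>E \<bar>\<xi>(A) - b \<bar>A\<bar>\<bar>\<^sup>q 1 \<le> K\<^sub>R \<bar>A\<bar>\<close>: \<open>q = 2\<close> up to dimension three, and
  \<open>p < q < d/(d - 2)\<close> above. No moments of the noise itself are available. However, for any finite
  partition of \<open>D\<close> the event that some cell carries an increment larger than \<open>R\<close> has a probability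
  that tends to zero as \<open>R \<rightarrow> \<infinity>\<close>, uniformly in the partition. Outside this event the integral of a
  step function is controlled by its \<open>L\<^sup>q\<close> size, simultaneously for all step functions over the
  partition. Used for a single function this gives existence of \<open>\<langle>\<xi>, f\<rangle>\<close> for \<open>f \<in> L\<^sup>q\<close>; used for all the
  \<open>f = H(x, \<sqdot>)\<close> of a step kernel \<open>H\<close> at once it allows integration in \<open>x\<close>, which replaces the
  Levy-Ito decomposition in the stochastic Fubini theorem. Choosing the approximating step
  functions measurably in \<open>x\<close> from a countable family makes \<open>u\<close> jointly measurable.

  That the limit defining \<open>\<langle>\<xi>, f\<rangle>\<close> does not depend on the approximating sequence is seen on
  characteristic functions, by Fatou's lemma, up to the drift, which is a matter of the
  Vitali-Hahn-Saks theorem.\<close>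

section \<open>Singular kernels and Green functions\<close>

text \<open>Each \<open>u x\<close> is fixed only up to a null set that depends on \<open>x\<close>,
  so an estimate at single points cannot be integrated over \<open>D\<close>; bounds have to hold
  for all points outside one common event. Symmetry enters through centring: once \<open>b\<close>
  times Lebesgue measure is subtracted, the increments have symmetric laws, so odd truncations of
  them have mean zero and, being independent over disjoint cells, are orthogonal. The two demands on
  \<open>q\<close> meet as follows. The power 2 - d of the distance is integrable to the order
  \<open>q\<close> exactly if (d - 2) q < d, which admits \<open>q = 2\<close> up to d = 3 and just
  fails at d = 4. Below 2 a Gaussian part would make \<psi> grow too fast, and the jumps need a
  moment of smaller order. In low dimension the Green function of the Laplacian is needed from above
  only, hence its harmonic corrector from below only. The drift needs its own argument for
  uniqueness because approximating sequences in the definition of the integral converge almost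
  everywhere, not in \<open>L^1\<close>; convergence of the integrals over every Borel set has to
  make up for this.\<close>

lemma second_derivative_nonneg_at_local_min:
  fixes g g' :: "real \<Rightarrow> real"
  assumes r: "0 < r" and min: "\<And>t. \<bar>t\<bar> < r \<Longrightarrow> g 0 \<le> g t"
    and g: "\<And>t. \<bar>t\<bar> < r \<Longrightarrow> DERIV g t :> g' t" and g': "DERIV g' 0 :> l"
  shows "0 \<le> l"
proof (rule ccontr)
  assume "\<not> 0 \<le> l"
  then have "l < 0" by simp
  have "g' 0 = 0"
    using r min g[of 0] by (intro DERIV_local_min[of g "g' 0" 0 r]) auto
  obtain e where e: "0 < e" "\<And>h. 0 < h \<Longrightarrow> h < e \<Longrightarrow> g' (0 + h) < g' 0"
    using DERIV_neg_dec_right[OF g' \<open>l < 0\<close>] by auto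
  define s where "s = min e r / 2"
  have s: "0 < s" "s < e" "s < r" using e(1) r by (auto simp: s_def min_def)
  have "g s < g 0"
  proof (rule DERIV_neg_imp_decreasing_open[OF s(1)])
    show "\<exists>y. DERIV g x :> y \<and> y < 0" if "0 < x" "x < s" for x
      using that s e(2)[of x] g[of x] \<open>g' 0 = 0\<close> by (intro exI[of _ "g' x"]) auto
    show "continuous_on {0..s} g"
      using s by (intro continuous_at_imp_continuous_on ballI DERIV_isCont[OF g]) auto
  qed
  with min[of s] s show False by auto
qed

lemma has_real_derivative_along_axis:
  fixes f :: "real^'d \<Rightarrow> real"
  assumes "f differentiable (at (z + t *\<^sub>R axis i 1))"
  shows "((\<lambda>t. f (z + t *\<^sub>R axis i 1)) has_real_derivative partial_deriv i f (z + t *\<^sub>R axis i 1)) (at t)"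
proof -
  let ?F = "frechet_derivative f (at (z + t *\<^sub>R axis i 1))"
  have F: "(f has_derivative ?F) (at (z + t *\<^sub>R axis i 1))"
    using assms frechet_derivative_works by blast
  have lin: "linear ?F" using F has_derivative_linear by blast
  have "((\<lambda>t. z + t *\<^sub>R axis i (1::real)) has_derivative (\<lambda>s. s *\<^sub>R axis i 1)) (at t)"
    by (auto intro!: derivative_eq_intros)
  from has_derivative_compose[OF this F]
  have "((\<lambda>t. f (z + t *\<^sub>R axis i 1)) has_derivative (\<lambda>s. ?F (s *\<^sub>R axis i 1))) (at t)" .
  also have "(\<lambda>s. ?F (s *\<^sub>R axis i 1)) = (*) (partial_deriv i f (z + t *\<^sub>R axis i 1))"
    by (simp add: linear_scale[OF lin] partial_deriv_def fun_eq_iff)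
  finally show ?thesis
    unfolding has_field_derivative_def .
qed

text \<open>The quadratic perturbation makes the function strictly superharmonic, so that its minimum
  over the closure cannot be attained inside.\<close>

lemma harmonic_lower_bound:
  fixes h :: "real^'d \<Rightarrow> real"
  assumes D: "open D" "bounded D"
    and cont: "continuous_on (closure D) h" and C2: "Ck_on 2 D h"
    and harm: "\<And>y. y \<in> D \<Longrightarrow> (\<Sum>i\<in>UNIV. partial_deriv i (partial_deriv i h) y) = 0"
    and bd: "\<And>y. y \<in> frontier D \<Longrightarrow> m \<le> h y" and y0: "y0 \<in> D"
  shows "m \<le> h y0"
proof (rule ccontr)
  assume "\<not> m \<le> h y0"
  then have gap: "h y0 < m" by simp
  obtain R where R: "R > 0" "\<And>y. y \<in> closure D \<Longrightarrow> norm y \<le> R"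
    using bounded_closure[OF D(2)] bounded_pos by metis
  \<comment> \<open>With this value the perturbation is at most half the gap \<open>m - h y0\<close>
    on the closure, too little for a boundary point to compete with \<open>y0\<close>.\<close>
  define e where "e = (m - h y0) / (2 * R\<^sup>2)"
  have e: "e > 0" "e * R\<^sup>2 < m - h y0" using gap R by (auto simp: e_def field_simps)
  define w where "w y = h y - e * (y \<bullet> y)" for y
  have "continuous_on (closure D) w"
    unfolding w_def by (intro continuous_intros cont)
  moreover have "compact (closure D)" using D by (simp add: compact_closure)
  ultimately obtain z where z: "z \<in> closure D" "\<And>y. y \<in> closure D \<Longrightarrow> w z \<le> w y"
    using continuous_attains_inf[of "closure D" w] y0 closure_subset[of D] by auto
  have "z \<in> D"
  proof (rule ccontr)
    assume "z \<notin> D"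
    then have "z \<in> frontier D" using z D by (simp add: frontier_def interior_open)
    then have "m \<le> h z" by (rule bd)
    moreover have "z \<bullet> z \<le> R\<^sup>2"
      using R(2)[OF z(1)] by (simp add: power2_norm_eq_inner[symmetric] power_mono)
    ultimately have "m - e * R\<^sup>2 \<le> w z" using e by (auto simp: w_def intro!: diff_mono mult_left_mono)
    also have "w z \<le> w y0" using z(2) y0 closure_subset by blast
    also have "\<dots> \<le> h y0" using e by (simp add: w_def)
    finally show False using e by simp
  qed
  then obtain r where r: "r > 0" "ball z r \<subseteq> D" using D open_contains_ball by blast
  have diff: "h differentiable (at x)" "partial_deriv i h differentiable (at x)" if "x \<in> D" for x i
    using C2 that by (auto simp: numeral_2_eq_2)
  \<comment> \<open>Along every axis \<open>w\<close> has a minimum at \<open>z\<close>, and the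
    perturbation lowers the second derivative by \<open>2 * e\<close>. Summing over the axes
    contradicts harmonicity.\<close>
  have "2 * e \<le> partial_deriv i (partial_deriv i h) z" for i
  proof -
    let ?p = "\<lambda>t. z + t *\<^sub>R axis i (1::real)"
    have pD: "?p t \<in> D" if "\<bar>t\<bar> < r" for t
      using that r by (intro subsetD[OF r(2)]) (simp add: dist_norm)
    have "0 \<le> partial_deriv i (partial_deriv i h) (?p 0) - 2 * e"
    proof (rule second_derivative_nonneg_at_local_min[OF r(1), where g = "\<lambda>t. w (?p t)" and g' = "\<lambda>t. partial_deriv i h (?p t) - e * (2 * (z $ i + t))"])
      show "w (?p 0) \<le> w (?p t)" if "\<bar>t\<bar> < r" for t
        using z(2)[of "?p t"] pD[OF that] closure_subset by auto
      have exp: "?p t \<bullet> ?p t = z \<bullet> z + 2 * t * z $ i + t * t" for t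
        by (simp add: inner_simps inner_axis inner_axis_axis inner_commute[of "axis i 1"] algebra_simps)
      show "((\<lambda>t. w (?p t)) has_real_derivative partial_deriv i h (?p t) - e * (2 * (z $ i + t))) (at t)"
        if "\<bar>t\<bar> < r" for t
        unfolding w_def exp
        by (rule derivative_eq_intros has_real_derivative_along_axis diff(1) pD that refl | simp add: algebra_simps)+
      show "((\<lambda>t. partial_deriv i h (?p t) - e * (2 * (z $ i + t))) has_real_derivative
          partial_deriv i (partial_deriv i h) (?p 0) - 2 * e) (at 0)"
        by (rule derivative_eq_intros has_real_derivative_along_axis diff(2) pD refl | simp add: r)+
    qed
    then show ?thesis by simp
  qed
  then have "(\<Sum>i\<in>(UNIV::'d set). 2 * e) \<le> (\<Sum>i\<in>UNIV. partial_deriv i (partial_deriv i h) z)"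
    by (intro sum_mono) auto
  then show False using harm[OF \<open>z \<in> D\<close>] e by (simp add: mult_le_0_iff)
qed

section \<open>Integrals of negative powers of the distance\<close>

lemma ex_dyadic_scale:
  fixes r s :: real
  assumes "0 < s" "s \<le> r"
  shows "\<exists>k::nat. r * (1/2) ^ Suc k < s \<and> s \<le> r * (1/2) ^ k"
proof -
  define k where "k = (LEAST k. r * (1/2) ^ Suc k < s)"
  have "\<exists>k. (1/2::real) ^ k < s / r" using assms by (intro real_arch_pow_inv) auto
  then obtain k0 where "(1/2::real) ^ k0 < s / r" by blast
  then have "r * (1/2) ^ Suc k0 < s" using assms by (simp add: field_simps)
  then have 1: "r * (1/2) ^ Suc k < s" unfolding k_def by (rule LeastI)
  have "s \<le> r * (1/2) ^ k"
  proof (cases k)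
    case 0
    then show ?thesis using assms by simp
  next
    case (Suc j)
    then have "\<not> r * (1/2) ^ Suc j < s" using not_less_Least[of j "\<lambda>k. r * (1/2) ^ Suc k < s"] k_def by auto
    then show ?thesis using Suc by simp
  qed
  with 1 show ?thesis by blast
qed

text \<open>On the k-th dyadic shell around \<open>x\<close> the integrand is at most
  \<open>c k\<close>, and the ball containing the shell has volume \<open>v k\<close>. The products
  form a geometric series whose ratio is 2 to the power \<alpha> minus the dimension, hence below 1.
  Only a bound on the diameter of \<open>D\<close> enters, which gives uniformity in
  \<open>x\<close>.\<close>

lemma singular_integral_bound:
  fixes D :: "(real^'d) set"
  assumes D: "bounded D" "D \<in> sets borel" and \<alpha>: "0 \<le> \<alpha>" "\<alpha> < real CARD('d)"
  shows "\<exists>K::real. 0 \<le> K \<and>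
    (\<forall>x\<in>D. (\<integral>\<^sup>+y\<in>D. ennreal (norm (x - y) powr (- \<alpha>)) \<partial>lborel) \<le> ennreal K)"
proof -
  obtain R where R: "R > 0" "\<And>y. y \<in> D \<Longrightarrow> norm y \<le> R" using D(1) bounded_pos by metis
  define r where "r = 2 * R"
  have r: "r > 0" "\<And>x y. x \<in> D \<Longrightarrow> y \<in> D \<Longrightarrow> norm (x - y) \<le> r"
    using R norm_triangle_ineq4 by (auto simp: r_def intro: order_trans[OF norm_triangle_ineq4] add_mono[of _ R _ R, simplified])
  let ?n = "CARD('d)"
  define c where "c k = (r * (1/2) ^ Suc k) powr (- \<alpha>)" for k
  define v where "v k = unit_ball_vol ?n * (r * (1/2)^k) ^ ?n" for k :: nat
  define \<rho> where "\<rho> = 2 powr (\<alpha> - ?n)"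
  have \<rho>: "0 \<le> \<rho>" "\<rho> < 1" unfolding \<rho>_def using \<alpha> powr_less_mono[of "\<alpha> - ?n" 0 2] by auto
  have cv: "c k * v k = (c 0 * v 0) * \<rho> ^ k" for k
  proof -
    have "c k = c 0 * (2 powr \<alpha>) ^ k"
      using r by (simp add: c_def powr_mult powr_minus powr_divide powr_realpow[symmetric] powr_powr field_simps)
    moreover have "v k = v 0 * (2 powr (- real ?n)) ^ k"
      by (simp add: v_def powr_minus powr_realpow power_mult_distrib field_simps power_mult[symmetric])
    moreover have "\<rho> = 2 powr \<alpha> * 2 powr (- real ?n)" by (simp add: \<rho>_def powr_diff powr_minus field_simps)
    ultimately show ?thesis by (simp add: power_mult_distrib)
  qed
  define K where "K = (\<Sum>k. c k * v k)"
  have v0: "v k \<ge> 0" "c k \<ge> 0" for k using r by (auto simp: v_def c_def)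
  have sm: "summable (\<lambda>k. c k * v k)" 
  proof -
    have "(\<lambda>k. c k * v k) = (\<lambda>k. (c 0 * v 0) * \<rho> ^ k)" by (rule ext) (rule cv)
    then show ?thesis using \<rho> by (simp only:) (intro summable_mult summable_geometric, auto)
  qed
  have K: "0 \<le> K" unfolding K_def using sm v0 by (intro suminf_nonneg) auto
  have "(\<integral>\<^sup>+y\<in>D. ennreal (norm (x - y) powr (- \<alpha>)) \<partial>lborel) \<le> ennreal K" if x: "x \<in> D" for x
  proof -
    have "(\<integral>\<^sup>+y\<in>D. ennreal (norm (x - y) powr (- \<alpha>)) \<partial>lborel)
        \<le> (\<integral>\<^sup>+y. (\<Sum>k. ennreal (c k) * indicator (cball x (r * (1/2)^k)) y) \<partial>lborel)"
    proof (rule nn_integral_mono)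
      fix y
      show "ennreal (norm (x - y) powr - \<alpha>) * indicator D y
          \<le> (\<Sum>k. ennreal (c k) * indicator (cball x (r * (1/2)^k)) y)"
      \<comment> \<open>At \<open>y = x\<close> the left side vanishes because \<open>0 powr\<close>
        any exponent is 0, so only points at positive distance have to be placed in a shell.\<close>
      proof (cases "y \<in> D \<and> y \<noteq> x")
        case True
        then have "0 < norm (x - y)" "norm (x - y) \<le> r" using r x by auto
        then obtain k where k: "r * (1/2) ^ Suc k < norm (x - y)" "norm (x - y) \<le> r * (1/2) ^ k"
          using ex_dyadic_scale by blast
        have "norm (x - y) powr (-\<alpha>) \<le> c k"
          unfolding c_def using k r \<alpha> by (intro powr_mono2') auto
        then have "ennreal (norm (x - y) powr - \<alpha>) * indicator D y \<le> ennreal (c k) * indicator (cball x (r * (1/2)^k)) y"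
          using k by (auto simp: dist_norm indicator_def ennreal_leI)
        also have "\<dots> = (\<Sum>j\<in>{k}. ennreal (c j) * indicator (cball x (r * (1/2)^j)) y)"
            by (subst sum.insert) auto
        also have "\<dots> \<le> (\<Sum>k. ennreal (c k) * indicator (cball x (r * (1/2)^k)) y)"
          by (rule sum_le_suminf) auto
        finally show ?thesis .
      qed (auto simp: indicator_def)
    qed
    also have "\<dots> = (\<Sum>k. ennreal (c k) * emeasure lborel (cball x (r * (1/2)^k)))"
    proof (subst nn_integral_suminf)
      have [measurable]: "cball x t \<in> sets borel" for t by simp
      show "(\<lambda>y. ennreal (c k) * indicator (cball x (r * (1/2)^k)) y) \<in> borel_measurable lborel" for k
        by measurable
    qed (auto intro!: suminf_cong nn_integral_cmult_indicator)
    also have "\<dots> = (\<Sum>k. ennreal (c k * v k))"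
    proof (rule suminf_cong)
      fix k
      have "emeasure lborel (cball x (r * (1/2)^k)) = ennreal (v k)"
        using r by (subst emeasure_cball) (auto simp: v_def)
      then show "ennreal (c k) * emeasure lborel (cball x (r * (1/2)^k)) = ennreal (c k * v k)"
        using v0 by (simp add: ennreal_mult)
    qed
    also have "\<dots> = ennreal K" unfolding K_def using v0 sm by (intro suminf_ennreal2) auto
    finally show ?thesis .
  qed
  with K show ?thesis by blast
qed

text \<open>The corrector agrees on the boundary with the fundamental solution, which is at least
  \<open>- r\<close> there, so the minimum principle gives \<open>h y \<ge> - r\<close> throughout
  \<open>D\<close>, uniformly in \<open>x\<close>. What remains is at worst a logarithmic
  singularity and a constant, both absorbed by a small negative power. The exponent 1/4 is chosen so
  that its double stays below the dimension even on the line.\<close>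

lemma laplace_green_function_bound:
  fixes D :: "(real^'d) set"
  assumes D: "open D" "bounded D" and dim: "CARD('d) \<le> 2" and GD: "laplace_green_function D GD"
  shows "\<exists>K\<ge>0. \<forall>x\<in>D. \<forall>y\<in>D. x \<noteq> y \<longrightarrow> GD x y \<le> K * norm (x - y) powr (- (1/4))"
proof -
  obtain R where R: "R > 0" "\<And>y. y \<in> closure D \<Longrightarrow> norm y \<le> R"
    using bounded_closure[OF D(2)] bounded_pos by metis
  \<comment> \<open>Forcing \<open>r \<ge> 1\<close> lets powers of \<open>r\<close> with different
    exponents be compared when a constant is traded for a negative power of the distance.\<close>
  define r where "r = max 1 (2 * R)"
  have r1: "r \<ge> 1" by (simp add: r_def)
  have r: "norm (x - y) \<le> r" if "x \<in> closure D" "y \<in> closure D" for x y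
    using norm_triangle_ineq4[of x y] R(2)[OF that(1)] R(2)[OF that(2)] by (auto simp: r_def)
  have dim': "CARD('d) = 1 \<or> CARD('d) = 2" using dim zero_less_card_finite[where 'a='d] by linarith
  have pi2: "2 * pi \<ge> 1" using pi_ge_two by simp
  have low: "- r \<le> laplace_fundamental u" if "0 < norm u" "norm u \<le> r" for u :: "real^'d"
  proof (cases "CARD('d) = 1")
    case True
    then show ?thesis using that r1 by (simp add: laplace_fundamental_def)
  next
    case False
    then have d2: "CARD('d) = 2" using dim' by simp
    have "ln (norm u) \<le> r" using that ln_bound[of "norm u"] by linarith
    also have "r \<le> r * (2 * pi)" using r1 pi2 by (simp add: mult_le_cancel_left1)
    finally have "ln (norm u) / (2 * pi) \<le> r" using pi2 by (simp add: pos_divide_le_eq)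
    then show ?thesis using d2 by (simp add: laplace_fundamental_def)
  qed
  have up: "laplace_fundamental u \<le> 4 * norm u powr (-(1/4))" if "0 < norm u" for u :: "real^'d"
  proof (cases "CARD('d) = 1")
    case True
    then show ?thesis using that by (simp add: laplace_fundamental_def order_trans[of _ 0])
  next
    case False
    then have d2: "CARD('d) = 2" using dim' by simp
    \<comment> \<open>Writing the logarithm through a power with exponent -1/4 and using
      \<open>ln s \<le> s\<close> is the source of the factor 4.\<close>
    have "- ln (norm u) = 4 * ln (norm u powr (-(1/4)))" using that by (simp add: ln_powr)
    also have "\<dots> \<le> 4 * norm u powr (-(1/4))" using that by (intro mult_left_mono ln_bound) auto
    also have "\<dots> \<le> 4 * norm u powr (-(1/4)) * (2 * pi)"
      using pi2 mult_left_mono[OF pi2, of "4 * norm u powr (-(1/4))"] by simp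
    finally have "- ln (norm u) / (2 * pi) \<le> 4 * norm u powr (-(1/4))" using pi2
      by (subst pos_divide_le_eq) auto
    then show ?thesis using d2 by (simp add: laplace_fundamental_def)
  qed
  have "GD x y \<le> (4 + r * r) * norm (x - y) powr (- (1/4))" if xy: "x \<in> D" "y \<in> D" "x \<noteq> y" for x y
  proof -
    obtain h where h: "continuous_on (closure D) h" "Ck_on 2 D h"
        "\<And>y. y \<in> D \<Longrightarrow> (\<Sum>i\<in>UNIV. partial_deriv i (partial_deriv i h) y) = 0"
        "\<And>y. y \<in> frontier D \<Longrightarrow> h y = laplace_fundamental (y - x)"
        "\<And>y. y \<in> D \<Longrightarrow> y \<noteq> x \<Longrightarrow> GD x y = laplace_fundamental (y - x) - h y"
      using bspec[OF GD[unfolded laplace_green_function_def] xy(1)] by blast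
    have "- r \<le> h y"
    proof (rule harmonic_lower_bound[OF D h(1-3) _ xy(2)])
      fix z assume z: "z \<in> frontier D"
      then have "z \<noteq> x" using xy(1) D(1) by (auto simp: frontier_def interior_open)
      moreover have "z \<in> closure D" using z by (simp add: frontier_def)
      ultimately show "- r \<le> h z"
        using h(4)[OF z] low[of "z - x"] r[of z x] xy(1) closure_subset[of D] by auto
    qed
    let ?n = "norm (x - y)"
    have n: "0 < ?n" "?n \<le> r" using xy r[of x y] closure_subset[of D] by auto
    \<comment> \<open>Distances in \<open>D\<close> do not exceed \<open>r\<close>, so the additive
      constant from the corrector becomes a multiple of the negative power, at the cost of a further
      factor \<open>r\<close>.\<close>
    have "r powr (-1) \<le> ?n powr (-(1/4))"
    proof -
      have "r powr (-1) \<le> r powr (-(1/4))" using r1 by (intro powr_mono) auto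
      also have "\<dots> \<le> ?n powr (-(1/4))" using n by (intro powr_mono2') auto
      finally show ?thesis .
    qed
    then have "1 \<le> r * ?n powr (-(1/4))" using r1 by (simp add: powr_minus field_simps)
    then have "r \<le> r * r * ?n powr (-(1/4))" using r1 mult_left_mono[of 1 "r * ?n powr (-(1/4))" r] by simp
    moreover have "laplace_fundamental (y - x) \<le> 4 * ?n powr (-(1/4))"
      using up[of "y - x"] n by (simp add: norm_minus_commute)
    ultimately show ?thesis
      using h(5)[OF xy(2)] xy(3) \<open>- r \<le> h y\<close> by (auto simp: algebra_simps)
  qed
  then show ?thesis by (intro exI[of _ "4 + r * r"]) (use r1 in auto)
qed

section \<open>Laws of symmetric noise\<close>

lemma one_minus_cos_eq: "1 - cos (x::real) = 2 * (sin (x / 2))\<^sup>2"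
  using cos_double_sin[of "x / 2"] by simp

lemma one_minus_cos_le_square: "1 - cos (x::real) \<le> x\<^sup>2 / 2"
proof -
  have "(sin (x / 2))\<^sup>2 \<le> (x / 2)\<^sup>2" using abs_sin_x_le_abs_x[of "x / 2"] by (rule abs_le_square_iff[THEN iffD1])
  then show ?thesis unfolding one_minus_cos_eq by (simp add: power_divide)
qed

text \<open>On \<open>[0, 1]\<close>, which lies within \<open>pi / 3\<close>, the cosine is at
  least 1/2; integrating this twice gives the constant 1/4.\<close>

lemma one_minus_cos_ge_square:
  fixes x :: real
  assumes "\<bar>x\<bar> \<le> 1"
  shows "x\<^sup>2 / 4 \<le> 1 - cos x"
proof -
  have *: "x\<^sup>2 / 4 \<le> 1 - cos x" if x: "0 \<le> x" "x \<le> 1" for x :: real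
  proof -
    have c: "1 / 2 \<le> cos y" if "0 \<le> y" "y \<le> 1" for y :: real
      using that cos_monotone_0_pi_le[of y "pi / 3"] pi_gt3 by (simp add: cos_60)
    have s: "y / 2 \<le> sin y" if y: "0 \<le> y" "y \<le> 1" for y :: real
    proof -
      have "(\<lambda>y. sin y - y / 2) 0 \<le> (\<lambda>y. sin y - y / 2) y"
      proof (rule DERIV_nonneg_imp_nondecreasing[OF y(1)])
        fix z assume "0 \<le> z" "z \<le> y"
        then show "\<exists>D. ((\<lambda>y. sin y - y / 2) has_real_derivative D) (at z) \<and> 0 \<le> D"
          using c[of z] y by (intro exI[of _ "cos z - 1 / 2"]) (auto intro!: derivative_eq_intros)
      qed
      then show ?thesis by simp
    qed
    have "(\<lambda>y. 1 - cos y - y\<^sup>2 / 4) 0 \<le> (\<lambda>y. 1 - cos y - y\<^sup>2 / 4) x"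
    proof (rule DERIV_nonneg_imp_nondecreasing[OF x(1)])
      fix z assume "0 \<le> z" "z \<le> x"
      then show "\<exists>D. ((\<lambda>y. 1 - cos y - y\<^sup>2 / 4) has_real_derivative D) (at z) \<and> 0 \<le> D"
        using s[of z] x by (intro exI[of _ "sin z - z / 2"]) (auto intro!: derivative_eq_intros)
    qed
    then show ?thesis by simp
  qed
  from *[of "\<bar>x\<bar>"] assms show ?thesis by simp
qed

section \<open>The characteristic exponent of a symmetric Levy measure\<close>

definition levy_psi :: "real \<Rightarrow> real measure \<Rightarrow> real \<Rightarrow> real" where
  "levy_psi \<sigma> \<nu> u = \<sigma>\<^sup>2 * u\<^sup>2 / 2 + (LINT z|\<nu>. 1 - cos (u * z))"

lemma one_minus_cos_le_min:
  fixes u z :: real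
  shows "1 - cos (u * z) \<le> (2 + u\<^sup>2) * min (\<bar>z\<bar>\<^sup>2) 1"
proof (cases "\<bar>z\<bar> \<le> 1")
  case True
  then have m: "min (\<bar>z\<bar>\<^sup>2) 1 = z\<^sup>2" by (simp add: abs_square_le_1 min_def)
  moreover have "1 - cos (u * z) \<le> u\<^sup>2 * z\<^sup>2"
    using one_minus_cos_le_square[of "u * z"] zero_le_power2[of "u * z"]
    unfolding power_mult_distrib by linarith
  moreover have "0 \<le> z\<^sup>2" by simp
  ultimately show ?thesis unfolding distrib_right m by linarith
next
  case False
  then have "min (\<bar>z\<bar>\<^sup>2) 1 = 1" using abs_square_le_1[of z] by (simp add: min_def)
  moreover have "1 - cos (u * z) \<le> 2" using cos_ge_minus_one[of "u * z"] by linarith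
  ultimately show ?thesis by (simp add: add_increasing2)
qed

context
  fixes \<nu> :: "real measure"
  assumes levy: "symmetric_levy_measure \<nu>"
begin

lemma space_levy: "space \<nu> = - {0}"
  using levy sets_eq_imp_space_eq[of \<nu> "restrict_space borel (- {0})"]
  by (auto simp: symmetric_levy_measure_def space_restrict_space)

lemma sets_levy: "sets \<nu> = sets (restrict_space borel (- {0}))"
  using levy by (simp add: symmetric_levy_measure_def)

lemma measurable_levy: "f \<in> measurable borel N \<Longrightarrow> f \<in> measurable \<nu> N"
  unfolding measurable_cong_sets[OF sets_levy refl] by (rule measurable_restrict_space1)

lemma integrable_levy_min: "integrable \<nu> (\<lambda>z. min (\<bar>z\<bar>\<^sup>2) 1)"
  using levy by (intro integrableI_nonneg measurable_levy) (auto simp: symmetric_levy_measure_def)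

lemma integrable_levy_bound:
  fixes f :: "real \<Rightarrow> 'a::{banach, second_countable_topology}"
  assumes "f \<in> borel_measurable borel" "\<And>z. norm (f z) \<le> C * min (\<bar>z\<bar>\<^sup>2) 1"
  shows "integrable \<nu> f"
proof (rule Bochner_Integration.integrable_bound)
  show "integrable \<nu> (\<lambda>z. C * min (\<bar>z\<bar>\<^sup>2) 1)" using integrable_levy_min by simp
  show "f \<in> borel_measurable \<nu>"
    by (rule measurable_levy[OF assms(1)])
qed (use assms(2) in \<open>auto intro: order_trans[OF _ abs_ge_self]\<close>)

lemma integrable_levy_cos: "integrable \<nu> (\<lambda>z. 1 - cos (u * z))"
proof (rule integrable_levy_bound)
  show "norm (1 - cos (u * z)) \<le> (2 + u\<^sup>2) * min (\<bar>z\<bar>\<^sup>2) 1" for z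
    using one_minus_cos_le_min[of u z] by simp
qed simp

text \<open>The definition of the Levy measure states symmetry for images of sets; as invariance
  under a map it can be used to change variables in integrals.\<close>

lemma distr_uminus_levy: "distr \<nu> \<nu> uminus = \<nu>"
proof (rule measure_eqI)
  have meas: "uminus \<in> measurable \<nu> \<nu>"
    unfolding measurable_cong_sets[OF refl sets_levy]
    by (intro measurable_restrict_space2 measurable_levy) (auto simp: space_levy)
  show "sets (distr \<nu> \<nu> uminus) = sets \<nu>" by simp
  fix A assume "A \<in> sets (distr \<nu> \<nu> uminus)"
  then have A: "A \<in> sets \<nu>" by simp
  have "uminus -` A \<inter> space \<nu> = uminus ` A"
    using sets.sets_into_space[OF A] by (auto simp: space_levy image_iff) (metis minus_minus)+
  then show "emeasure (distr \<nu> \<nu> uminus) A = emeasure \<nu> A"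
    using levy A by (simp add: emeasure_distr[OF meas A] symmetric_levy_measure_def)
qed

text \<open>Reflection leaves the measure invariant and changes the sign of the integral. Change of
  variables and the sign rule hold for the Bochner integral of any measurable function, its value
  being 0 when the function is not integrable.\<close>

lemma integral_levy_odd:
  fixes f :: "real \<Rightarrow> real"
  assumes "f \<in> borel_measurable borel" "\<And>z. f (- z) = - f z"
  shows "integral\<^sup>L \<nu> f = 0"
proof -
  have meas: "uminus \<in> measurable \<nu> \<nu>"
    unfolding measurable_cong_sets[OF refl sets_levy]
    by (intro measurable_restrict_space2 measurable_levy) (auto simp: space_levy)
  have "integral\<^sup>L \<nu> f = integral\<^sup>L (distr \<nu> \<nu> uminus) f" by (simp add: distr_uminus_levy)
  also have "\<dots> = (LINT z|\<nu>. f (- z))"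
    by (rule integral_distr[OF meas measurable_levy[OF assms(1)]])
  also have "\<dots> = - integral\<^sup>L \<nu> f" using assms(2) by simp
  finally show ?thesis by simp
qed

text \<open>The imaginary part of the integrand, compensator included, is odd and integrates to 0 by
  symmetry. The only imaginary term left is the drift, so centred increments will have real
  characteristic functions.\<close>

lemma levy_exponent_eq:
  "levy_exponent b \<sigma> \<nu> u = \<i> * complex_of_real (b * u) - complex_of_real (levy_psi \<sigma> \<nu> u)"
proof -
  let ?f = "\<lambda>z. exp (\<i> * complex_of_real (u * z)) - 1
                   - \<i> * complex_of_real (u * z * indicator {z. \<bar>z\<bar> \<le> 1} z)"
  have bnd: "norm (?f z) \<le> (2 + u\<^sup>2) * min (\<bar>z\<bar>\<^sup>2) 1" for z
  proof (cases "\<bar>z\<bar> \<le> 1")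
    case True
    then have m: "min (\<bar>z\<bar>\<^sup>2) 1 = z\<^sup>2" by (simp add: abs_square_le_1 min_def)
    have "norm (?f z) = norm (iexp (u * z) - (\<Sum>k\<le>1. (\<i> * (u * z))^k / fact k))"
      using True by (simp add: algebra_simps)
    also have "\<dots> \<le> \<bar>u * z\<bar>^2 / 2" using iexp_approx1[of "u * z" 1] by (simp add: numeral_2_eq_2)
    also have "\<dots> \<le> (2 + u\<^sup>2) * z\<^sup>2" by (simp add: power_mult_distrib algebra_simps)
    finally show ?thesis unfolding m .
  next
    case False
    then have m: "min (\<bar>z\<bar>\<^sup>2) 1 = 1" using abs_square_le_1[of z] by (simp add: min_def)
    have "norm (?f z) \<le> norm (exp (\<i> * complex_of_real (u * z))) + norm (1::complex)"
      using False norm_triangle_ineq4[of "exp (\<i> * complex_of_real (u * z))" 1] by simp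
    then have "norm (?f z) \<le> 2" by simp
    then show ?thesis unfolding m by (simp add: add_increasing2)
  qed
  have int: "integrable \<nu> ?f"
    by (rule integrable_levy_bound[OF _ bnd]) measurable
  have "Re (integral\<^sup>L \<nu> ?f) = (LINT z|\<nu>. - (1 - cos (u * z)))"
    unfolding integral_Re[OF int, symmetric] by (rule Bochner_Integration.integral_cong) (auto simp: Re_exp)
  also have "\<dots> = - (LINT z|\<nu>. 1 - cos (u * z))" by (rule integral_minus)
  finally have "Re (integral\<^sup>L \<nu> ?f) = - (LINT z|\<nu>. 1 - cos (u * z))" .
  moreover have "Im (integral\<^sup>L \<nu> ?f) = 0"
    unfolding integral_Im[OF int, symmetric]
    by (rule integral_levy_odd) (measurable, auto simp: Im_exp indicator_def)
  ultimately show ?thesis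
    unfolding levy_exponent_def levy_psi_def by (simp add: complex_eq_iff)
qed

lemma levy_psi_nonneg: "0 \<le> levy_psi \<sigma> \<nu> u"
  unfolding levy_psi_def by (intro add_nonneg_nonneg Bochner_Integration.integral_nonneg) auto

lemma levy_psi_0: "levy_psi \<sigma> \<nu> 0 = 0"
  unfolding levy_psi_def by simp

lemma continuous_levy_psi: "continuous_on UNIV (levy_psi \<sigma> \<nu>)"
proof -
  have "isCont (levy_psi \<sigma> \<nu>) u" for u
    unfolding continuous_at_sequentially comp_def
  proof (intro allI impI)
    fix x :: "nat \<Rightarrow> real" assume x: "x \<longlonglongrightarrow> u"
    then obtain B where B: "\<And>n. \<bar>x n\<bar> \<le> B"
      using convergent_imp_Bseq[of x] unfolding convergent_def Bseq_def by auto
    have "(\<lambda>n. LINT z|\<nu>. 1 - cos (x n * z)) \<longlonglongrightarrow> (LINT z|\<nu>. 1 - cos (u * z))"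
    proof (rule integral_dominated_convergence[where w = "\<lambda>z. (2 + B\<^sup>2) * min (\<bar>z\<bar>\<^sup>2) 1"])
      show "integrable \<nu> (\<lambda>z. (2 + B\<^sup>2) * min (\<bar>z\<bar>\<^sup>2) 1)" using integrable_levy_min by simp
      show "AE z in \<nu>. (\<lambda>n. 1 - cos (x n * z)) \<longlonglongrightarrow> 1 - cos (u * z)"
        by (intro AE_I2 tendsto_intros x)
      have "1 - cos (x n * z) \<le> (2 + B\<^sup>2) * min (\<bar>z\<bar>\<^sup>2) 1" for n z
      proof -
        have "(x n)\<^sup>2 \<le> B\<^sup>2" using B[of n] by (metis abs_le_square_iff abs_ge_self order_trans)
        then have "(2 + (x n)\<^sup>2) * min (\<bar>z\<bar>\<^sup>2) 1 \<le> (2 + B\<^sup>2) * min (\<bar>z\<bar>\<^sup>2) 1"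
          by (intro mult_right_mono) auto
        with one_minus_cos_le_min[of "x n" z] show ?thesis by simp
      qed
      then show "AE z in \<nu>. norm (1 - cos (x n * z)) \<le> (2 + B\<^sup>2) * min (\<bar>z\<bar>\<^sup>2) 1" for n by simp
    qed (auto intro!: measurable_levy)
    then show "(\<lambda>n. levy_psi \<sigma> \<nu> (x n)) \<longlonglongrightarrow> levy_psi \<sigma> \<nu> u"
      unfolding levy_psi_def by (intro tendsto_intros x) auto
  qed
  then show ?thesis by (simp add: continuous_at_imp_continuous_on)
qed

text \<open>Small jumps contribute through \<open>1 - cos x \<le> 2 * \<bar>x\<bar> powr p\<close>,
  valid because \<open>p \<le> 2\<close>, and jumps larger than 1 contribute a bounded amount. A
  Gaussian part would add quadratic growth, hence the value 0 in place of \<sigma>.\<close>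

lemma levy_psi_growth:
  assumes p: "0 < p" "p \<le> 2"
    and int: "(\<integral>\<^sup>+ z. ennreal (\<bar>z\<bar> powr p) * indicator {z. \<bar>z\<bar> \<le> 1} z \<partial>\<nu>) < \<infinity>"
  shows "\<exists>K\<ge>0. \<forall>s\<ge>0. levy_psi 0 \<nu> s \<le> K * (1 + s powr p)"
proof -
  have int': "integrable \<nu> (\<lambda>z. \<bar>z\<bar> powr p * indicator {z. \<bar>z\<bar> \<le> 1} z)"
    using int by (intro integrableI_nonneg measurable_levy) (auto simp: ennreal_mult ennreal_indicator)
  have 1: "1 - cos x \<le> 2 * \<bar>x\<bar> powr p" for x :: real
  proof (cases "\<bar>x\<bar> \<le> 1")
    case True
    have "\<bar>x\<bar>\<^sup>2 \<le> \<bar>x\<bar> powr p"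
      using True p powr_mono'[of p 2 "\<bar>x\<bar>"] by (cases "x = 0") auto
    moreover have "0 \<le> \<bar>x\<bar> powr p" by simp
    ultimately show ?thesis using one_minus_cos_le_square[of x] unfolding power2_abs by linarith
  next
    case False
    then have "1 \<le> \<bar>x\<bar> powr p" using p by (intro ge_one_powr_ge_zero) auto
    then show ?thesis using cos_ge_minus_one[of x] by linarith
  qed
  define K where "K = (LINT z|\<nu>. 2 * (\<bar>z\<bar> powr p * indicator {z. \<bar>z\<bar> \<le> 1} z + min (\<bar>z\<bar>\<^sup>2) 1))"
  have "levy_psi 0 \<nu> s \<le> K * (1 + s powr p)" if s: "0 \<le> s" for s
  proof -
    have "levy_psi 0 \<nu> s = (LINT z|\<nu>. 1 - cos (s * z))" by (simp add: levy_psi_def)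
    also have "\<dots> \<le> (LINT z|\<nu>. 2 * (\<bar>z\<bar> powr p * indicator {z. \<bar>z\<bar> \<le> 1} z + min (\<bar>z\<bar>\<^sup>2) 1) * (1 + s powr p))"
    proof (rule integral_mono)
      show "integrable \<nu> (\<lambda>z. 1 - cos (s * z))" by (rule integrable_levy_cos)
      show "integrable \<nu> (\<lambda>z. 2 * (\<bar>z\<bar> powr p * indicator {z. \<bar>z\<bar> \<le> 1} z + min (\<bar>z\<bar>\<^sup>2) 1) * (1 + s powr p))"
        using int' integrable_levy_min by simp
      fix z
      show "1 - cos (s * z) \<le> 2 * (\<bar>z\<bar> powr p * indicator {z. \<bar>z\<bar> \<le> 1} z + min (\<bar>z\<bar>\<^sup>2) 1) * (1 + s powr p)"
      proof (cases "\<bar>z\<bar> \<le> 1")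
        case True
        have "1 - cos (s * z) \<le> 2 * \<bar>z\<bar> powr p * s powr p"
          using 1[of "s * z"] s by (simp add: abs_mult powr_mult mult.commute)
        also have "\<dots> \<le> 2 * \<bar>z\<bar> powr p * (1 + s powr p)" by (simp add: algebra_simps)
        also have "\<dots> \<le> 2 * (\<bar>z\<bar> powr p + min (\<bar>z\<bar>\<^sup>2) 1) * (1 + s powr p)"
          by (intro mult_right_mono) (auto simp: add_increasing2)
        finally show ?thesis using True by simp
      next
        case False
        then have m: "min (\<bar>z\<bar>\<^sup>2) 1 = 1" using abs_square_le_1[of z] by (simp add: min_def)
        have "1 - cos (s * z) \<le> 2" using cos_ge_minus_one[of "s * z"] by linarith
        then show ?thesis using False unfolding m by (simp add: add_increasing2)
      qed
    qed
    finally show ?thesis unfolding K_def by simp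
  qed
  moreover have "0 \<le> K" unfolding K_def by (intro Bochner_Integration.integral_nonneg) auto
  ultimately show ?thesis by blast
qed

end

section \<open>Tails and truncated moments read off characteristic functions\<close>

context prob_space
begin

lemma integrable_one_minus_cos:
  fixes X :: "'a \<Rightarrow> real"
  assumes [measurable]: "X \<in> borel_measurable M"
  shows "integrable M (\<lambda>\<omega>. 1 - cos (u * X \<omega>))"
proof (rule integrable_const_bound[where B = 2])
  have "\<bar>1 - cos y\<bar> \<le> 2" for y :: real
    using cos_ge_minus_one[of y] cos_le_one[of y] by linarith
  then show "AE \<omega> in M. norm (1 - cos (u * X \<omega>)) \<le> 2" by simp
qed measurable

text \<open>Averaging over frequencies: the integral of \<open>1 - cos (u * x)\<close> over
  \<open>[0, \<delta>]\<close> is \<open>\<delta> - sin (\<delta> * x) / x\<close>, which is at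
  least \<open>\<delta> / 2\<close> once \<open>\<bar>x\<bar> > 2 / \<delta>\<close>; Tonelli turns
  this into a bound for the tail. Keeping the frequency integral on the right allows dominated
  convergence in \<open>u\<close> later.\<close>

lemma tail_le_integral_cos:
  fixes X :: "'a \<Rightarrow> real"
  assumes X[measurable]: "X \<in> borel_measurable M" and \<delta>: "0 < \<delta>"
  shows "ennreal (\<delta> / 2) * emeasure M {\<omega>\<in>space M. \<bar>X \<omega>\<bar> > 2 / \<delta>}
    \<le> (\<integral>\<^sup>+u\<in>{0..\<delta>}. ennreal (expectation (\<lambda>\<omega>. 1 - cos (u * X \<omega>))) \<partial>lborel)"
proof -
  interpret P: pair_sigma_finite lborel M ..
  have inner: "ennreal (\<delta> / 2) * indicator {\<omega>\<in>space M. \<bar>X \<omega>\<bar> > 2 / \<delta>} \<omega>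
      \<le> (\<integral>\<^sup>+u\<in>{0..\<delta>}. ennreal (1 - cos (u * X \<omega>)) \<partial>lborel)" for \<omega>
  proof (cases "\<bar>X \<omega>\<bar> > 2 / \<delta>")
    case True
    let ?x = "X \<omega>"
    have x: "?x \<noteq> 0" using True \<delta> by (auto simp: not_less)
    have "(\<integral>\<^sup>+u\<in>{0..\<delta>}. ennreal (1 - cos (u * ?x)) \<partial>lborel) = ennreal ((\<delta> - sin (\<delta> * ?x) / ?x) - (0 - sin (0 * ?x) / ?x))"
      using \<delta> x by (intro nn_integral_FTC_Icc) (auto intro!: derivative_eq_intros)
    moreover have "\<delta> / 2 \<le> \<delta> - sin (\<delta> * ?x) / ?x"
    proof -
      have "sin (\<delta> * ?x) / ?x \<le> \<bar>sin (\<delta> * ?x)\<bar> / \<bar>?x\<bar>" by (metis abs_divide abs_ge_self)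
      also have "\<dots> \<le> 1 / \<bar>?x\<bar>" by (intro divide_right_mono) auto
      also have "\<dots> \<le> \<delta> / 2" using True \<delta> x by (simp add: field_simps)
      finally show ?thesis by simp
    qed
    ultimately show ?thesis by (auto simp: indicator_def intro!: ennreal_leI)
  qed simp
  have "ennreal (\<delta> / 2) * emeasure M {\<omega>\<in>space M. \<bar>X \<omega>\<bar> > 2 / \<delta>}
      = (\<integral>\<^sup>+\<omega>. ennreal (\<delta> / 2) * indicator {\<omega>\<in>space M. \<bar>X \<omega>\<bar> > 2 / \<delta>} \<omega> \<partial>M)"
    by (subst nn_integral_cmult_indicator) auto
  also have "\<dots> \<le> (\<integral>\<^sup>+\<omega>. (\<integral>\<^sup>+u\<in>{0..\<delta>}. ennreal (1 - cos (u * X \<omega>)) \<partial>lborel) \<partial>M)"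
    by (intro nn_integral_mono inner)
  also have "\<dots> = (\<integral>\<^sup>+u. (\<integral>\<^sup>+\<omega>. ennreal (1 - cos (u * X \<omega>)) * indicator {0..\<delta>} u \<partial>M) \<partial>lborel)"
    by (rule P.Fubini') measurable
  also have "\<dots> = (\<integral>\<^sup>+u\<in>{0..\<delta>}. ennreal (expectation (\<lambda>\<omega>. 1 - cos (u * X \<omega>))) \<partial>lborel)"
  proof (rule nn_integral_cong)
    fix u
    have "integrable M (\<lambda>\<omega>. 1 - cos (u * X \<omega>))"
      by (rule integrable_one_minus_cos) measurable
    then show "(\<integral>\<^sup>+\<omega>. ennreal (1 - cos (u * X \<omega>)) * indicator {0..\<delta>} u \<partial>M)
        = ennreal (expectation (\<lambda>\<omega>. 1 - cos (u * X \<omega>))) * indicator {0..\<delta>} u"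
      by (subst nn_integral_multc) (auto simp: nn_integral_eq_integral)
  qed
  finally show ?thesis .
qed

lemma tail_le_of_cos:
  fixes X :: "'a \<Rightarrow> real"
  assumes X[measurable]: "X \<in> borel_measurable M" and \<delta>: "0 < \<delta>" and c: "0 \<le> c"
    and bd: "\<And>u. 0 \<le> u \<Longrightarrow> u \<le> \<delta> \<Longrightarrow> expectation (\<lambda>\<omega>. 1 - cos (u * X \<omega>)) \<le> c"
  shows "prob {\<omega>\<in>space M. \<bar>X \<omega>\<bar> > 2 / \<delta>} \<le> 2 * c"
proof -
  have "ennreal (\<delta> / 2 * prob {\<omega>\<in>space M. \<bar>X \<omega>\<bar> > 2 / \<delta>})
      \<le> (\<integral>\<^sup>+u\<in>{0..\<delta>}. ennreal (expectation (\<lambda>\<omega>. 1 - cos (u * X \<omega>))) \<partial>lborel)"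
    using tail_le_integral_cos[OF X \<delta>] \<delta> unfolding emeasure_eq_measure
    by (subst ennreal_mult) auto
  also have "\<dots> \<le> (\<integral>\<^sup>+u. ennreal c * indicator {0..\<delta>} u \<partial>lborel)"
    by (intro nn_integral_mono) (auto simp: indicator_def intro!: ennreal_leI bd)
  also have "\<dots> = ennreal (c * \<delta>)" using \<delta> c by (subst nn_integral_cmult_indicator) (auto simp: ennreal_mult)
  finally have "\<delta> / 2 * prob {\<omega>\<in>space M. \<bar>X \<omega>\<bar> > 2 / \<delta>} \<le> c * \<delta>"
    using \<delta> c by (subst (asm) ennreal_le_iff) auto
  then show ?thesis using \<delta> by (simp add: field_simps)
qed

text \<open>The single frequency \<open>1 / R\<close> suffices for the second moment: as long as
  \<open>\<bar>X \<omega>\<bar> \<le> R\<close> the rescaled argument stays in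
  \<open>[-1, 1]\<close>, where \<open>1 - cos\<close> dominates a multiple of the square.\<close>

lemma truncated_second_moment:
  fixes X :: "'a \<Rightarrow> real"
  assumes X[measurable]: "X \<in> borel_measurable M" and R: "0 < R"
    and bd: "\<And>u. expectation (\<lambda>\<omega>. 1 - cos (u * X \<omega>)) \<le> t * \<psi> u"
  shows "(\<integral>\<^sup>+\<omega>. ennreal (\<bar>X \<omega>\<bar> powr 2) * indicator {..R} \<bar>X \<omega>\<bar> \<partial>M) \<le> ennreal (4 * R\<^sup>2 * \<psi> (1 / R) * t)"
proof -
  have int: "integrable M (\<lambda>\<omega>. 1 - cos (u * X \<omega>))" for u
    by (rule integrable_one_minus_cos) measurable
  have "(\<integral>\<^sup>+\<omega>. ennreal (\<bar>X \<omega>\<bar> powr 2) * indicator {..R} \<bar>X \<omega>\<bar> \<partial>M)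
      \<le> (\<integral>\<^sup>+\<omega>. ennreal (4 * R\<^sup>2 * (1 - cos (1 / R * X \<omega>))) \<partial>M)"
  proof (rule nn_integral_mono)
    fix \<omega>
    have "\<bar>X \<omega>\<bar> powr 2 \<le> 4 * R\<^sup>2 * (1 - cos (1 / R * X \<omega>))" if "\<bar>X \<omega>\<bar> \<le> R"
      using one_minus_cos_ge_square[of "1 / R * X \<omega>"] R that by (simp add: field_simps power_divide abs_mult)
    then show "ennreal (\<bar>X \<omega>\<bar> powr 2) * indicator {..R} \<bar>X \<omega>\<bar> \<le> ennreal (4 * R\<^sup>2 * (1 - cos (1 / R * X \<omega>)))"
      by (auto simp: indicator_def intro!: ennreal_leI)
  qed
  also have "\<dots> = ennreal (expectation (\<lambda>\<omega>. 4 * R\<^sup>2 * (1 - cos (1 / R * X \<omega>))))"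
    using int[of "1 / R"] by (intro nn_integral_eq_integral) auto
  also have "\<dots> = ennreal (4 * R\<^sup>2 * expectation (\<lambda>\<omega>. 1 - cos (1 / R * X \<omega>)))" by simp
  also have "\<dots> \<le> ennreal (4 * R\<^sup>2 * (t * \<psi> (1 / R)))"
    by (intro ennreal_leI mult_left_mono bd) auto
  finally show ?thesis by (simp add: mult_ac)
qed

text \<open>Below the second moment, \<open>|x|\<^sup>q\<close> is dominated by the dyadic sum
  \<open>\<Sum>k. 2\<^sup>-\<^sup>k\<^sup>q (1 - cos (2\<^sup>k x))\<close>.\<close>

lemma truncated_moment:
  fixes \<psi> :: "real \<Rightarrow> real"
  assumes R: "0 < R" and pq: "0 < p" "p < q"
    and grow: "\<And>s. 0 \<le> s \<Longrightarrow> \<psi> s \<le> B * (1 + s powr p)" and B: "0 \<le> B"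
  shows "\<exists>K\<ge>0. \<forall>X t. X \<in> borel_measurable M \<longrightarrow> 0 \<le> t \<longrightarrow>
     (\<forall>u. expectation (\<lambda>\<omega>. 1 - cos (u * X \<omega>)) \<le> t * \<psi> u) \<longrightarrow>
     (\<integral>\<^sup>+\<omega>. ennreal (\<bar>X \<omega>\<bar> powr q) * indicator {..R} \<bar>X \<omega>\<bar> \<partial>M) \<le> ennreal (K * t)"
proof -
  define w where "w k = (2 powr (- q)) ^ k" for k :: nat
  have w: "0 \<le> w k" for k by (simp add: w_def)
  define e where "e k = w k * (B * (1 + (2 ^ k / R) powr p))" for k :: nat
  have e: "0 \<le> e k" for k using B by (simp add: e_def w_def)
  \<comment> \<open>The error splits into two geometric sequences. The ratio
    \<open>2 powr (p - q)\<close> of the second is below 1 because the growth exponent is smaller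
    than the moment exponent.\<close>
  have e_eq: "e k = B * (2 powr (- q)) ^ k + B * R powr (- p) * (2 powr (p - q)) ^ k" for k
  proof -
    have "(2 ^ k / R) powr p = R powr (- p) * (2 powr p) ^ k"
      using R by (simp add: powr_divide powr_realpow[symmetric] powr_powr powr_minus mult.commute field_simps)
    moreover have "(2 powr (p - q) :: real) = 2 powr p * 2 powr (- q)" by (simp add: powr_add[symmetric])
    ultimately show ?thesis by (simp add: e_def w_def algebra_simps power_mult_distrib)
  qed
  have "2 powr (- q) < (1::real)" "2 powr (p - q) < (1::real)" using pq by (auto simp: powr_less_one)
  then have sm: "summable e"
    unfolding e_eq[abs_def] by (intro summable_add summable_mult summable_geometric) auto
  define K where "K = 16 * R powr q * suminf e"
  have K: "0 \<le> K" using e sm by (simp add: K_def suminf_nonneg)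
  have "(\<integral>\<^sup>+\<omega>. ennreal (\<bar>X \<omega>\<bar> powr q) * indicator {..R} \<bar>X \<omega>\<bar> \<partial>M) \<le> ennreal (K * t)"
    if X[measurable]: "X \<in> borel_measurable M" and t: "0 \<le> t"
      and bd: "\<And>u. expectation (\<lambda>\<omega>. 1 - cos (u * X \<omega>)) \<le> t * \<psi> u" for X t
  proof -
    let ?c = "\<lambda>k \<omega>. 1 - cos (2 ^ k / R * X \<omega>)"
    have int: "integrable M (?c k)" for k
      by (rule integrable_one_minus_cos) (rule X)
    have "(\<integral>\<^sup>+\<omega>. ennreal (\<bar>X \<omega>\<bar> powr q) * indicator {..R} \<bar>X \<omega>\<bar> \<partial>M)
        \<le> (\<integral>\<^sup>+\<omega>. (\<Sum>k. ennreal (16 * R powr q * w k * ?c k \<omega>)) \<partial>M)"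
    proof (rule nn_integral_mono)
      fix \<omega>
      show "ennreal (\<bar>X \<omega>\<bar> powr q) * indicator {..R} \<bar>X \<omega>\<bar> \<le> (\<Sum>k. ennreal (16 * R powr q * w k * ?c k \<omega>))"
      proof (cases "X \<omega> \<noteq> 0 \<and> \<bar>X \<omega>\<bar> \<le> R")
        case True
        define y where "y = X \<omega> / R"
        \<comment> \<open>The dyadic frequency is matched to the size of \<open>X \<omega>\<close>:
          after rescaling, \<open>\<bar>z\<bar>\<close> lies between 1/2 and 1, so
          \<open>1 - cos z\<close> is at least 1/16 and this one term of the series already
          dominates.\<close>
        obtain k :: nat where k: "1 * (1/2) ^ Suc k < \<bar>y\<bar>" "\<bar>y\<bar> \<le> 1 * (1/2) ^ k"
          using ex_dyadic_scale[of "\<bar>y\<bar>" 1] True R by (auto simp: y_def)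
        define z where "z = 2 ^ k * y"
        have z: "1 / 2 \<le> \<bar>z\<bar>" "\<bar>z\<bar> \<le> 1"
          using k by (auto simp: z_def abs_mult field_simps power_divide)
        have "(1/2)\<^sup>2 \<le> \<bar>z\<bar>\<^sup>2" using z by (intro power_mono) auto
        then have "1 / 16 \<le> z\<^sup>2 / 4" by (simp add: power_divide)
        also have "\<dots> \<le> 1 - cos z" using z by (intro one_minus_cos_ge_square)
        finally have c: "1 \<le> 16 * ?c k \<omega>" by (simp add: z_def y_def)
        have "\<bar>y\<bar> powr q \<le> ((1/2) ^ k) powr q" using k pq by (intro powr_mono2) auto
        also have "\<dots> = w k"
          by (simp add: w_def powr_realpow[symmetric] powr_powr powr_minus powr_divide power_one_over mult.commute inverse_eq_divide)
        finally have "\<bar>y\<bar> powr q \<le> w k" .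
        moreover have "\<bar>X \<omega>\<bar> powr q = R powr q * \<bar>y\<bar> powr q" using R by (simp add: y_def abs_divide powr_divide)
        ultimately have "\<bar>X \<omega>\<bar> powr q \<le> R powr q * w k" by (simp add: mult_left_mono)
        also have "\<dots> \<le> R powr q * w k * (16 * ?c k \<omega>)" 
          using mult_left_mono[OF c, of "R powr q * w k"] w[of k] by simp
        finally have "ennreal (\<bar>X \<omega>\<bar> powr q) * indicator {..R} \<bar>X \<omega>\<bar> \<le> ennreal (16 * R powr q * w k * ?c k \<omega>)"
          using True by (auto intro!: ennreal_leI simp: mult_ac)
        also have "\<dots> = (\<Sum>k\<in>{k}. ennreal (16 * R powr q * w k * ?c k \<omega>))" by simp
        also have "\<dots> \<le> (\<Sum>k. ennreal (16 * R powr q * w k * ?c k \<omega>))" by (rule sum_le_suminf) auto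
        finally show ?thesis .
      qed (auto simp: indicator_def)
    qed
    also have "\<dots> = (\<Sum>k. \<integral>\<^sup>+\<omega>. ennreal (16 * R powr q * w k * ?c k \<omega>) \<partial>M)"
      by (rule nn_integral_suminf) measurable
    also have "\<dots> \<le> (\<Sum>k. ennreal (16 * R powr q * t * e k))"
    proof (rule suminf_le)
      fix k
      have "(\<integral>\<^sup>+\<omega>. ennreal (16 * R powr q * w k * ?c k \<omega>) \<partial>M) = ennreal (expectation (\<lambda>\<omega>. 16 * R powr q * w k * ?c k \<omega>))"
        using int[of k] w by (intro nn_integral_eq_integral) auto
      also have "\<dots> = ennreal (16 * R powr q * w k * expectation (?c k))" by (subst integral_mult_right_zero) simp
      also have "\<dots> \<le> ennreal (16 * R powr q * w k * (t * (B * (1 + (2 ^ k / R) powr p))))"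
        using w t R by (intro ennreal_leI mult_left_mono order_trans[OF bd] grow) auto
      finally show "(\<integral>\<^sup>+\<omega>. ennreal (16 * R powr q * w k * ?c k \<omega>) \<partial>M) \<le> ennreal (16 * R powr q * t * e k)"
        by (simp add: e_def mult_ac)
    qed auto
    also have "\<dots> = ennreal (\<Sum>k. 16 * R powr q * t * e k)"
      using e t sm by (intro suminf_ennreal2 summable_mult) auto
    also have "(\<Sum>k. 16 * R powr q * t * e k) = K * t" using sm by (simp add: suminf_mult K_def)
    finally show ?thesis .
  qed
  with K show ?thesis by blast
qed

end

section \<open>Truncated sums over disjoint cells\<close>

text \<open>From here on the noise enters through a continuous even function \<psi> and the drift
  \<open>b\<close>; the Levy measure returns only when the locale is instantiated. The drift stays
  explicit because symmetry of the jumps does not remove it.\<close>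

locale symmetric_noise = prob_space M for M :: "'w measure" +
  fixes D :: "(real^'d) set" and \<xi> :: "(real^'d) set \<Rightarrow> 'w \<Rightarrow> real" and b :: real
    and \<psi> :: "real \<Rightarrow> real"
  assumes D_borel: "D \<in> sets borel" and D_finite: "emeasure lborel D < \<infinity>"
    and scattered: "independently_scattered M D \<xi>"
    and psi_nonneg: "0 \<le> \<psi> u" and psi_0: "\<psi> 0 = 0" and psi_even: "\<psi> (- u) = \<psi> u"
    and psi_cont: "continuous_on UNIV \<psi>"
    and cf: "A \<in> sets (restrict_space borel D) \<Longrightarrow>
      (CLINT \<omega>|M. exp (\<i> * complex_of_real (u * \<xi> A \<omega>)))
        = exp (complex_of_real (measure lborel A) * (\<i> * complex_of_real (b * u) - complex_of_real (\<psi> u)))"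
begin

definition vol :: "(real^'d) measure" where "vol = restrict_space lborel D"

text \<open>Subtracting the deterministic drift makes the law symmetric. Truncations are applied to
  these centred increments, and the drift is added back afterwards.\<close>

definition \<eta> :: "(real^'d) set \<Rightarrow> 'w \<Rightarrow> real" where
  "\<eta> A \<omega> = \<xi> A \<omega> - b * measure lborel A"

lemma sets_vol: "sets vol = sets (restrict_space borel D)"
  unfolding vol_def by (intro sets_restrict_space_cong) simp

lemma space_vol [simp]: "space vol = D"
  using D_borel by (simp add: vol_def space_restrict_space)

lemma D_in_vol [simp]: "D \<in> sets vol"
  using sets.top[of vol] by simp

lemma sets_vol_iff: "A \<in> sets vol \<longleftrightarrow> A \<subseteq> D \<and> A \<in> sets borel"
  using D_borel by (simp add: sets_vol sets_restrict_space_iff)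

lemma emeasure_vol: "A \<in> sets vol \<Longrightarrow> emeasure vol A = emeasure lborel A"
  using D_borel sets_vol_iff[of A] unfolding vol_def by (subst emeasure_restrict_space) auto

lemma measure_vol: "A \<in> sets vol \<Longrightarrow> measure vol A = measure lborel A"
  by (simp add: measure_def emeasure_vol)

lemma finite_measure_vol: "finite_measure vol"
  using D_finite emeasure_vol[of D] by (intro finite_measureI) (auto simp: less_top[symmetric])

sublocale vol: finite_measure vol by (rule finite_measure_vol)

lemma measurable_vol_iff: "f \<in> measurable vol N \<longleftrightarrow> f \<in> measurable (restrict_space borel D) N"
  by (simp add: measurable_cong_sets[OF sets_vol refl])

lemma simple_function_vol_iff: "simple_function vol f \<longleftrightarrow> simple_function (restrict_space borel D) f"
  using D_borel by (simp add: simple_function_def sets_vol space_restrict_space)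

lemma xi_measurable [measurable]: "A \<in> sets vol \<Longrightarrow> \<xi> A \<in> borel_measurable M"
  using scattered by (simp add: independently_scattered_def sets_vol)

lemma eta_measurable [measurable]: "A \<in> sets vol \<Longrightarrow> \<eta> A \<in> borel_measurable M"
  unfolding \<eta>_def[abs_def] by (intro borel_measurable_diff xi_measurable borel_measurable_const)

lemma char_eta:
  assumes A: "A \<in> sets vol"
  shows "char (distr M borel (\<eta> A)) u = complex_of_real (exp (- (measure vol A * \<psi> u)))"
proof -
  note [measurable] = A
  let ?m = "measure lborel A"
  have "char (distr M borel (\<eta> A)) u = (CLINT \<omega>|M. iexp (u * \<eta> A \<omega>))"
    by (simp add: char_def integral_distr)
  also have "\<dots> = (CLINT \<omega>|M. exp (- (\<i> * complex_of_real (u * b * ?m))) * exp (\<i> * complex_of_real (u * \<xi> A \<omega>)))"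
    by (simp add: \<eta>_def exp_add[symmetric] algebra_simps)
  also have "\<dots> = exp (- (\<i> * complex_of_real (u * b * ?m))) * (CLINT \<omega>|M. exp (\<i> * complex_of_real (u * \<xi> A \<omega>)))"
    by (rule integral_mult_right_zero)
  also have "\<dots> = exp (- (\<i> * complex_of_real (u * b * ?m)) + complex_of_real ?m * (\<i> * complex_of_real (b * u) - complex_of_real (\<psi> u)))"
    using A by (simp only: cf[of A u] sets_vol exp_add)
  also have "\<dots> = exp (complex_of_real (- (?m * \<psi> u)))" by (simp add: algebra_simps)
  finally show ?thesis by (simp only: exp_of_real measure_vol[OF A])
qed

text \<open>The characteristic function of the centred increment is even, hence also that of its
  negative; by uniqueness of characteristic functions both have the same law.\<close>

lemma expectation_odd_eta:
  fixes g :: "real \<Rightarrow> real"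
  assumes A: "A \<in> sets vol" and g[measurable]: "g \<in> borel_measurable borel" and odd: "\<And>x. g (- x) = - g x"
  shows "expectation (\<lambda>\<omega>. g (\<eta> A \<omega>)) = 0"
proof -
  note [measurable] = A
  have "distr M borel (\<eta> A) = distr M borel (\<lambda>\<omega>. - \<eta> A \<omega>)"
  proof (rule Levy_uniqueness)
    show "char (distr M borel (\<eta> A)) = char (distr M borel (\<lambda>\<omega>. - \<eta> A \<omega>))"
    proof
      fix u
      have "char (distr M borel (\<lambda>\<omega>. - \<eta> A \<omega>)) u = char (distr M borel (\<eta> A)) (- u)"
        by (simp add: char_def integral_distr)
      then show "char (distr M borel (\<eta> A)) u = char (distr M borel (\<lambda>\<omega>. - \<eta> A \<omega>)) u"
        by (simp add: char_eta[OF A] psi_even)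
    qed
  qed auto
  then have "integral\<^sup>L (distr M borel (\<eta> A)) g = integral\<^sup>L (distr M borel (\<lambda>\<omega>. - \<eta> A \<omega>)) g" by simp
  then have "expectation (\<lambda>\<omega>. g (\<eta> A \<omega>)) = expectation (\<lambda>\<omega>. g (- \<eta> A \<omega>))"
    by (simp add: integral_distr)
  then show ?thesis by (simp add: odd)
qed

lemma cos_eq_Re_char:
  assumes [measurable]: "X \<in> borel_measurable M"
  shows "expectation (\<lambda>\<omega>. 1 - cos (u * X \<omega>)) = 1 - Re (char (distr M borel X) u)"
proof -
  have int: "integrable M (\<lambda>\<omega>. iexp (u * X \<omega>))"
    by (rule integrable_const_bound[where B = 1]) auto
  have "Re (char (distr M borel X) u) = Re (CLINT \<omega>|M. iexp (u * X \<omega>))"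
    by (simp add: char_def integral_distr)
  also have "\<dots> = expectation (\<lambda>\<omega>. cos (u * X \<omega>))"
    using integral_Re[OF int] by (simp add: Re_exp)
  finally show ?thesis
    using integrable_Re[OF int] by (subst Bochner_Integration.integral_diff) (auto simp: Re_exp prob_space)
qed

text \<open>From \<open>1 - exp (- t) \<le> t\<close>. A bound linear in the measure of the cell can
  be summed over a partition without any dependence on the number of cells.\<close>

lemma one_minus_cos_eta_le:
  assumes A: "A \<in> sets vol"
  shows "expectation (\<lambda>\<omega>. 1 - cos (u * \<eta> A \<omega>)) \<le> measure vol A * \<psi> u"
proof -
  have "expectation (\<lambda>\<omega>. 1 - cos (u * \<eta> A \<omega>)) = 1 - exp (- (measure vol A * \<psi> u))"
    by (simp add: cos_eq_Re_char[OF eta_measurable[OF A]] char_eta[OF A] del: of_real_exp)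
  also have "\<dots> \<le> measure vol A * \<psi> u" using exp_ge_add_one_self[of "- (measure vol A * \<psi> u)"] by linarith
  finally show ?thesis .
qed

context
  fixes B :: "nat \<Rightarrow> (real^'d) set" and N :: nat
  assumes B: "\<And>n. n < N \<Longrightarrow> B n \<in> sets vol" and disj: "disjoint_family_on B {..<N}"
begin

text \<open>Independent scattering is defined for sequences, so a finite family is continued by
  empty sets, which are disjoint from everything, including each other.\<close>

lemma padded_family:
  defines "B' \<equiv> \<lambda>n. if n < N then B n else {}"
  shows "range B' \<subseteq> sets (restrict_space borel D)" "disjoint_family B'"
  using B disj by (auto simp: B'_def sets_vol disjoint_family_on_def)

lemma indep_xi: "indep_vars (\<lambda>_. borel) (\<lambda>n. \<xi> (B n)) {..<N}"
proof -
  have "indep_vars (\<lambda>_. borel) (\<lambda>n. \<xi> (if n < N then B n else {})) UNIV"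
    using scattered padded_family by (simp add: independently_scattered_def)
  then have "indep_vars (\<lambda>_. borel) (\<lambda>n. \<xi> (if n < N then B n else {})) {..<N}"
    by (rule indep_vars_subset) auto
  then show ?thesis by (rule indep_vars_cong[THEN iffD1, rotated -1]) auto
qed

lemma indep_eta: "indep_vars (\<lambda>_. borel) (\<lambda>n. \<eta> (B n)) {..<N}"
  unfolding \<eta>_def[abs_def] using indep_vars_compose2[OF indep_xi, of "\<lambda>n x. x - b * measure lborel (B n)" "\<lambda>_. borel"]
  by auto

lemma char_sum_eta:
  "char (distr M borel (\<lambda>\<omega>. \<Sum>n<N. c n * \<eta> (B n) \<omega>)) u
    = complex_of_real (exp (- (\<Sum>n<N. measure vol (B n) * \<psi> (u * c n))))"
proof -
  have "indep_vars (\<lambda>_. borel) (\<lambda>n \<omega>. c n * \<eta> (B n) \<omega>) {..<N}"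
    using indep_vars_compose2[OF indep_eta, of "\<lambda>n x. c n * x" "\<lambda>_. borel"] by auto
  then have "char (distr M borel (\<lambda>\<omega>. \<Sum>n<N. c n * \<eta> (B n) \<omega>)) u
      = (\<Prod>n<N. char (distr M borel (\<lambda>\<omega>. c n * \<eta> (B n) \<omega>)) u)"
    by (rule char_distr_sum)
  also have "\<dots> = (\<Prod>n<N. complex_of_real (exp (- (measure vol (B n) * \<psi> (u * c n)))))"
  proof (rule prod.cong)
    fix n assume "n \<in> {..<N}"
    then have Bn[measurable]: "B n \<in> sets vol" using B by auto
    have "char (distr M borel (\<lambda>\<omega>. c n * \<eta> (B n) \<omega>)) u = char (distr M borel (\<eta> (B n))) (u * c n)"
      by (simp add: char_def integral_distr mult.assoc)
    then show "char (distr M borel (\<lambda>\<omega>. c n * \<eta> (B n) \<omega>)) u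
        = complex_of_real (exp (- (measure vol (B n) * \<psi> (u * c n))))"
      by (simp add: char_eta[OF Bn])
  qed simp
  also have "\<dots> = complex_of_real (exp (- (\<Sum>n<N. measure vol (B n) * \<psi> (u * c n))))"
    by (simp add: exp_sum sum_negf[symmetric] del: of_real_exp)
  finally show ?thesis .
qed

lemma finite_additivity_nat: "AE \<omega> in M. \<xi> (\<Union>n<N. B n) \<omega> = (\<Sum>n<N. \<xi> (B n) \<omega>)"
proof -
  have "AE \<omega> in M. (\<lambda>n. \<xi> (if n < N then B n else {}) \<omega>) sums \<xi> (\<Union>n. if n < N then B n else {}) \<omega>"
    using scattered padded_family unfolding independently_scattered_def by blast
  \<comment> \<open>That the empty set carries no mass is itself a consequence of additivity: a
    constant series converges only if its terms vanish.\<close>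
  moreover have "AE \<omega> in M. (\<lambda>n::nat. \<xi> {} \<omega>) sums \<xi> (\<Union>n::nat. {}) \<omega>"
  proof -
    have "range (\<lambda>n::nat. {}) \<subseteq> sets (restrict_space borel D)" "disjoint_family (\<lambda>n::nat. {})"
      by (auto simp: disjoint_family_on_def)
    then show ?thesis using scattered unfolding independently_scattered_def by blast
  qed
  ultimately show ?thesis
  proof eventually_elim
    case (elim \<omega>)
    have "summable (\<lambda>n::nat. \<xi> {} \<omega>)" using elim(2) by (rule sums_summable)
    then have z: "\<xi> {} \<omega> = 0" by (simp add: summable_const_iff)
    have "(\<lambda>n. \<xi> (if n < N then B n else {}) \<omega>) sums (\<Sum>n<N. \<xi> (if n < N then B n else {}) \<omega>)"
      by (rule sums_finite) (auto simp: z)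
    moreover have "(\<Union>n. if n < N then B n else {}) = (\<Union>n<N. B n)" by (auto split: if_splits)
    ultimately show ?case using elim(1) sums_unique2 by fastforce
  qed
qed

text \<open>The large terms \<open>\<bar>c n * \<eta> (B n)\<bar> > 1\<close> are summed absolutely; the small ones are
  symmetric and independent, hence orthogonal.\<close>

lemma truncated_sum_bound:
  assumes q: "1 \<le> q" "q \<le> 2" and K: "0 \<le> K" and \<delta>: "0 < \<delta>"
    and mom: "\<And>n. n < N \<Longrightarrow>
      (\<integral>\<^sup>+\<omega>. ennreal (\<bar>\<eta> (B n) \<omega>\<bar> powr q) * indicator {..R} \<bar>\<eta> (B n) \<omega>\<bar> \<partial>M) \<le> ennreal (K * measure vol (B n))"
  shows "(\<integral>\<^sup>+\<omega>. ennreal \<bar>\<Sum>n<N. c n * (\<eta> (B n) \<omega> * indicator {..R} \<bar>\<eta> (B n) \<omega>\<bar>)\<bar> \<partial>M)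
    \<le> ennreal (\<delta> + (1 + 1 / \<delta>) * K * (\<Sum>n<N. \<bar>c n\<bar> powr q * measure vol (B n)))"
proof -
  have Bm[measurable]: "n \<in> {..<N} \<Longrightarrow> \<eta> (B n) \<in> borel_measurable M" for n using B by auto
  define s where "s n x = (if \<bar>x\<bar> \<le> R \<and> \<bar>c n * x\<bar> \<le> 1 then c n * x else 0)" for n x
  define l where "l n x = (if \<bar>x\<bar> \<le> R \<and> \<bar>c n * x\<bar> > 1 then c n * x else 0)" for n x
  have sm[measurable]: "s n \<in> borel_measurable borel" and lm[measurable]: "l n \<in> borel_measurable borel" for n
    unfolding s_def[abs_def] l_def[abs_def] by measurable
  have sb: "\<bar>s n x\<bar> \<le> 1" for n x by (simp add: s_def)
  define m where "m n = (\<integral>\<^sup>+\<omega>. ennreal (\<bar>c n * \<eta> (B n) \<omega>\<bar> powr q) * indicator {..R} \<bar>\<eta> (B n) \<omega>\<bar> \<partial>M)" for n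
  have m: "m n \<le> ennreal (K * (\<bar>c n\<bar> powr q * measure vol (B n)))" if n: "n < N" for n
  proof -
    have "m n = (\<integral>\<^sup>+\<omega>. ennreal (\<bar>c n\<bar> powr q) * (ennreal (\<bar>\<eta> (B n) \<omega>\<bar> powr q) * indicator {..R} \<bar>\<eta> (B n) \<omega>\<bar>) \<partial>M)"
      unfolding m_def by (intro nn_integral_cong) (simp add: abs_mult powr_mult ennreal_mult mult.assoc)
    also have "\<dots> = ennreal (\<bar>c n\<bar> powr q) * (\<integral>\<^sup>+\<omega>. ennreal (\<bar>\<eta> (B n) \<omega>\<bar> powr q) * indicator {..R} \<bar>\<eta> (B n) \<omega>\<bar> \<partial>M)"
      using Bm n by (intro nn_integral_cmult) auto
    also have "\<dots> \<le> ennreal (\<bar>c n\<bar> powr q) * ennreal (K * measure vol (B n))"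
      by (intro mult_left_mono mom n) auto
    also have "\<dots> = ennreal (K * (\<bar>c n\<bar> powr q * measure vol (B n)))"
      using K by (subst ennreal_mult[symmetric]) (auto simp: mult_ac)
    finally show ?thesis .
  qed
  define \<Sigma> where "\<Sigma> = (\<Sum>n<N. \<bar>c n\<bar> powr q * measure vol (B n))"
  have \<Sigma>: "0 \<le> \<Sigma>" unfolding \<Sigma>_def by (intro sum_nonneg) auto
  have sum_m: "(\<Sum>n<N. m n) \<le> ennreal (K * \<Sigma>)"
  proof -
    have "(\<Sum>n<N. m n) \<le> (\<Sum>n<N. ennreal (K * (\<bar>c n\<bar> powr q * measure vol (B n))))"
      by (intro sum_mono m) auto
    also have "\<dots> = ennreal (K * \<Sigma>)" unfolding \<Sigma>_def sum_distrib_left using K by (intro sum_ennreal) auto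
    finally show ?thesis .
  qed
  define Y where "Y \<omega> = (\<Sum>n<N. s n (\<eta> (B n) \<omega>))" for \<omega>
  have Ym[measurable]: "Y \<in> borel_measurable M" unfolding Y_def[abs_def] by measurable
  have int_s: "integrable M (\<lambda>\<omega>. s n (\<eta> (B n) \<omega>))" if "n < N" for n
    using that by (intro integrable_const_bound[where B = 1]) (auto simp: sb)
  have int_ss: "integrable M (\<lambda>\<omega>. s n (\<eta> (B n) \<omega>) * s k (\<eta> (B k) \<omega>))" if "n < N" "k < N" for n k
    using that by (intro integrable_const_bound[where B = 1]) (auto simp: sb abs_mult mult_le_one)
  \<comment> \<open>The conditions in \<open>s\<close> depend on absolute values only, so
    \<open>s n\<close> is odd and its expectation vanishes; independence over disjoint cells then
    gives orthogonality.\<close>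
  have orth: "expectation (\<lambda>\<omega>. s n (\<eta> (B n) \<omega>) * s k (\<eta> (B k) \<omega>)) = 0" if nk: "n < N" "k < N" "n \<noteq> k" for n k
  proof -
    have "indep_vars (\<lambda>_. borel) (\<lambda>n \<omega>. s n (\<eta> (B n) \<omega>)) {n, k}"
      using indep_vars_subset[OF indep_vars_compose2[OF indep_eta, of s "\<lambda>_. borel"], of "{n, k}"] nk by auto
    then have "expectation (\<lambda>\<omega>. \<Prod>i\<in>{n, k}. s i (\<eta> (B i) \<omega>)) = (\<Prod>i\<in>{n, k}. expectation (\<lambda>\<omega>. s i (\<eta> (B i) \<omega>)))"
      using nk by (intro indep_vars_lebesgue_integral) (auto intro: int_s)
    moreover have "expectation (\<lambda>\<omega>. s n (\<eta> (B n) \<omega>)) = 0"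
      using nk B by (intro expectation_odd_eta) (auto simp: s_def)
    ultimately show ?thesis using nk by simp
  qed
  have Y2: "(\<integral>\<^sup>+\<omega>. ennreal ((Y \<omega>)\<^sup>2) \<partial>M) \<le> ennreal (K * \<Sigma>)"
  proof -
    have sq: "(Y \<omega>)\<^sup>2 = (\<Sum>n<N. \<Sum>k<N. s n (\<eta> (B n) \<omega>) * s k (\<eta> (B k) \<omega>))" for \<omega>
      by (simp add: Y_def power2_eq_square sum_product)
    have "integrable M (\<lambda>\<omega>. (Y \<omega>)\<^sup>2)"
      unfolding sq by (intro Bochner_Integration.integrable_sum int_ss) auto
    then have "(\<integral>\<^sup>+\<omega>. ennreal ((Y \<omega>)\<^sup>2) \<partial>M) = ennreal (expectation (\<lambda>\<omega>. (Y \<omega>)\<^sup>2))"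
      by (intro nn_integral_eq_integral) auto
    also have "expectation (\<lambda>\<omega>. (Y \<omega>)\<^sup>2) = (\<Sum>n<N. \<Sum>k<N. expectation (\<lambda>\<omega>. s n (\<eta> (B n) \<omega>) * s k (\<eta> (B k) \<omega>)))"
      unfolding sq using int_ss
      by (subst Bochner_Integration.integral_sum)
         (auto intro!: sum.cong Bochner_Integration.integral_sum Bochner_Integration.integrable_sum)
    also have "\<dots> = (\<Sum>n<N. \<Sum>k<N. if k = n then expectation (\<lambda>\<omega>. (s n (\<eta> (B n) \<omega>))\<^sup>2) else 0)"
      by (intro sum.cong refl) (auto simp: orth power2_eq_square)
    also have "\<dots> = (\<Sum>n<N. expectation (\<lambda>\<omega>. (s n (\<eta> (B n) \<omega>))\<^sup>2))"
      by (intro sum.cong refl) auto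
    also have "ennreal \<dots> = (\<Sum>n<N. ennreal (expectation (\<lambda>\<omega>. (s n (\<eta> (B n) \<omega>))\<^sup>2)))"
      by (rule sum_ennreal[symmetric]) auto
    also have "\<dots> = (\<Sum>n<N. (\<integral>\<^sup>+\<omega>. ennreal ((s n (\<eta> (B n) \<omega>))\<^sup>2) \<partial>M))"
      using int_ss by (intro sum.cong refl nn_integral_eq_integral[symmetric]) (auto simp: power2_eq_square)
    also have "\<dots> \<le> (\<Sum>n<N. m n)"
      unfolding m_def
    proof (intro sum_mono nn_integral_mono)
      fix n \<omega>
      let ?x = "c n * \<eta> (B n) \<omega>"
      have "?x\<^sup>2 \<le> \<bar>?x\<bar> powr q" if "\<bar>?x\<bar> \<le> 1"
        using that q powr_mono'[of q 2 "\<bar>?x\<bar>"] by (cases "?x = 0") (auto simp del: mult_eq_0_iff)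
      then show "ennreal ((s n (\<eta> (B n) \<omega>))\<^sup>2) \<le> ennreal (\<bar>?x\<bar> powr q) * indicator {..R} \<bar>\<eta> (B n) \<omega>\<bar>"
        by (auto simp: s_def intro!: ennreal_leI)
    qed
    also have "\<dots> \<le> ennreal (K * \<Sigma>)" by (rule sum_m)
    finally show ?thesis .
  qed
  have L: "(\<integral>\<^sup>+\<omega>. ennreal \<bar>\<Sum>n<N. l n (\<eta> (B n) \<omega>)\<bar> \<partial>M) \<le> ennreal (K * \<Sigma>)"
  proof -
    have "(\<integral>\<^sup>+\<omega>. ennreal \<bar>\<Sum>n<N. l n (\<eta> (B n) \<omega>)\<bar> \<partial>M) \<le> (\<integral>\<^sup>+\<omega>. (\<Sum>n<N. ennreal \<bar>l n (\<eta> (B n) \<omega>)\<bar>) \<partial>M)"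
      by (intro nn_integral_mono) (auto simp: sum_ennreal intro!: ennreal_leI)
    also have "\<dots> = (\<Sum>n<N. (\<integral>\<^sup>+\<omega>. ennreal \<bar>l n (\<eta> (B n) \<omega>)\<bar> \<partial>M))"
      by (rule nn_integral_sum) auto
    also have "\<dots> \<le> (\<Sum>n<N. m n)"
      unfolding m_def
    proof (intro sum_mono nn_integral_mono)
      fix n \<omega>
      let ?x = "c n * \<eta> (B n) \<omega>"
      have "\<bar>?x\<bar> \<le> \<bar>?x\<bar> powr q" if "\<bar>?x\<bar> > 1"
        using that q powr_mono[of 1 q "\<bar>?x\<bar>"] by simp
      then show "ennreal \<bar>l n (\<eta> (B n) \<omega>)\<bar> \<le> ennreal (\<bar>?x\<bar> powr q) * indicator {..R} \<bar>\<eta> (B n) \<omega>\<bar>"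
        by (auto simp: l_def intro!: ennreal_leI)
    qed
    also have "\<dots> \<le> ennreal (K * \<Sigma>)" by (rule sum_m)
    finally show ?thesis .
  qed
  have "(\<integral>\<^sup>+\<omega>. ennreal \<bar>\<Sum>n<N. c n * (\<eta> (B n) \<omega> * indicator {..R} \<bar>\<eta> (B n) \<omega>\<bar>)\<bar> \<partial>M)
      \<le> (\<integral>\<^sup>+\<omega>. (ennreal \<delta> + ennreal (1 / \<delta>) * ennreal ((Y \<omega>)\<^sup>2)) + ennreal \<bar>\<Sum>n<N. l n (\<eta> (B n) \<omega>)\<bar> \<partial>M)"
  proof (rule nn_integral_mono)
    fix \<omega>
    have "(\<Sum>n<N. c n * (\<eta> (B n) \<omega> * indicator {..R} \<bar>\<eta> (B n) \<omega>\<bar>)) = Y \<omega> + (\<Sum>n<N. l n (\<eta> (B n) \<omega>))"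
      unfolding Y_def sum.distrib[symmetric] by (intro sum.cong refl) (auto simp: s_def l_def)
    \<comment> \<open>This takes the place of Cauchy-Schwarz: the bound stays linear in the sum of
      the \<open>\<bar>c n\<bar> powr q\<close>, at the price of the additive constant \<delta>, and
      can therefore be integrated over a family of coefficients.\<close>
    moreover have "\<bar>Y \<omega>\<bar> \<le> \<delta> + (Y \<omega>)\<^sup>2 / \<delta>"
    proof (cases "\<bar>Y \<omega>\<bar> \<le> \<delta>")
      case False
      then have "\<bar>Y \<omega>\<bar> * \<delta> \<le> \<bar>Y \<omega>\<bar> * \<bar>Y \<omega>\<bar>" by (intro mult_left_mono) auto
      then have "\<bar>Y \<omega>\<bar> \<le> (Y \<omega>)\<^sup>2 / \<delta>" using \<delta> by (simp add: field_simps power2_eq_square)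
      then show ?thesis using \<delta> by simp
    qed (use \<delta> in \<open>simp add: add_increasing2\<close>)
    ultimately have "\<bar>\<Sum>n<N. c n * (\<eta> (B n) \<omega> * indicator {..R} \<bar>\<eta> (B n) \<omega>\<bar>)\<bar>
        \<le> \<delta> + 1 / \<delta> * (Y \<omega>)\<^sup>2 + \<bar>\<Sum>n<N. l n (\<eta> (B n) \<omega>)\<bar>" by simp
    then show "ennreal \<bar>\<Sum>n<N. c n * (\<eta> (B n) \<omega> * indicator {..R} \<bar>\<eta> (B n) \<omega>\<bar>)\<bar>
        \<le> (ennreal \<delta> + ennreal (1 / \<delta>) * ennreal ((Y \<omega>)\<^sup>2)) + ennreal \<bar>\<Sum>n<N. l n (\<eta> (B n) \<omega>)\<bar>"
      using \<delta> by (simp add: ennreal_mult[symmetric] ennreal_plus[symmetric] ennreal_leI del: ennreal_plus)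
  qed
  also have "\<dots> = (ennreal \<delta> + ennreal (1 / \<delta>) * (\<integral>\<^sup>+\<omega>. ennreal ((Y \<omega>)\<^sup>2) \<partial>M)) + (\<integral>\<^sup>+\<omega>. ennreal \<bar>\<Sum>n<N. l n (\<eta> (B n) \<omega>)\<bar> \<partial>M)"
    by (simp add: nn_integral_add nn_integral_cmult emeasure_space_1)
  also have "\<dots> \<le> (ennreal \<delta> + ennreal (1 / \<delta>) * ennreal (K * \<Sigma>)) + ennreal (K * \<Sigma>)"
    by (intro add_mono mult_left_mono Y2 L) auto
  also have "\<dots> = ennreal (\<delta> + (1 + 1 / \<delta>) * K * \<Sigma>)"
    using \<delta> K \<Sigma> by (simp add: ennreal_mult[symmetric] ennreal_plus[symmetric] algebra_simps del: ennreal_plus)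
  finally show ?thesis unfolding \<Sigma>_def .
qed

end

end

locale noise_with_moments = symmetric_noise M D \<xi> b \<psi>
  for M :: "'w measure" and D :: "(real^'d) set" and \<xi> b \<psi> +
  fixes q :: real
  assumes q: "1 \<le> q" "q \<le> 2"
    and moments: "0 < R \<Longrightarrow> \<exists>K\<ge>0. \<forall>A\<in>sets (restrict_space borel D).
      (\<integral>\<^sup>+\<omega>. ennreal (\<bar>\<xi> A \<omega> - b * measure lborel A\<bar> powr q) * indicator {..R} \<bar>\<xi> A \<omega> - b * measure lborel A\<bar> \<partial>M)
        \<le> ennreal (K * measure lborel A)"
begin

text \<open>The order of quantifiers carries the later arguments: \<open>K\<close> depends on
  \<epsilon> alone, and the event \<open>E\<close> on the partition but not on the coefficients.
  \<open>E\<close> says that no centred increment exceeds a level \<open>R\<close>; the tail bounds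
  of the cells sum to a multiple of the total volume, whatever the number of cells.\<close>

lemma elementary_sum_bound:
  assumes \<epsilon>: "0 < \<epsilon>"
  shows "\<exists>K\<ge>0. \<forall>(N::nat) B. (\<forall>n<N. B n \<in> sets vol) \<longrightarrow> disjoint_family_on B {..<N} \<longrightarrow>
    (\<exists>E\<in>events. prob (space M - E) \<le> \<epsilon> \<and>
      (\<forall>c. (\<integral>\<^sup>+\<omega>\<in>E. ennreal \<bar>\<Sum>n<N. c n * \<xi> (B n) \<omega>\<bar> \<partial>M)
        \<le> ennreal (\<epsilon> + K * (\<Sum>n<N. \<bar>c n\<bar> powr q * measure vol (B n)))))"
proof -
  define V where "V = measure vol D"
  have V: "0 \<le> V" by (simp add: V_def)
  \<comment> \<open>The tail bound carries a factor 2 and the cells have total volume at most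
    \<open>V\<close>, so the union bound asks for \<open>2 * V * e \<le> \<epsilon>\<close>; the
    summand 1 keeps the denominator positive.\<close>
  define e where "e = \<epsilon> / (2 * V + 1)"
  have e: "0 < e" "2 * V * e \<le> \<epsilon>" using \<epsilon> V by (auto simp: e_def field_simps)
  have "isCont \<psi> 0" using psi_cont by (simp add: continuous_on_eq_continuous_at)
  then obtain \<delta>0 where \<delta>0: "0 < \<delta>0" "\<And>u. \<bar>u\<bar> < \<delta>0 \<Longrightarrow> \<psi> u < e"
    using e(1) psi_0 unfolding continuous_at_eps_delta
    by (metis abs_less_iff diff_zero dist_real_def)
  \<comment> \<open>The tail bound works at level 2 over the length of the frequency range. The
    range is halved so that the strict bound on \<psi> holds up to its endpoint.\<close>
  define R where "R = 2 / (\<delta>0 / 2)"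
  have R: "0 < R" using \<delta>0 by (simp add: R_def)
  obtain K where K: "0 \<le> K" "\<And>A. A \<in> sets vol \<Longrightarrow>
      (\<integral>\<^sup>+\<omega>. ennreal (\<bar>\<eta> A \<omega>\<bar> powr q) * indicator {..R} \<bar>\<eta> A \<omega>\<bar> \<partial>M) \<le> ennreal (K * measure vol A)"
    using moments[OF R] by (auto simp: \<eta>_def sets_vol measure_vol)
  \<comment> \<open>One \<delta> serves two additive errors, \<delta> from the truncated sums and
    \<open>\<bar>b\<bar> * V * \<delta>\<close> from the drift, which add up to \<epsilon>.\<close>
  define \<delta> where "\<delta> = \<epsilon> / (1 + \<bar>b\<bar> * V)"
  have \<delta>: "0 < \<delta>" "\<delta> * (1 + \<bar>b\<bar> * V) = \<epsilon>"
  proof -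
    have "0 < 1 + \<bar>b\<bar> * V" using V by (intro add_pos_nonneg) auto
    then show "0 < \<delta>" "\<delta> * (1 + \<bar>b\<bar> * V) = \<epsilon>" using \<epsilon> by (auto simp: \<delta>_def)
  qed
  define K' where "K' = (1 + 1 / \<delta>) * K + \<bar>b\<bar> * \<delta> powr (1 - q)"
  have K': "0 \<le> K'" using K \<delta> by (auto simp: K'_def)
  have main: "\<exists>E\<in>events. prob (space M - E) \<le> \<epsilon> \<and>
      (\<forall>c. (\<integral>\<^sup>+\<omega>\<in>E. ennreal \<bar>\<Sum>n<N. c n * \<xi> (B n) \<omega>\<bar> \<partial>M)
        \<le> ennreal (\<epsilon> + K' * (\<Sum>n<N. \<bar>c n\<bar> powr q * measure vol (B n))))"
    if B: "\<forall>n<N. B n \<in> sets vol" and disj: "disjoint_family_on B {..<N}" for N :: nat and B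
  proof -
    have Bm[measurable]: "n \<in> {..<N} \<Longrightarrow> \<eta> (B n) \<in> borel_measurable M"
      "n \<in> {..<N} \<Longrightarrow> \<xi> (B n) \<in> borel_measurable M" for n using B by auto
    have tot: "(\<Sum>n<N. measure vol (B n)) \<le> V"
    proof -
      have "(\<Sum>n<N. measure vol (B n)) = measure vol (\<Union>n<N. B n)"
        using B disj by (intro vol.finite_measure_finite_Union[symmetric]) auto
      also have "\<dots> \<le> V" unfolding V_def using B sets.sets_into_space[of _ vol]
        by (intro vol.finite_measure_mono) auto
      finally show ?thesis .
    qed
    define E where "E = {\<omega>\<in>space M. \<forall>n\<in>{..<N}. \<bar>\<eta> (B n) \<omega>\<bar> \<le> R}"
    have E[measurable]: "E \<in> events" unfolding E_def by measurable
    have "prob (space M - E) \<le> prob (\<Union>n<N. {\<omega>\<in>space M. \<bar>\<eta> (B n) \<omega>\<bar> > R})"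
      by (rule finite_measure_mono) (auto simp: E_def)
    also have "\<dots> \<le> (\<Sum>n<N. prob {\<omega>\<in>space M. \<bar>\<eta> (B n) \<omega>\<bar> > R})"
      by (rule finite_measure_subadditive_finite) auto
    also have "\<dots> \<le> (\<Sum>n<N. 2 * (measure vol (B n) * e))"
    proof (rule sum_mono)
      fix n assume n: "n \<in> {..<N}"
      show "prob {\<omega>\<in>space M. \<bar>\<eta> (B n) \<omega>\<bar> > R} \<le> 2 * (measure vol (B n) * e)"
        unfolding R_def
      proof (rule tail_le_of_cos)
        fix u :: real assume u: "0 \<le> u" "u \<le> \<delta>0 / 2"
        have "expectation (\<lambda>\<omega>. 1 - cos (u * \<eta> (B n) \<omega>)) \<le> measure vol (B n) * \<psi> u"
          using n B by (intro one_minus_cos_eta_le) auto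
        also have "\<dots> \<le> measure vol (B n) * e"
          using u \<delta>0 by (intro mult_left_mono less_imp_le[OF \<delta>0(2)]) auto
        finally show "expectation (\<lambda>\<omega>. 1 - cos (u * \<eta> (B n) \<omega>)) \<le> measure vol (B n) * e" .
      qed (use n \<delta>0 e in auto)
    qed
    also have "\<dots> = 2 * (\<Sum>n<N. measure vol (B n)) * e" by (simp add: sum_distrib_left sum_distrib_right mult_ac)
    also have "\<dots> \<le> 2 * V * e" using tot e by (intro mult_right_mono mult_left_mono) auto
    also have "\<dots> \<le> \<epsilon>" by (rule e)
    finally have PE: "prob (space M - E) \<le> \<epsilon>" .
    have bound: "(\<integral>\<^sup>+\<omega>\<in>E. ennreal \<bar>\<Sum>n<N. c n * \<xi> (B n) \<omega>\<bar> \<partial>M)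
        \<le> ennreal (\<epsilon> + K' * (\<Sum>n<N. \<bar>c n\<bar> powr q * measure vol (B n)))" for c
    proof -
      let ?S = "\<Sum>n<N. \<bar>c n\<bar> powr q * measure vol (B n)"
      have S: "0 \<le> ?S" by (intro sum_nonneg) auto
      define \<beta> where "\<beta> = b * (\<Sum>n<N. c n * measure vol (B n))"
      \<comment> \<open>The drift is linear in the coefficients. Because \<open>q \<ge> 1\<close> it
        can be charged to their \<open>q\<close>-th powers, up to the constant \<delta> for small
        coefficients.\<close>
      have c_le: "\<bar>c n\<bar> \<le> \<delta> + \<delta> powr (1 - q) * \<bar>c n\<bar> powr q" for n
      proof (cases "\<bar>c n\<bar> \<le> \<delta>")
        case False
        then have "1 \<le> \<bar>c n\<bar> / \<delta>" using \<delta> by simp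
        then have "\<bar>c n\<bar> / \<delta> \<le> (\<bar>c n\<bar> / \<delta>) powr q" using q powr_mono[of 1 q "\<bar>c n\<bar> / \<delta>"] \<delta> False by auto
        then have "\<bar>c n\<bar> \<le> \<delta> * (\<bar>c n\<bar> / \<delta>) powr q" using \<delta> by (simp add: field_simps)
        also have "\<dots> = \<delta> powr (1 - q) * \<bar>c n\<bar> powr q" using \<delta> by (simp add: powr_divide powr_diff)
        finally show ?thesis using \<delta> by simp
      qed (simp add: add_increasing2)
      have "\<bar>\<beta>\<bar> \<le> \<bar>b\<bar> * (\<Sum>n<N. \<bar>c n\<bar> * measure vol (B n))"
        unfolding \<beta>_def abs_mult by (intro mult_left_mono order_trans[OF sum_abs]) (auto simp: abs_mult)
      also have "\<dots> \<le> \<bar>b\<bar> * (\<Sum>n<N. (\<delta> + \<delta> powr (1 - q) * \<bar>c n\<bar> powr q) * measure vol (B n))"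
        by (intro mult_left_mono sum_mono mult_right_mono c_le) auto
      also have "\<dots> = \<bar>b\<bar> * (\<delta> * (\<Sum>n<N. measure vol (B n)) + \<delta> powr (1 - q) * ?S)"
        by (simp add: algebra_simps sum.distrib sum_distrib_left)
      also have "\<dots> \<le> \<bar>b\<bar> * (\<delta> * V + \<delta> powr (1 - q) * ?S)"
        using tot \<delta> by (intro mult_left_mono add_right_mono) auto
      finally have \<beta>: "\<bar>\<beta>\<bar> \<le> \<bar>b\<bar> * (\<delta> * V + \<delta> powr (1 - q) * ?S)" .
      let ?T = "\<lambda>\<omega>. \<Sum>n<N. c n * (\<eta> (B n) \<omega> * indicator {..R} \<bar>\<eta> (B n) \<omega>\<bar>)"
      have "(\<integral>\<^sup>+\<omega>\<in>E. ennreal \<bar>\<Sum>n<N. c n * \<xi> (B n) \<omega>\<bar> \<partial>M) \<le> (\<integral>\<^sup>+\<omega>. ennreal \<bar>?T \<omega>\<bar> + ennreal \<bar>\<beta>\<bar> \<partial>M)"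
      proof (rule nn_integral_mono)
        fix \<omega>
        show "ennreal \<bar>\<Sum>n<N. c n * \<xi> (B n) \<omega>\<bar> * indicator E \<omega> \<le> ennreal \<bar>?T \<omega>\<bar> + ennreal \<bar>\<beta>\<bar>"
        proof (cases "\<omega> \<in> E")
          case True
          have "(\<Sum>n<N. c n * \<xi> (B n) \<omega>) = (\<Sum>n<N. c n * (\<eta> (B n) \<omega> * indicator {..R} \<bar>\<eta> (B n) \<omega>\<bar>) + b * (c n * measure vol (B n)))"
            using True B by (intro sum.cong refl) (auto simp: E_def \<eta>_def measure_vol algebra_simps)
          then have "(\<Sum>n<N. c n * \<xi> (B n) \<omega>) = ?T \<omega> + \<beta>"
            by (simp add: sum.distrib \<beta>_def sum_distrib_left)
          then show ?thesis using True
            by (simp add: ennreal_plus[symmetric] ennreal_leI abs_triangle_ineq del: ennreal_plus)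
        qed simp
      qed
      also have "\<dots> = (\<integral>\<^sup>+\<omega>. ennreal \<bar>?T \<omega>\<bar> \<partial>M) + ennreal \<bar>\<beta>\<bar>"
        by (subst nn_integral_add) (auto simp: emeasure_space_1)
      also have "\<dots> \<le> ennreal (\<delta> + (1 + 1 / \<delta>) * K * ?S) + ennreal (\<bar>b\<bar> * (\<delta> * V + \<delta> powr (1 - q) * ?S))"
        using B disj q K \<delta> \<beta> by (intro add_mono truncated_sum_bound ennreal_leI) auto
      also have "\<dots> = ennreal (\<epsilon> + K' * ?S)"
      proof (subst ennreal_plus[symmetric])
        show "0 \<le> \<delta> + (1 + 1 / \<delta>) * K * ?S" "0 \<le> \<bar>b\<bar> * (\<delta> * V + \<delta> powr (1 - q) * ?S)"
          using \<delta>(1) K(1) S V by simp_all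
        have "\<delta> + (1 + 1 / \<delta>) * K * ?S + \<bar>b\<bar> * (\<delta> * V + \<delta> powr (1 - q) * ?S)
          = \<delta> * (1 + \<bar>b\<bar> * V) + K' * ?S"
          unfolding K'_def by (simp only: algebra_simps)
        then show "ennreal (\<delta> + (1 + 1 / \<delta>) * K * ?S + \<bar>b\<bar> * (\<delta> * V + \<delta> powr (1 - q) * ?S))
          = ennreal (\<epsilon> + K' * ?S)" unfolding \<delta>(2) by simp
      qed
      finally show ?thesis .
    qed
    show ?thesis by (rule bexI[OF _ E]) (intro conjI allI PE bound)
  qed
  show ?thesis
  proof (rule exI[of _ K'], rule conjI[OF K'], rule allI, rule allI, rule impI, rule impI)
    fix N :: nat and B :: "nat \<Rightarrow> (real^'d) set"
    assume 1: "\<forall>n<N. B n \<in> sets vol" and 2: "disjoint_family_on B {..<N}"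
    show "\<exists>E\<in>events. prob (space M - E) \<le> \<epsilon> \<and>
      (\<forall>c. (\<integral>\<^sup>+\<omega>\<in>E. ennreal \<bar>\<Sum>n<N. c n * \<xi> (B n) \<omega>\<bar> \<partial>M)
        \<le> ennreal (\<epsilon> + K' * (\<Sum>n<N. \<bar>c n\<bar> powr q * measure vol (B n))))"
      by (rule main[OF 1 2])
  qed
qed

end

section \<open>Simple integrals and convergence in probability\<close>

context prob_space
begin

text \<open>This truncated mean metrises convergence in probability. Taking values in
  \<open>ennreal\<close>, it can be summed and compared without integrability conditions.\<close>

definition prob_size :: "('a \<Rightarrow> real) \<Rightarrow> ennreal" where
  "prob_size X = (\<integral>\<^sup>+\<omega>. ennreal (min 1 \<bar>X \<omega>\<bar>) \<partial>M)"

lemma prob_size_cong_AE: "(AE \<omega> in M. X \<omega> = Y \<omega>) \<Longrightarrow> prob_size X = prob_size Y"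
  unfolding prob_size_def by (intro nn_integral_cong_AE) auto

lemma prob_size_add:
  assumes [measurable]: "X \<in> borel_measurable M" "Y \<in> borel_measurable M"
  shows "prob_size (\<lambda>\<omega>. X \<omega> + Y \<omega>) \<le> prob_size X + prob_size Y"
proof -
  have "prob_size (\<lambda>\<omega>. X \<omega> + Y \<omega>) \<le> (\<integral>\<^sup>+\<omega>. ennreal (min 1 \<bar>X \<omega>\<bar>) + ennreal (min 1 \<bar>Y \<omega>\<bar>) \<partial>M)"
    unfolding prob_size_def
    by (intro nn_integral_mono) (auto simp: ennreal_plus[symmetric] min_def simp del: ennreal_plus intro!: ennreal_leI)
  also have "\<dots> = prob_size X + prob_size Y" unfolding prob_size_def by (intro nn_integral_add) auto
  finally show ?thesis .
qed

lemma prob_size_minus: "prob_size (\<lambda>\<omega>. X \<omega> - Y \<omega>) = prob_size (\<lambda>\<omega>. Y \<omega> - X \<omega>)"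
  unfolding prob_size_def by (simp add: abs_minus_commute)

lemma prob_size_triangle:
  assumes "X \<in> borel_measurable M" "Y \<in> borel_measurable M" "Z \<in> borel_measurable M"
  shows "prob_size (\<lambda>\<omega>. X \<omega> - Z \<omega>) \<le> prob_size (\<lambda>\<omega>. X \<omega> - Y \<omega>) + prob_size (\<lambda>\<omega>. Y \<omega> - Z \<omega>)"
  using prob_size_add[of "\<lambda>\<omega>. X \<omega> - Y \<omega>" "\<lambda>\<omega>. Y \<omega> - Z \<omega>"] assms by simp

lemma prob_size_eq_0:
  assumes [measurable]: "X \<in> borel_measurable M" and 0: "prob_size X = 0"
  shows "AE \<omega> in M. X \<omega> = 0"
proof -
  have "AE \<omega> in M. ennreal (min 1 \<bar>X \<omega>\<bar>) = 0"
    using 0 unfolding prob_size_def by (subst (asm) nn_integral_0_iff_AE) auto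
  then show ?thesis by eventually_elim (auto simp: ennreal_eq_0_iff min_def split: if_splits)
qed

lemma prob_size_le_1: "prob_size X \<le> 1"
proof -
  have "prob_size X \<le> (\<integral>\<^sup>+\<omega>. 1 \<partial>M)" unfolding prob_size_def by (intro nn_integral_mono) auto
  then show ?thesis by (simp add: emeasure_space_1)
qed

lemma prob_le_prob_size:
  assumes [measurable]: "X \<in> borel_measurable M" and \<epsilon>: "0 < \<epsilon>"
  shows "ennreal (min 1 \<epsilon>) * ennreal (prob {\<omega>\<in>space M. \<bar>X \<omega>\<bar> > \<epsilon>}) \<le> prob_size X"
proof -
  have "ennreal (min 1 \<epsilon>) * ennreal (prob {\<omega>\<in>space M. \<bar>X \<omega>\<bar> > \<epsilon>})
      = (\<integral>\<^sup>+\<omega>. ennreal (min 1 \<epsilon>) * indicator {\<omega>\<in>space M. \<bar>X \<omega>\<bar> > \<epsilon>} \<omega> \<partial>M)"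
    by (subst nn_integral_cmult_indicator) (auto simp: emeasure_eq_measure)
  also have "\<dots> \<le> prob_size X"
    unfolding prob_size_def by (intro nn_integral_mono) (auto simp: indicator_def intro!: ennreal_leI)
  finally show ?thesis .
qed

lemma prob_size_le_prob:
  assumes [measurable]: "X \<in> borel_measurable M" and \<epsilon>: "0 < \<epsilon>"
  shows "prob_size X \<le> ennreal (\<epsilon> + prob {\<omega>\<in>space M. \<bar>X \<omega>\<bar> > \<epsilon>})"
proof -
  have "prob_size X \<le> (\<integral>\<^sup>+\<omega>. ennreal \<epsilon> + indicator {\<omega>\<in>space M. \<bar>X \<omega>\<bar> > \<epsilon>} \<omega> \<partial>M)"
    unfolding prob_size_def
  proof (rule nn_integral_mono)
    fix \<omega> assume "\<omega> \<in> space M"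
    then show "ennreal (min 1 \<bar>X \<omega>\<bar>) \<le> ennreal \<epsilon> + indicator {\<omega>\<in>space M. \<bar>X \<omega>\<bar> > \<epsilon>} \<omega>"
      using \<epsilon> by (cases "\<bar>X \<omega>\<bar> > \<epsilon>") (auto intro!: ennreal_leI add_increasing)
  qed
  also have "\<dots> = ennreal \<epsilon> + emeasure M {\<omega>\<in>space M. \<bar>X \<omega>\<bar> > \<epsilon>}"
    by (subst nn_integral_add) (auto simp: emeasure_space_1)
  finally show ?thesis using \<epsilon> by (simp add: emeasure_eq_measure)
qed

lemma tendsto_in_prob_iff:
  assumes [measurable]: "\<And>n. X n \<in> borel_measurable M" "Y \<in> borel_measurable M"
  shows "tendsto_in_prob M X Y \<longleftrightarrow> (\<lambda>n. prob_size (\<lambda>\<omega>. X n \<omega> - Y \<omega>)) \<longlonglongrightarrow> 0"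
proof
  assume L: "tendsto_in_prob M X Y"
  show "(\<lambda>n. prob_size (\<lambda>\<omega>. X n \<omega> - Y \<omega>)) \<longlonglongrightarrow> 0"
  proof (rule order_tendstoI)
    fix a :: ennreal assume "0 < a"
    then obtain e :: real where e: "0 < e" "ennreal e < a"
      by (metis ennreal_less_zero_iff ennreal_neg ennreal_zero_less_top dense not_le less_le ennreal_cases neq_top_trans top.not_eq_extremum)
    have "(\<lambda>n. prob {\<omega>\<in>space M. \<bar>X n \<omega> - Y \<omega>\<bar> > e / 2}) \<longlonglongrightarrow> 0"
      using L e(1) half_gt_zero[OF e(1)] unfolding tendsto_in_prob_def by blast
    then have "\<forall>\<^sub>F n in sequentially. prob {\<omega>\<in>space M. \<bar>X n \<omega> - Y \<omega>\<bar> > e / 2} < e / 2"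
      using e by (intro order_tendstoD) auto
    then show "\<forall>\<^sub>F n in sequentially. prob_size (\<lambda>\<omega>. X n \<omega> - Y \<omega>) < a"
    proof eventually_elim
      case (elim n)
      have "prob_size (\<lambda>\<omega>. X n \<omega> - Y \<omega>) \<le> ennreal (e / 2 + prob {\<omega>\<in>space M. \<bar>X n \<omega> - Y \<omega>\<bar> > e / 2})"
        using e by (intro prob_size_le_prob) auto
      also have "\<dots> \<le> ennreal e" using elim by (intro ennreal_leI) auto
      finally show ?case using e by simp
    qed
  qed simp
next
  assume R: "(\<lambda>n. prob_size (\<lambda>\<omega>. X n \<omega> - Y \<omega>)) \<longlonglongrightarrow> 0"
  show "tendsto_in_prob M X Y"
    unfolding tendsto_in_prob_def
  proof (intro conjI allI impI assms)
    fix \<epsilon> :: real assume \<epsilon>: "0 < \<epsilon>"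
    have "(\<lambda>n. inverse (ennreal (min 1 \<epsilon>)) * prob_size (\<lambda>\<omega>. X n \<omega> - Y \<omega>)) \<longlonglongrightarrow> inverse (ennreal (min 1 \<epsilon>)) * 0"
      using \<epsilon> by (intro ennreal_tendsto_cmult R) (auto simp: inverse_ennreal)
    then have lim: "(\<lambda>n. prob_size (\<lambda>\<omega>. X n \<omega> - Y \<omega>) / ennreal (min 1 \<epsilon>)) \<longlonglongrightarrow> 0"
      by (simp add: divide_ennreal_def mult.commute)
    have "(\<lambda>n. ennreal (prob {\<omega>\<in>space M. \<bar>X n \<omega> - Y \<omega>\<bar> > \<epsilon>})) \<longlonglongrightarrow> 0"
    proof (rule tendsto_sandwich[OF _ _ tendsto_const lim])
      show "\<forall>\<^sub>F n in sequentially. ennreal (prob {\<omega>\<in>space M. \<bar>X n \<omega> - Y \<omega>\<bar> > \<epsilon>})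
          \<le> prob_size (\<lambda>\<omega>. X n \<omega> - Y \<omega>) / ennreal (min 1 \<epsilon>)"
      proof (rule always_eventually, rule allI)
        fix n
        have "ennreal (min 1 \<epsilon>) * ennreal (prob {\<omega>\<in>space M. \<bar>X n \<omega> - Y \<omega>\<bar> > \<epsilon>}) \<le> prob_size (\<lambda>\<omega>. X n \<omega> - Y \<omega>)"
          using \<epsilon> by (intro prob_le_prob_size) auto
        then have "ennreal (prob {\<omega>\<in>space M. \<bar>X n \<omega> - Y \<omega>\<bar> > \<epsilon>}) * ennreal (min 1 \<epsilon>) / ennreal (min 1 \<epsilon>)
          \<le> prob_size (\<lambda>\<omega>. X n \<omega> - Y \<omega>) / ennreal (min 1 \<epsilon>)"
          by (intro divide_right_mono_ennreal) (simp add: mult.commute)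
        then show "ennreal (prob {\<omega>\<in>space M. \<bar>X n \<omega> - Y \<omega>\<bar> > \<epsilon>})
          \<le> prob_size (\<lambda>\<omega>. X n \<omega> - Y \<omega>) / ennreal (min 1 \<epsilon>)"
          using \<epsilon> by (subst (asm) mult_divide_eq_ennreal) auto
      qed
    qed auto
    then show "(\<lambda>n. prob {\<omega>\<in>space M. \<bar>X n \<omega> - Y \<omega>\<bar> > \<epsilon>}) \<longlonglongrightarrow> 0"
      by (subst (asm) tendsto_ennreal_iff[where x = 0, simplified]) auto
  qed
qed

lemma tendsto_in_prob_AE_cong:
  assumes "tendsto_in_prob M X Y" "\<And>n. AE \<omega> in M. X n \<omega> = X' n \<omega>" "AE \<omega> in M. Y \<omega> = Y' \<omega>"
    "\<And>n. X' n \<in> borel_measurable M" "Y' \<in> borel_measurable M"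
  shows "tendsto_in_prob M X' Y'"
proof -
  have m: "\<And>n. X n \<in> borel_measurable M" "Y \<in> borel_measurable M" using assms(1) by (auto simp: tendsto_in_prob_def)
  have "prob_size (\<lambda>\<omega>. X n \<omega> - Y \<omega>) = prob_size (\<lambda>\<omega>. X' n \<omega> - Y' \<omega>)" for n
    using assms(2)[of n] assms(3) by (intro prob_size_cong_AE) auto
  with assms(1) show ?thesis by (simp add: tendsto_in_prob_iff m assms(4,5))
qed

lemma tendsto_in_prob_unique:
  assumes "tendsto_in_prob M X Y" "tendsto_in_prob M X Z"
  shows "AE \<omega> in M. Y \<omega> = Z \<omega>"
proof -
  have m: "\<And>n. X n \<in> borel_measurable M" "Y \<in> borel_measurable M" "Z \<in> borel_measurable M"
    using assms by (auto simp: tendsto_in_prob_def)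
  have "(\<lambda>n. prob_size (\<lambda>\<omega>. X n \<omega> - Y \<omega>) + prob_size (\<lambda>\<omega>. X n \<omega> - Z \<omega>)) \<longlonglongrightarrow> 0 + 0"
    using assms by (intro tendsto_add) (simp_all add: tendsto_in_prob_iff m)
  moreover have "prob_size (\<lambda>\<omega>. Y \<omega> - Z \<omega>) \<le> prob_size (\<lambda>\<omega>. X n \<omega> - Y \<omega>) + prob_size (\<lambda>\<omega>. X n \<omega> - Z \<omega>)" for n
    using prob_size_triangle[OF m(2) m(1)[of n] m(3)] by (simp add: prob_size_minus[of Y])
  ultimately have "prob_size (\<lambda>\<omega>. Y \<omega> - Z \<omega>) \<le> 0"
    by (intro tendsto_lowerbound[of _ 0 sequentially]) auto
  then have "AE \<omega> in M. Y \<omega> - Z \<omega> = 0" using m by (intro prob_size_eq_0) auto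
  then show ?thesis by simp
qed

lemma tendsto_in_prob_diff:
  assumes "tendsto_in_prob M X Y" "tendsto_in_prob M X' Y'"
  shows "tendsto_in_prob M (\<lambda>n \<omega>. X n \<omega> - X' n \<omega>) (\<lambda>\<omega>. Y \<omega> - Y' \<omega>)"
proof -
  have m[measurable]: "\<And>n. X n \<in> borel_measurable M" "Y \<in> borel_measurable M" "\<And>n. X' n \<in> borel_measurable M" "Y' \<in> borel_measurable M"
    using assms by (auto simp: tendsto_in_prob_def)
  have lim: "(\<lambda>n. prob_size (\<lambda>\<omega>. X n \<omega> - Y \<omega>) + prob_size (\<lambda>\<omega>. Y' \<omega> - X' n \<omega>)) \<longlonglongrightarrow> 0"
    using assms tendsto_add[of "\<lambda>n. prob_size (\<lambda>\<omega>. X n \<omega> - Y \<omega>)" 0 sequentially "\<lambda>n. prob_size (\<lambda>\<omega>. X' n \<omega> - Y' \<omega>)" 0]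
    by (simp add: tendsto_in_prob_iff m prob_size_minus[of Y'])
  have "(\<lambda>n. prob_size (\<lambda>\<omega>. (X n \<omega> - X' n \<omega>) - (Y \<omega> - Y' \<omega>))) \<longlonglongrightarrow> 0"
  proof (rule tendsto_sandwich[OF _ _ tendsto_const lim])
    show "\<forall>\<^sub>F n in sequentially. prob_size (\<lambda>\<omega>. (X n \<omega> - X' n \<omega>) - (Y \<omega> - Y' \<omega>))
        \<le> prob_size (\<lambda>\<omega>. X n \<omega> - Y \<omega>) + prob_size (\<lambda>\<omega>. Y' \<omega> - X' n \<omega>)"
      using prob_size_add[of "\<lambda>\<omega>. X _ \<omega> - Y \<omega>" "\<lambda>\<omega>. Y' \<omega> - X' _ \<omega>"] by (intro always_eventually allI) (simp add: algebra_simps)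
  qed auto
  then show ?thesis by (subst tendsto_in_prob_iff) auto
qed

lemma AE_tendsto_imp_in_prob:
  assumes [measurable]: "\<And>n. X n \<in> borel_measurable M" "Y \<in> borel_measurable M"
    and lim: "AE \<omega> in M. (\<lambda>n. X n \<omega>) \<longlonglongrightarrow> Y \<omega>"
  shows "tendsto_in_prob M X Y"
proof -
  have "(\<lambda>n. prob_size (\<lambda>\<omega>. X n \<omega> - Y \<omega>)) \<longlonglongrightarrow> (\<integral>\<^sup>+\<omega>. ennreal 0 \<partial>M)"
    unfolding prob_size_def
  proof (rule nn_integral_dominated_convergence[where w = "\<lambda>_. 1"])
    show "AE \<omega> in M. (\<lambda>n. ennreal (min 1 \<bar>X n \<omega> - Y \<omega>\<bar>)) \<longlonglongrightarrow> ennreal 0"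
      using lim
    proof eventually_elim
      case (elim \<omega>)
      have "(\<lambda>n. min 1 \<bar>X n \<omega> - Y \<omega>\<bar>) \<longlonglongrightarrow> min 1 \<bar>Y \<omega> - Y \<omega>\<bar>"
        by (intro tendsto_intros elim)
      then show ?case by (intro tendsto_ennrealI) simp
    qed
  qed (auto simp: emeasure_space_1)
  then show ?thesis by (subst tendsto_in_prob_iff) auto
qed

text \<open>Borel-Cantelli in expectation: the truncated increments have summable means, hence an
  almost surely finite sum, and once a term is below 1 the truncation has no effect on it.\<close>

lemma fast_Cauchy_convergent:
  assumes [measurable]: "\<And>n. X n \<in> borel_measurable M"
    and fast: "\<And>n. prob_size (\<lambda>\<omega>. X (Suc n) \<omega> - X n \<omega>) \<le> ennreal ((1/2)^n)"
  shows "AE \<omega> in M. convergent (\<lambda>n. X n \<omega>)"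
proof -
  have "(\<integral>\<^sup>+\<omega>. (\<Sum>n. ennreal (min 1 \<bar>X (Suc n) \<omega> - X n \<omega>\<bar>)) \<partial>M) = (\<Sum>n. prob_size (\<lambda>\<omega>. X (Suc n) \<omega> - X n \<omega>))"
    unfolding prob_size_def by (rule nn_integral_suminf) auto
  also have "\<dots> \<le> (\<Sum>n. ennreal ((1/2)^n))" by (intro suminf_le fast) auto
  also have "\<dots> = ennreal (\<Sum>n. (1/2)^n)" by (intro suminf_ennreal2) (auto intro: summable_geometric)
  also have "\<dots> < \<infinity>" by simp
  finally have "AE \<omega> in M. (\<Sum>n. ennreal (min 1 \<bar>X (Suc n) \<omega> - X n \<omega>\<bar>)) \<noteq> \<infinity>"
    by (intro nn_integral_PInf_AE) auto
  then show ?thesis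
  proof eventually_elim
    case (elim \<omega>)
    let ?d = "\<lambda>n. X (Suc n) \<omega> - X n \<omega>"
    have sm: "summable (\<lambda>n. min 1 \<bar>?d n\<bar>)"
      using elim by (intro summable_suminf_not_top) auto
    then have "\<forall>\<^sub>F n in sequentially. min 1 \<bar>?d n\<bar> < 1"
      using summable_LIMSEQ_zero by (intro order_tendstoD) auto
    then have "\<forall>\<^sub>F n in sequentially. norm (?d n) \<le> min 1 \<bar>?d n\<bar>"
      by eventually_elim (auto simp: min_def split: if_splits)
    then have "summable ?d" using sm by (rule summable_comparison_test_ev)
    then have "convergent (\<lambda>n. \<Sum>i<n. ?d i)" by (simp add: summable_iff_convergent)
    then have "convergent (\<lambda>n. X 0 \<omega> + (\<Sum>i<n. ?d i))" by (intro convergent_add convergent_const)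
    then show ?case by (simp add: sum_lessThan_telescope[of "\<lambda>n. X n \<omega>"])
  qed
qed

end

section \<open>Simple integrals computed on a common partition\<close>

context symmetric_noise
begin

abbreviation "SI \<equiv> simple_stoch_integral D \<xi>"

text \<open>The intersection with \<open>D\<close> reproduces the form in which level sets occur in
  the simple integral over all of \<open>D\<close>. The labels \<open>v\<close> may have any type,
  so pairs or lists of values can describe a common partition for several step functions.\<close>

abbreviation "cell V v \<equiv> D \<inter> {y\<in>D. V y = v}"

lemma cell_in_vol:
  assumes "simple_function vol V" "A \<in> sets vol"
  shows "A \<inter> {y\<in>D. V y = v} \<in> sets vol"
proof -
  have "V -` {v} \<inter> space vol \<in> sets vol"
    using assms(1) by (cases "v \<in> V ` D") (auto simp: simple_function_def intro: back_subst[of "\<lambda>A. A \<in> sets vol", OF sets.empty_sets])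
  moreover have "{y\<in>D. V y = v} = V -` {v} \<inter> space vol" by auto
  ultimately show ?thesis using assms(2) by auto
qed

lemma simple_finite: "simple_function vol V \<Longrightarrow> finite (V ` D)"
  by (simp add: simple_function_def)

lemma simple_stoch_integral_measurable [measurable]:
  "simple_function vol f \<Longrightarrow> A \<in> sets vol \<Longrightarrow> SI f A \<in> borel_measurable M"
  unfolding simple_stoch_integral_def[abs_def]
  by (intro borel_measurable_sum borel_measurable_times borel_measurable_const xi_measurable cell_in_vol)

lemma finite_additivity:
  assumes J: "finite J" and B: "\<And>j. j \<in> J \<Longrightarrow> B j \<in> sets vol" and disj: "disjoint_family_on B J"
  shows "AE \<omega> in M. \<xi> (\<Union>j\<in>J. B j) \<omega> = (\<Sum>j\<in>J. \<xi> (B j) \<omega>)"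
proof -
  obtain e where e: "bij_betw e {..<card J} J"
    using ex_bij_betw_nat_finite[OF J] by (auto simp: atLeast0LessThan)
  have "AE \<omega> in M. \<xi> (\<Union>n<card J. B (e n)) \<omega> = (\<Sum>n<card J. \<xi> (B (e n)) \<omega>)"
  proof (rule finite_additivity_nat)
    show "disjoint_family_on (\<lambda>n. B (e n)) {..<card J}"
      using disj e unfolding disjoint_family_on_def bij_betw_def inj_on_def by blast
  qed (use B bij_betw_apply[OF e] in auto)
  moreover have "(\<Union>n<card J. B (e n)) = (\<Union>j\<in>J. B j)"
  proof -
    have "(\<Union>n<card J. B (e n)) = (\<Union>j\<in>e ` {..<card J}. B j)" by auto
    then show ?thesis unfolding bij_betw_imp_surj_on[OF e] .
  qed
  moreover have "(\<Sum>n<card J. \<xi> (B (e n)) \<omega>) = (\<Sum>j\<in>J. \<xi> (B j) \<omega>)" for \<omega>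
    by (rule sum.reindex_bij_betw[OF e])
  ultimately show ?thesis by simp
qed

lemma xi_empty: "AE \<omega> in M. \<xi> {} \<omega> = 0"
  using finite_additivity[of "{}" "\<lambda>_. {}"] by (auto simp: disjoint_family_on_def)

text \<open>Distinct labels may carry the same value, so a level set of \<open>f\<close> is a finite
  union of cells, and finite additivity is applied to each of the finitely many level sets. In this
  way several step functions are integrated on one partition.\<close>

lemma simple_stoch_integral_rep:
  assumes V: "simple_function vol V" and A: "A \<in> sets vol" and f: "\<And>y. y \<in> D \<Longrightarrow> f y = c (V y)"
  shows "AE \<omega> in M. SI f A \<omega> = (\<Sum>v\<in>V ` D. c v * \<xi> (A \<inter> {y\<in>D. V y = v}) \<omega>)"
proof -
  have fin: "finite (V ` D)" using V by (rule simple_finite)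
  have fD: "f ` D = c ` V ` D" using f by force
  have "AE \<omega> in M. \<xi> (A \<inter> {y\<in>D. f y = \<alpha>}) \<omega> = (\<Sum>v | v \<in> V ` D \<and> c v = \<alpha>. \<xi> (A \<inter> {y\<in>D. V y = v}) \<omega>)" for \<alpha>
  proof -
    have "AE \<omega> in M. \<xi> (\<Union>v\<in>{v \<in> V ` D. c v = \<alpha>}. A \<inter> {y\<in>D. V y = v}) \<omega>
        = (\<Sum>v | v \<in> V ` D \<and> c v = \<alpha>. \<xi> (A \<inter> {y\<in>D. V y = v}) \<omega>)"
      using fin by (intro finite_additivity cell_in_vol V A) (auto simp: disjoint_family_on_def)
    moreover have "(\<Union>v\<in>{v \<in> V ` D. c v = \<alpha>}. A \<inter> {y\<in>D. V y = v}) = A \<inter> {y\<in>D. f y = \<alpha>}"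
      using f by auto
    ultimately show ?thesis by simp
  qed
  then have "AE \<omega> in M. \<forall>\<alpha>\<in>f ` D. \<xi> (A \<inter> {y\<in>D. f y = \<alpha>}) \<omega> = (\<Sum>v | v \<in> V ` D \<and> c v = \<alpha>. \<xi> (A \<inter> {y\<in>D. V y = v}) \<omega>)"
    using fin by (intro AE_finite_allI) (auto simp: fD)
  then show ?thesis
  proof eventually_elim
    case (elim \<omega>)
    have "SI f A \<omega> = (\<Sum>\<alpha>\<in>f ` D. \<alpha> * (\<Sum>v | v \<in> V ` D \<and> c v = \<alpha>. \<xi> (A \<inter> {y\<in>D. V y = v}) \<omega>))"
      unfolding simple_stoch_integral_def using elim by (intro sum.cong refl arg_cong2[where f = "(*)"]) blast+
    also have "\<dots> = (\<Sum>\<alpha>\<in>c ` V ` D. (\<Sum>v | v \<in> V ` D \<and> c v = \<alpha>. c v * \<xi> (A \<inter> {y\<in>D. V y = v}) \<omega>))"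
      unfolding fD by (intro sum.cong refl) (auto simp: sum_distrib_left)
    also have "\<dots> = (\<Sum>v\<in>V ` D. c v * \<xi> (A \<inter> {y\<in>D. V y = v}) \<omega>)"
      by (rule sum.image_gen[OF fin, symmetric])
    finally show ?case .
  qed
qed

text \<open>The noise is additive only almost surely, so linearity has to be read off a common
  partition; the pair of values labels one.\<close>

lemma simple_stoch_integral_diff:
  assumes f: "simple_function vol f" and g: "simple_function vol g" and A: "A \<in> sets vol"
  shows "AE \<omega> in M. SI (\<lambda>y. f y - g y) A \<omega>
    = SI f A \<omega> - SI g A \<omega>"
proof -
  have V: "simple_function vol (\<lambda>y. (f y, g y))" using f g by (rule simple_function_Pair)
  let ?S = "\<lambda>c \<omega>. \<Sum>v\<in>(\<lambda>y. (f y, g y)) ` D. c v * \<xi> (A \<inter> {y\<in>D. (f y, g y) = v}) \<omega>"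
  have "AE \<omega> in M. SI (\<lambda>y. f y - g y) A \<omega> = ?S (\<lambda>v. fst v - snd v) \<omega>"
    "AE \<omega> in M. SI f A \<omega> = ?S fst \<omega>"
    "AE \<omega> in M. SI g A \<omega> = ?S snd \<omega>"
    by (intro simple_stoch_integral_rep[OF V A]; simp)+
  then show ?thesis by eventually_elim (simp add: sum_subtractf left_diff_distrib)
qed

lemma simple_stoch_integral_restrict:
  assumes f: "simple_function vol f" and A: "A \<in> sets vol"
  shows "AE \<omega> in M. SI f A \<omega> = SI (\<lambda>y. f y * indicator A y) D \<omega>"
proof -
  let ?V = "\<lambda>y. (f y, indicator A y :: real)"
  have V: "simple_function vol ?V" using f A by (intro simple_function_Pair simple_function_indicator) auto
  from simple_stoch_integral_rep[OF V A, of f fst]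
    simple_stoch_integral_rep[OF V D_in_vol, of "\<lambda>y. f y * indicator A y" "\<lambda>v. fst v * snd v"] xi_empty
  have "AE \<omega> in M. SI f A \<omega> = (\<Sum>v\<in>?V ` D. fst v * \<xi> (A \<inter> {y\<in>D. ?V y = v}) \<omega>) \<and>
      SI (\<lambda>y. f y * indicator A y) D \<omega>
        = (\<Sum>v\<in>?V ` D. fst v * snd v * \<xi> (D \<inter> {y\<in>D. ?V y = v}) \<omega>) \<and> \<xi> {} \<omega> = 0"
    by simp
  then show ?thesis
  proof eventually_elim
    case (elim \<omega>)
    have "fst v * \<xi> (A \<inter> {y\<in>D. ?V y = v}) \<omega> = fst v * snd v * \<xi> (D \<inter> {y\<in>D. ?V y = v}) \<omega>" if "v \<in> ?V ` D" for v
    proof -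
      have "snd v = 1 \<or> snd v = 0" using that by (auto simp: indicator_def)
      then consider "snd v = 1" | "snd v = 0" by blast
      then show ?thesis
      proof cases
        case 1
        then have "A \<inter> {y\<in>D. ?V y = v} = D \<inter> {y\<in>D. ?V y = v}" by (auto simp: indicator_def split: if_splits)
        then show ?thesis using 1 by simp
      next
        case 2
        then have "A \<inter> {y\<in>D. ?V y = v} = {}" by (auto simp: indicator_def split: if_splits)
        then show ?thesis using 2 elim by simp
      qed
    qed
    then have "(\<Sum>v\<in>?V ` D. fst v * \<xi> (A \<inter> {y\<in>D. ?V y = v}) \<omega>)
        = (\<Sum>v\<in>?V ` D. fst v * snd v * \<xi> (D \<inter> {y\<in>D. ?V y = v}) \<omega>)"
      by (intro sum.cong refl)
    then show ?case using elim by (simp only:)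
  qed
qed

lemma nn_integral_simple_cells:
  assumes V: "simple_function vol V"
  shows "(\<integral>\<^sup>+y. g (V y) \<partial>vol) = (\<Sum>v\<in>V ` D. g v * emeasure vol (cell V v))"
proof -
  have fin: "finite (V ` D)" using V by (rule simple_finite)
  have "(\<integral>\<^sup>+y. g (V y) \<partial>vol) = (\<integral>\<^sup>+y. (\<Sum>v\<in>V ` D. g v * indicator (cell V v) y) \<partial>vol)"
  proof (rule nn_integral_cong)
    fix y assume y: "y \<in> space vol"
    have "(\<Sum>v\<in>V ` D. g v * indicator (cell V v) y) = (\<Sum>v\<in>V ` D. if v = V y then g v else 0)"
      using y by (intro sum.cong refl) (auto simp: indicator_def)
    then show "g (V y) = (\<Sum>v\<in>V ` D. g v * indicator (cell V v) y)"
      using y fin by simp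
  qed
  also have "\<dots> = (\<Sum>v\<in>V ` D. g v * emeasure vol (cell V v))"
    using cell_in_vol[OF V D_in_vol]
    by (subst nn_integral_sum) (auto intro!: sum.cong nn_integral_cmult_indicator)
  finally show ?thesis .
qed

lemma ex_cell_enumeration:
  assumes V: "simple_function vol V"
  shows "\<exists>(N :: nat) e. bij_betw e {..<N} (V ` D) \<and>
    (\<forall>n. cell V (e n) \<in> sets vol) \<and> disjoint_family_on (\<lambda>n. cell V (e n)) {..<N}"
proof -
  obtain e where e: "bij_betw e {..<card (V ` D)} (V ` D)"
    using ex_bij_betw_nat_finite[OF simple_finite[OF V]] by (auto simp: atLeast0LessThan)
  moreover have "disjoint_family_on (\<lambda>n. cell V (e n)) {..<card (V ` D)}"
    using e unfolding disjoint_family_on_def bij_betw_def inj_on_def by auto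
  ultimately show ?thesis using cell_in_vol[OF V D_in_vol] by blast
qed

end

section \<open>Bounds for sums over the cells of a partition\<close>

context noise_with_moments
begin

lemma cell_sum_bound:
  assumes \<epsilon>: "0 < \<epsilon>"
  obtains K where "0 \<le> K"
    "\<And>V :: real^'d \<Rightarrow> 'b. simple_function vol V \<Longrightarrow>
      \<exists>E\<in>events. prob (space M - E) \<le> \<epsilon> \<and>
      (\<forall>c. (\<integral>\<^sup>+\<omega>\<in>E. ennreal \<bar>\<Sum>v\<in>V ` D. c v * \<xi> (cell V v) \<omega>\<bar> \<partial>M)
        \<le> ennreal \<epsilon> + ennreal K * (\<integral>\<^sup>+y. ennreal (\<bar>c (V y)\<bar> powr q) \<partial>vol))"
proof -
  obtain K where K: "0 \<le> K" and main: "\<And>(N::nat) B. (\<forall>n<N. B n \<in> sets vol) \<Longrightarrow> disjoint_family_on B {..<N} \<Longrightarrow>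
    (\<exists>E\<in>events. prob (space M - E) \<le> \<epsilon> \<and>
      (\<forall>c. (\<integral>\<^sup>+\<omega>\<in>E. ennreal \<bar>\<Sum>n<N. c n * \<xi> (B n) \<omega>\<bar> \<partial>M)
        \<le> ennreal (\<epsilon> + K * (\<Sum>n<N. \<bar>c n\<bar> powr q * measure vol (B n)))))"
    using elementary_sum_bound[OF \<epsilon>] by blast
  show thesis
  proof (rule that[OF K])
    fix V :: "real^'d \<Rightarrow> 'b" assume V: "simple_function vol V"
    obtain N :: nat and e where e: "bij_betw e {..<N} (V ` D)"
      and cells: "\<And>n. cell V (e n) \<in> sets vol" "disjoint_family_on (\<lambda>n. cell V (e n)) {..<N}"
      using ex_cell_enumeration[OF V] by blast
    obtain E where E: "E \<in> events" "prob (space M - E) \<le> \<epsilon>"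
      and bd: "\<And>c. (\<integral>\<^sup>+\<omega>\<in>E. ennreal \<bar>\<Sum>n<N. c n * \<xi> (cell V (e n)) \<omega>\<bar> \<partial>M)
        \<le> ennreal (\<epsilon> + K * (\<Sum>n<N. \<bar>c n\<bar> powr q * measure vol (cell V (e n))))"
      using main[of N "\<lambda>n. cell V (e n)"] cells by blast
    have "(\<integral>\<^sup>+\<omega>\<in>E. ennreal \<bar>\<Sum>v\<in>V ` D. c v * \<xi> (cell V v) \<omega>\<bar> \<partial>M)
        \<le> ennreal \<epsilon> + ennreal K * (\<integral>\<^sup>+y. ennreal (\<bar>c (V y)\<bar> powr q) \<partial>vol)" for c
    proof -
      have r: "(\<Sum>n<N. h (e n)) = (\<Sum>v\<in>V ` D. h v)" for h :: "'b \<Rightarrow> real"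
        by (rule sum.reindex_bij_betw[OF e])
      have "(\<integral>\<^sup>+y. ennreal (\<bar>c (V y)\<bar> powr q) \<partial>vol)
          = (\<Sum>v\<in>V ` D. ennreal (\<bar>c v\<bar> powr q) * emeasure vol (cell V v))"
        by (rule nn_integral_simple_cells[OF V])
      also have "\<dots> = ennreal (\<Sum>v\<in>V ` D. \<bar>c v\<bar> powr q * measure vol (cell V v))"
        by (subst sum_ennreal[symmetric]) (auto simp: vol.emeasure_eq_measure ennreal_mult intro!: sum.cong)
      finally have i: "(\<integral>\<^sup>+y. ennreal (\<bar>c (V y)\<bar> powr q) \<partial>vol)
          = ennreal (\<Sum>v\<in>V ` D. \<bar>c v\<bar> powr q * measure vol (cell V v))" .
      have "ennreal \<epsilon> + ennreal K * (\<integral>\<^sup>+y. ennreal (\<bar>c (V y)\<bar> powr q) \<partial>vol)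
          = ennreal (\<epsilon> + K * (\<Sum>v\<in>V ` D. \<bar>c v\<bar> powr q * measure vol (cell V v)))"
        unfolding i using \<epsilon> K by (simp add: ennreal_mult sum_nonneg)
      then show ?thesis
        using bd[of "\<lambda>n. c (e n)"] unfolding r[of "\<lambda>v. c v * \<xi> (cell V v) _"]
          r[of "\<lambda>v. \<bar>c v\<bar> powr q * measure vol (cell V v)"] by simp
    qed
    with E show "\<exists>E\<in>events. prob (space M - E) \<le> \<epsilon> \<and>
      (\<forall>c. (\<integral>\<^sup>+\<omega>\<in>E. ennreal \<bar>\<Sum>v\<in>V ` D. c v * \<xi> (cell V v) \<omega>\<bar> \<partial>M)
        \<le> ennreal \<epsilon> + ennreal K * (\<integral>\<^sup>+y. ennreal (\<bar>c (V y)\<bar> powr q) \<partial>vol))"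
      by blast
  qed
qed

text \<open>The event does not depend on the coefficients, so on it the bound applies to
  \<open>c x\<close> for every \<open>x\<close>, and Tonelli integrates it over \<open>D\<close>.
  Off the event, the minimum with 1 leaves only its probability.\<close>

lemma kernel_sum_bound:
  assumes \<epsilon>: "0 < \<epsilon>"
  shows "\<exists>K\<ge>0. \<forall>(V :: real^'d \<Rightarrow> 'b) c. simple_function vol V \<longrightarrow>
      (\<forall>v\<in>V ` D. (\<lambda>x. c x v) \<in> borel_measurable vol) \<longrightarrow>
      (\<integral>\<^sup>+\<omega>. min 1 (\<integral>\<^sup>+x. ennreal \<bar>\<Sum>v\<in>V ` D. c x v * \<xi> (cell V v) \<omega>\<bar> \<partial>vol) \<partial>M)
        \<le> ennreal \<epsilon> + ennreal K * (\<integral>\<^sup>+x. \<integral>\<^sup>+y. ennreal (\<bar>c x (V y)\<bar> powr q) \<partial>vol \<partial>vol)"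
proof -
  define m where "m = measure vol D"
  \<comment> \<open>The error \<delta> occurs once as a probability and once integrated over
    \<open>D\<close>, where it becomes \<open>\<delta> * m\<close>.\<close>
  define \<delta> where "\<delta> = \<epsilon> / (1 + m)"
  have m: "0 < 1 + m" by (simp add: m_def add_pos_nonneg)
  have \<delta>: "0 < \<delta>" "\<delta> + \<delta> * m = \<epsilon>"
  proof -
    have "\<delta> * (1 + m) = \<epsilon>" using m by (simp add: \<delta>_def)
    then show "\<delta> + \<delta> * m = \<epsilon>" by (simp add: algebra_simps)
    show "0 < \<delta>" using \<epsilon> m by (simp add: \<delta>_def)
  qed
  obtain K where K: "0 \<le> K" and main: "\<And>V :: real^'d \<Rightarrow> 'b. simple_function vol V \<Longrightarrow>
      \<exists>E\<in>events. prob (space M - E) \<le> \<delta> \<and>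
      (\<forall>c. (\<integral>\<^sup>+\<omega>\<in>E. ennreal \<bar>\<Sum>v\<in>V ` D. c v * \<xi> (cell V v) \<omega>\<bar> \<partial>M)
        \<le> ennreal \<delta> + ennreal K * (\<integral>\<^sup>+y. ennreal (\<bar>c (V y)\<bar> powr q) \<partial>vol))"
    by (rule cell_sum_bound[OF \<delta>(1), where 'b = 'b]) (rule that)
  show ?thesis
  proof (rule exI[of _ K], rule conjI[OF K], intro allI impI)
    fix V :: "real^'d \<Rightarrow> 'b" and c :: "real^'d \<Rightarrow> 'b \<Rightarrow> real"
    assume V: "simple_function vol V" and c': "\<forall>v\<in>V ` D. (\<lambda>x. c x v) \<in> borel_measurable vol"
    have c: "(\<lambda>x. c x v) \<in> borel_measurable vol" if "v \<in> V ` D" for v using c' that by blast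
    obtain E where E[measurable]: "E \<in> events" and PE: "prob (space M - E) \<le> \<delta>"
      and bd: "\<And>c. (\<integral>\<^sup>+\<omega>\<in>E. ennreal \<bar>\<Sum>v\<in>V ` D. c v * \<xi> (cell V v) \<omega>\<bar> \<partial>M)
        \<le> ennreal \<delta> + ennreal K * (\<integral>\<^sup>+y. ennreal (\<bar>c (V y)\<bar> powr q) \<partial>vol)"
      using main[OF V] by blast
    interpret P: pair_sigma_finite M vol ..
    define S where "S x \<omega> = (\<Sum>v\<in>V ` D. c x v * \<xi> (cell V v) \<omega>)" for x \<omega>
    have S[measurable]: "(\<lambda>(\<omega>, x). S x \<omega>) \<in> borel_measurable (M \<Otimes>\<^sub>M vol)"
      unfolding split_beta' S_def
    proof (intro borel_measurable_sum borel_measurable_times)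
      fix v assume v: "v \<in> V ` D"
      show "(\<lambda>z. c (snd z) v) \<in> borel_measurable (M \<Otimes>\<^sub>M vol)"
        using measurable_compose[OF measurable_snd c[OF v]] .
      show "(\<lambda>z. \<xi> (cell V v) (fst z)) \<in> borel_measurable (M \<Otimes>\<^sub>M vol)"
        using measurable_compose[OF measurable_fst xi_measurable[OF cell_in_vol[OF V D_in_vol]]] .
    qed
    have cm[measurable]: "(\<lambda>x. \<integral>\<^sup>+y. ennreal (\<bar>c x (V y)\<bar> powr q) \<partial>vol) \<in> borel_measurable vol"
    proof -
      have "(\<lambda>x. \<Sum>v\<in>V ` D. ennreal (\<bar>c x v\<bar> powr q) * emeasure vol (cell V v)) \<in> borel_measurable vol"
        using c by measurable
      then show ?thesis using nn_integral_simple_cells[OF V, of "\<lambda>v. ennreal (\<bar>c _ v\<bar> powr q)"] by simp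
    qed
    have "(\<integral>\<^sup>+\<omega>. min 1 (\<integral>\<^sup>+x. ennreal \<bar>S x \<omega>\<bar> \<partial>vol) \<partial>M)
        \<le> (\<integral>\<^sup>+\<omega>. indicator (space M - E) \<omega> + (\<integral>\<^sup>+x. ennreal \<bar>S x \<omega>\<bar> * indicator E \<omega> \<partial>vol) \<partial>M)"
    proof (rule nn_integral_mono)
      fix \<omega> assume \<omega>: "\<omega> \<in> space M"
      show "min 1 (\<integral>\<^sup>+x. ennreal \<bar>S x \<omega>\<bar> \<partial>vol)
          \<le> indicator (space M - E) \<omega> + (\<integral>\<^sup>+x. ennreal \<bar>S x \<omega>\<bar> * indicator E \<omega> \<partial>vol)"
        using \<omega> by (cases "\<omega> \<in> E") auto
    qed
    also have "\<dots> = emeasure M (space M - E) + (\<integral>\<^sup>+\<omega>. (\<integral>\<^sup>+x. ennreal \<bar>S x \<omega>\<bar> * indicator E \<omega> \<partial>vol) \<partial>M)"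
      by (subst nn_integral_add) auto
    also have "(\<integral>\<^sup>+\<omega>. (\<integral>\<^sup>+x. ennreal \<bar>S x \<omega>\<bar> * indicator E \<omega> \<partial>vol) \<partial>M)
        = (\<integral>\<^sup>+x. (\<integral>\<^sup>+\<omega>. ennreal \<bar>S x \<omega>\<bar> * indicator E \<omega> \<partial>M) \<partial>vol)"
      by (rule P.Fubini'[symmetric]) measurable
    also have "\<dots> \<le> (\<integral>\<^sup>+x. ennreal \<delta> + ennreal K * (\<integral>\<^sup>+y. ennreal (\<bar>c x (V y)\<bar> powr q) \<partial>vol) \<partial>vol)"
      unfolding S_def by (intro nn_integral_mono bd)
    also have "\<dots> = ennreal (\<delta> * m) + ennreal K * (\<integral>\<^sup>+x. \<integral>\<^sup>+y. ennreal (\<bar>c x (V y)\<bar> powr q) \<partial>vol \<partial>vol)"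
      using \<delta> by (subst nn_integral_add) (auto simp: nn_integral_cmult cm m_def vol.emeasure_eq_measure ennreal_mult)
    also have "emeasure M (space M - E) + (ennreal (\<delta> * m) + ennreal K * (\<integral>\<^sup>+x. \<integral>\<^sup>+y. ennreal (\<bar>c x (V y)\<bar> powr q) \<partial>vol \<partial>vol))
        \<le> ennreal \<delta> + (ennreal (\<delta> * m) + ennreal K * (\<integral>\<^sup>+x. \<integral>\<^sup>+y. ennreal (\<bar>c x (V y)\<bar> powr q) \<partial>vol \<partial>vol))"
      using PE by (intro add_right_mono) (simp add: emeasure_eq_measure ennreal_leI)
    also have "\<dots> = ennreal \<epsilon> + ennreal K * (\<integral>\<^sup>+x. \<integral>\<^sup>+y. ennreal (\<bar>c x (V y)\<bar> powr q) \<partial>vol \<partial>vol)"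
      using \<delta> by (simp add: add.assoc[symmetric] ennreal_plus[symmetric] m_def del: ennreal_plus)
    finally show "(\<integral>\<^sup>+\<omega>. min 1 (\<integral>\<^sup>+x. ennreal \<bar>\<Sum>v\<in>V ` D. c x v * \<xi> (cell V v) \<omega>\<bar> \<partial>vol) \<partial>M)
        \<le> ennreal \<epsilon> + ennreal K * (\<integral>\<^sup>+x. \<integral>\<^sup>+y. ennreal (\<bar>c x (V y)\<bar> powr q) \<partial>vol \<partial>vol)"
      unfolding S_def by (simp add: add_mono)
  qed
qed

text \<open>Restriction to \<open>A\<close> is absorbed into the integrand, whose \<open>L^q\<close>
  size it can only decrease. One constant therefore serves all the sets over which the definition of
  the stochastic integral asks for convergence.\<close>

lemma simple_integral_bound:
  assumes \<epsilon>: "0 < \<epsilon>"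
  obtains K where "0 \<le> K"
    "\<And>f A. simple_function vol f \<Longrightarrow> A \<in> sets vol \<Longrightarrow>
      prob_size (SI f A) \<le> ennreal \<epsilon> + ennreal K * (\<integral>\<^sup>+y. ennreal (\<bar>f y\<bar> powr q) \<partial>vol)"
proof -
  have \<epsilon>2: "0 < \<epsilon> / 2" using \<epsilon> by simp
  obtain K where K: "0 \<le> K" and main: "\<And>V :: real^'d \<Rightarrow> real. simple_function vol V \<Longrightarrow>
      \<exists>E\<in>events. prob (space M - E) \<le> \<epsilon> / 2 \<and>
      (\<forall>c. (\<integral>\<^sup>+\<omega>\<in>E. ennreal \<bar>\<Sum>v\<in>V ` D. c v * \<xi> (cell V v) \<omega>\<bar> \<partial>M)
        \<le> ennreal (\<epsilon> / 2) + ennreal K * (\<integral>\<^sup>+y. ennreal (\<bar>c (V y)\<bar> powr q) \<partial>vol))"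
    by (rule cell_sum_bound[OF \<epsilon>2, where 'b = real]) (rule that)
  show thesis
  proof (rule that[OF K])
    fix f :: "real^'d \<Rightarrow> real" and A assume f: "simple_function vol f" and A: "A \<in> sets vol"
    define g where "g y = f y * indicator A y" for y
    have g: "simple_function vol g" unfolding g_def using f A by (intro simple_function_mult simple_function_indicator) auto
    have gm[measurable]: "SI g D \<in> borel_measurable M"
      by (rule simple_stoch_integral_measurable[OF g D_in_vol])
    obtain E where E[measurable]: "E \<in> events" and PE: "prob (space M - E) \<le> \<epsilon> / 2"
      and bd': "\<And>c. (\<integral>\<^sup>+\<omega>\<in>E. ennreal \<bar>\<Sum>v\<in>g ` D. c v * \<xi> (D \<inter> {y\<in>D. g y = v}) \<omega>\<bar> \<partial>M)
        \<le> ennreal (\<epsilon> / 2) + ennreal K * (\<integral>\<^sup>+y. ennreal (\<bar>c (g y)\<bar> powr q) \<partial>vol)"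
      using main[OF g] by blast
    have bd: "(\<integral>\<^sup>+\<omega>\<in>E. ennreal \<bar>SI g D \<omega>\<bar> \<partial>M)
        \<le> ennreal (\<epsilon> / 2) + ennreal K * (\<integral>\<^sup>+y. ennreal (\<bar>g y\<bar> powr q) \<partial>vol)"
      using bd'[of "\<lambda>v. v"] unfolding simple_stoch_integral_def .
    have "prob_size (SI f A) = prob_size (SI g D)"
      using simple_stoch_integral_restrict[OF f A] unfolding g_def by (rule prob_size_cong_AE)
    also have "\<dots> \<le> (\<integral>\<^sup>+\<omega>. indicator (space M - E) \<omega> + ennreal \<bar>SI g D \<omega>\<bar> * indicator E \<omega> \<partial>M)"
      unfolding prob_size_def
    proof (rule nn_integral_mono)
      fix \<omega> assume \<omega>: "\<omega> \<in> space M"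
      show "ennreal (min 1 \<bar>SI g D \<omega>\<bar>)
          \<le> indicator (space M - E) \<omega> + ennreal \<bar>SI g D \<omega>\<bar> * indicator E \<omega>"
        using \<omega> by (cases "\<omega> \<in> E") (auto intro!: ennreal_leI)
    qed
    also have "\<dots> = emeasure M (space M - E) + (\<integral>\<^sup>+\<omega>\<in>E. ennreal \<bar>SI g D \<omega>\<bar> \<partial>M)"
      by (subst nn_integral_add) auto
    also have "\<dots> \<le> ennreal (\<epsilon> / 2) + (ennreal (\<epsilon> / 2) + ennreal K * (\<integral>\<^sup>+y. ennreal (\<bar>g y\<bar> powr q) \<partial>vol))"
      using PE by (intro add_mono bd) (simp add: emeasure_eq_measure ennreal_leI)
    also have "\<dots> = ennreal \<epsilon> + ennreal K * (\<integral>\<^sup>+y. ennreal (\<bar>g y\<bar> powr q) \<partial>vol)"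
      using \<epsilon> by (simp add: add.assoc[symmetric] ennreal_plus[symmetric] del: ennreal_plus)
    also have "\<dots> \<le> ennreal \<epsilon> + ennreal K * (\<integral>\<^sup>+y. ennreal (\<bar>f y\<bar> powr q) \<partial>vol)"
      by (intro add_left_mono mult_left_mono nn_integral_mono) (auto simp: g_def indicator_def)
    finally show "prob_size (SI f A)
        \<le> ennreal \<epsilon> + ennreal K * (\<integral>\<^sup>+y. ennreal (\<bar>f y\<bar> powr q) \<partial>vol)" .
  qed
qed

end

section \<open>Uniqueness of the stochastic integral\<close>

text \<open>The Vitali-Hahn-Saks phenomenon, by a gliding hump: if the integrals had a nonzero limit,
  the mass of \<open>H (n k)\<close> would sit on the sets \<open>E (n k)\<close> of rapidly decreasing measure, and over
  \<open>A\<close>, which collects every other hump, the integrals would oscillate.\<close>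

lemma (in finite_measure) gliding_hump:
  fixes H :: "nat \<Rightarrow> 'a \<Rightarrow> real"
  assumes int: "\<And>n. integrable M (H n)" and bnd: "\<And>n. \<exists>K. \<forall>x\<in>space M. \<bar>H n x\<bar> \<le> K"
    and null: "AE x in M. (\<lambda>n. H n x) \<longlonglongrightarrow> 0"
    and conv: "\<And>A. A \<in> sets M \<Longrightarrow> convergent (\<lambda>n. \<integral>x. H n x * indicator A x \<partial>M)"
  shows "(\<lambda>n. \<integral>x. H n x \<partial>M) \<longlonglongrightarrow> 0"
proof (rule ccontr)
  assume nz: "\<not> ?thesis"
  have [measurable]: "H n \<in> borel_measurable M" for n using int by auto
  have intA: "integrable M (\<lambda>x. H n x * indicator A x)" if "A \<in> sets M" for n A
    using that int by (intro integrable_real_mult_indicator)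
  obtain c where c: "(\<lambda>n. \<integral>x. H n x \<partial>M) \<longlonglongrightarrow> c"
  proof -
    have "(\<integral>x. H n x * indicator (space M) x \<partial>M) = (\<integral>x. H n x \<partial>M)" for n
      by (intro Bochner_Integration.integral_cong) auto
    then show thesis using conv[of "space M"] that by (auto simp: convergent_def)
  qed
  have "c \<noteq> 0" using nz c by auto
  \<comment> \<open>In the end both \<open>\<bar>l - c\<bar>\<close> and
    \<open>\<bar>l\<bar>\<close> are at most \<open>2 * \<epsilon>\<close>, which is absurd as soon
    as \<open>4 * \<epsilon>\<close> is below \<open>\<bar>c\<bar>\<close>.\<close>
  define \<epsilon> where "\<epsilon> = \<bar>c\<bar> / 10"
  have \<epsilon>: "0 < \<epsilon>" using \<open>c \<noteq> 0\<close> by (simp add: \<epsilon>_def)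
  define \<eta> where "\<eta> = \<epsilon> / (measure M (space M) + 1)"
  have pos: "0 < measure M (space M) + 1" by (simp add: add_nonneg_pos)
  have \<eta>: "0 < \<eta>" "\<eta> * measure M (space M) \<le> \<epsilon>"
  proof -
    show "0 < \<eta>" using \<epsilon> pos by (simp add: \<eta>_def)
    have "\<eta> * (measure M (space M) + 1) = \<epsilon>" using pos by (simp add: \<eta>_def)
    then show "\<eta> * measure M (space M) \<le> \<epsilon>" using \<open>0 < \<eta>\<close> by (simp add: algebra_simps)
  qed
  define E where "E n = {x\<in>space M. \<bar>H n x\<bar> > \<eta>}" for n
  have E[measurable]: "E n \<in> sets M" for n unfolding E_def by measurable
  have outside: "\<bar>\<integral>x. H n x * indicator B x \<partial>M\<bar> \<le> \<epsilon>" if [measurable]: "B \<in> sets M" and B: "B \<inter> E n = {}" for n B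
  proof -
    have "\<bar>\<integral>x. H n x * indicator B x \<partial>M\<bar> \<le> (\<integral>x. \<bar>H n x * indicator B x\<bar> \<partial>M)" by (rule integral_abs_bound)
    also have "\<dots> \<le> (\<integral>x. \<eta> \<partial>M)"
      using intA[OF that(1)] \<eta> B sets.sets_into_space[OF that(1)]
      by (intro integral_mono integrable_abs) (auto simp: E_def indicator_def abs_mult)
    also have "\<dots> \<le> \<epsilon>" using \<eta> by (simp add: mult.commute)
    finally show ?thesis .
  qed
  \<comment> \<open>Absolute continuity of the integral of each single \<open>H n\<close>,
    elementary because \<open>H n\<close> is bounded.\<close>
  have "\<exists>\<delta>>0. \<forall>B\<in>sets M. measure M B \<le> \<delta> \<longrightarrow> \<bar>\<integral>x. H n x * indicator B x \<partial>M\<bar> \<le> \<epsilon>" for n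
  proof -
    obtain K where K: "\<And>x. x \<in> space M \<Longrightarrow> \<bar>H n x\<bar> \<le> K" using bnd by blast
    define L where "L = \<bar>K\<bar> + 1"
    have L: "0 < L" "\<And>x. x \<in> space M \<Longrightarrow> \<bar>H n x\<bar> \<le> L" using K by (fastforce simp: L_def)+
    have "\<bar>\<integral>x. H n x * indicator B x \<partial>M\<bar> \<le> \<epsilon>" if B[measurable]: "B \<in> sets M" and m: "measure M B \<le> \<epsilon> / L" for B
    proof -
      have "\<bar>\<integral>x. H n x * indicator B x \<partial>M\<bar> \<le> (\<integral>x. \<bar>H n x * indicator B x\<bar> \<partial>M)" by (rule integral_abs_bound)
      also have "\<dots> \<le> (\<integral>x. L * indicator B x \<partial>M)"
      proof (intro integral_mono integrable_abs intA B)
        show "integrable M (\<lambda>x. L * indicator B x)"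
          by (intro integrable_mult_right integrable_real_indicator B) (simp add: emeasure_eq_measure)
      qed (use L in \<open>auto simp: indicator_def\<close>)
      also have "\<dots> = L * measure M B" by simp
      also have "\<dots> \<le> \<epsilon>" using m L by (simp add: field_simps)
      finally show ?thesis .
    qed
    then show ?thesis using \<epsilon> L by (intro exI[of _ "\<epsilon> / L"]) auto
  qed
  then obtain \<delta> where \<delta>: "\<And>n. 0 < \<delta> n"
      "\<And>n B. B \<in> sets M \<Longrightarrow> measure M B \<le> \<delta> n \<Longrightarrow> \<bar>\<integral>x. H n x * indicator B x \<partial>M\<bar> \<le> \<epsilon>"
    by metis
  have small: "(\<lambda>n. measure M (E n)) \<longlonglongrightarrow> 0"
  proof -
    have "(\<lambda>n. \<integral>x. indicator (E n) x \<partial>M) \<longlonglongrightarrow> (\<integral>x. (0::real) \<partial>M)"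
    proof (rule integral_dominated_convergence[where w = "\<lambda>_. 1"])
      show "AE x in M. (\<lambda>n. indicator (E n) x :: real) \<longlonglongrightarrow> 0"
        using null
      proof eventually_elim
        case (elim x)
        then have "(\<lambda>n. \<bar>H n x\<bar>) \<longlonglongrightarrow> 0" by (rule tendsto_rabs_zero)
        then have "\<forall>\<^sub>F n in sequentially. \<bar>H n x\<bar> < \<eta>" using \<eta> by (intro order_tendstoD) auto
        then have "\<forall>\<^sub>F n in sequentially. (0::real) = indicator (E n) x"
          by eventually_elim (auto simp: E_def)
        then show ?case using Lim_transform_eventually[OF tendsto_const] by fast
      qed
    qed auto
    then show ?thesis by simp
  qed
  \<comment> \<open>The pair carries the index of a hump and a budget \<open>d\<close> for the later
    ones: the next hump has measure at most \<open>d\<close> and budgets at least halve, so all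
    later humps together have measure at most \<open>2 * d\<close>. By the choice of \<delta>, the
    current function contributes at most \<epsilon> over such a set.\<close>
  define P where "P = (\<lambda>(k::nat) (n::nat, d::real). 0 < d \<and> 2 * d \<le> \<delta> n)"
  define Q where "Q = (\<lambda>(k::nat) (n::nat, d::real) (n', d'). n < n' \<and> measure M (E n') \<le> d \<and> d' \<le> d / 2)"
  have "\<exists>f. \<forall>k. P k (f k) \<and> Q k (f k) (f (Suc k))"
  proof (rule dependent_nat_choice)
    show "\<exists>x. P 0 x" using \<delta>(1)[of 0] by (intro exI[of _ "(0, \<delta> 0 / 2)"]) (simp add: P_def)
    fix x k assume "P k x"
    then obtain n d where x: "x = (n, d)" "0 < d" by (auto simp: P_def)
    have "\<forall>\<^sub>F n' in sequentially. measure M (E n') < d \<and> n < n'"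
      using order_tendstoD(2)[OF small x(2)] eventually_gt_at_top[of n] by (rule eventually_conj)
    then obtain n' where n': "measure M (E n') < d" "n < n'" by (auto simp: eventually_sequentially)
    show "\<exists>y. P (Suc k) y \<and> Q k x y"
      using n' x \<delta>(1)[of n'] by (intro exI[of _ "(n', min (d / 2) (\<delta> n' / 2))"]) (auto simp: P_def Q_def)
  qed
  then obtain f where f: "\<And>k. P k (f k)" "\<And>k. Q k (f k) (f (Suc k))" by blast
  define n where "n k = fst (f k)" for k
  define d where "d k = snd (f k)" for k
  have d: "0 < d k" "2 * d k \<le> \<delta> (n k)" for k using f(1)[of k] by (auto simp: P_def n_def d_def split_beta)
  have step: "n k < n (Suc k)" "measure M (E (n (Suc k))) \<le> d k" "d (Suc k) \<le> d k / 2" for k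
    using f(2)[of k] by (auto simp: Q_def n_def d_def split_beta)
  have sub: "strict_mono n" using step by (simp add: strict_mono_Suc_iff)
  have dk: "d (k + i) \<le> d k * (1/2) ^ i" for k i
  proof (induction i)
    case (Suc i)
    then show ?case using step(3)[of "k + i"] by simp
  qed simp
  define T where "T k = (\<Union>i. E (n (k + Suc i)))" for k
  have T[measurable]: "T k \<in> sets M" for k unfolding T_def by measurable
  have T_small: "measure M (T k) \<le> \<delta> (n k)" for k
  proof -
    have le: "measure M (E (n (k + Suc i))) \<le> d k * (1/2) ^ i" for i
      using step(2)[of "k + i"] dk[of k i] by simp
    have sm: "summable (\<lambda>i. d k * (1/2::real) ^ i)" by (intro summable_mult summable_geometric) simp
    have sm2: "summable (\<lambda>i. measure M (E (n (k + Suc i))))"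
      by (rule summable_comparison_test'[OF sm, of 0]) (use le in auto)
    have "measure M (T k) \<le> (\<Sum>i. measure M (E (n (k + Suc i))))"
      unfolding T_def using sm2 by (intro finite_measure_subadditive_countably) auto
    also have "\<dots> \<le> (\<Sum>i. d k * (1/2) ^ i)" by (intro suminf_le le sm sm2)
    also have "\<dots> = 2 * d k" by (subst suminf_mult) (auto simp: suminf_geometric intro: summable_geometric)
    also have "\<dots> \<le> \<delta> (n k)" by (rule d)
    finally show ?thesis .
  qed
  \<comment> \<open>Each even hump enters without the later humps. What is lost is too small for the
    function of that hump to notice, and an odd hump can meet \<open>A\<close> only through even
    humps that come after it.\<close>
  define A where "A = (\<Union>k. E (n (2 * k)) - T (2 * k))"
  have A[measurable]: "A \<in> sets M" unfolding A_def by measurable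
  have in_T: "x \<in> T k" if "x \<in> E (n j)" "k < j" for x k j
  proof -
    have "j = k + Suc (j - k - 1)" using that by simp
    then show ?thesis unfolding T_def using that by (metis UN_I UNIV_I)
  qed
  have two: "\<bar>\<integral>x. H (n k) x * indicator B x \<partial>M\<bar> \<le> 2 * \<epsilon>"
    if B[measurable]: "B \<in> sets M" and sub: "B \<inter> E (n k) \<subseteq> T k" for B k
  proof -
    have "(\<integral>x. H (n k) x * indicator B x \<partial>M)
        = (\<integral>x. H (n k) x * indicator (B \<inter> T k) x + H (n k) x * indicator (B - T k) x \<partial>M)"
      by (intro Bochner_Integration.integral_cong) (auto simp: indicator_def)
    also have "\<dots> = (\<integral>x. H (n k) x * indicator (B \<inter> T k) x \<partial>M) + (\<integral>x. H (n k) x * indicator (B - T k) x \<partial>M)"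
      by (intro Bochner_Integration.integral_add intA) auto
    finally have eq: "(\<integral>x. H (n k) x * indicator B x \<partial>M) = \<dots>" .
    have "measure M (B \<inter> T k) \<le> \<delta> (n k)"
      by (rule order_trans[OF finite_measure_mono T_small]) auto
    then have "\<bar>\<integral>x. H (n k) x * indicator (B \<inter> T k) x \<partial>M\<bar> \<le> \<epsilon>" by (intro \<delta>(2)) auto
    moreover have "\<bar>\<integral>x. H (n k) x * indicator (B - T k) x \<partial>M\<bar> \<le> \<epsilon>"
      using sub by (intro outside) auto
    ultimately show ?thesis unfolding eq by linarith
  qed
  have even: "\<bar>(\<integral>x. H (n (2 * k)) x * indicator A x \<partial>M) - (\<integral>x. H (n (2 * k)) x \<partial>M)\<bar> \<le> 2 * \<epsilon>" for k
  proof -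
    have "(\<integral>x. H (n (2 * k)) x \<partial>M)
        = (\<integral>x. H (n (2 * k)) x * indicator A x + H (n (2 * k)) x * indicator (space M - A) x \<partial>M)"
      by (intro Bochner_Integration.integral_cong) (auto simp: indicator_def)
    also have "\<dots> = (\<integral>x. H (n (2 * k)) x * indicator A x \<partial>M) + (\<integral>x. H (n (2 * k)) x * indicator (space M - A) x \<partial>M)"
      by (intro Bochner_Integration.integral_add intA) auto
    finally have "(\<integral>x. H (n (2 * k)) x * indicator A x \<partial>M) - (\<integral>x. H (n (2 * k)) x \<partial>M)
        = - (\<integral>x. H (n (2 * k)) x * indicator (space M - A) x \<partial>M)" by simp
    moreover have "\<bar>\<integral>x. H (n (2 * k)) x * indicator (space M - A) x \<partial>M\<bar> \<le> 2 * \<epsilon>"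
      by (intro two) (auto simp: A_def)
    ultimately show ?thesis by simp
  qed
  have odd: "\<bar>\<integral>x. H (n (Suc (2 * k))) x * indicator A x \<partial>M\<bar> \<le> 2 * \<epsilon>" for k
  proof (rule two)
    show "A \<inter> E (n (Suc (2 * k))) \<subseteq> T (Suc (2 * k))"
    proof
      fix x assume x: "x \<in> A \<inter> E (n (Suc (2 * k)))"
      then obtain j where j: "x \<in> E (n (2 * j))" "x \<notin> T (2 * j)" by (auto simp: A_def)
      have "\<not> 2 * j < Suc (2 * k)" using in_T[of x "Suc (2 * k)" "2 * j"] x j by auto
      then have "Suc (2 * k) < 2 * j" by presburger
      then show "x \<in> T (Suc (2 * k))" using in_T j by blast
    qed
  qed simp
  obtain l where l: "(\<lambda>n. \<integral>x. H n x * indicator A x \<partial>M) \<longlonglongrightarrow> l"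
    using conv[OF A] by (auto simp: convergent_def)
  have subs: "strict_mono (\<lambda>k. n (2 * k))" "strict_mono (\<lambda>k. n (Suc (2 * k)))"
    using sub by (auto simp: strict_mono_def)
  have "(\<lambda>k. \<bar>(\<integral>x. H (n (2 * k)) x * indicator A x \<partial>M) - (\<integral>x. H (n (2 * k)) x \<partial>M)\<bar>) \<longlonglongrightarrow> \<bar>l - c\<bar>"
    using LIMSEQ_subseq_LIMSEQ[OF l subs(1)] LIMSEQ_subseq_LIMSEQ[OF c subs(1)]
    by (intro tendsto_intros) (auto simp: comp_def)
  then have 1: "\<bar>l - c\<bar> \<le> 2 * \<epsilon>" using even by (intro LIMSEQ_le_const2) auto
  have "(\<lambda>k. \<bar>\<integral>x. H (n (Suc (2 * k))) x * indicator A x \<partial>M\<bar>) \<longlonglongrightarrow> \<bar>l\<bar>"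
    using LIMSEQ_subseq_LIMSEQ[OF l subs(2)] by (intro tendsto_intros) (auto simp: comp_def)
  then have 2: "\<bar>l\<bar> \<le> 2 * \<epsilon>" using odd by (intro LIMSEQ_le_const2) auto
  from 1 2 show False using \<open>c \<noteq> 0\<close> unfolding \<epsilon>_def by linarith
qed

text \<open>Levy's continuity theorem for the limit 0: dominated convergence over the bounded
  frequency range \<open>[0, \<delta>]\<close> makes the averaged tail bound tend to 0.\<close>

lemma (in prob_space) in_prob_0_of_cos:
  assumes X[measurable]: "\<And>n. X n \<in> borel_measurable M"
    and lim: "\<And>u. (\<lambda>n. expectation (\<lambda>\<omega>. 1 - cos (u * X n \<omega>))) \<longlonglongrightarrow> 0"
  shows "tendsto_in_prob M X (\<lambda>_. 0)"
  unfolding tendsto_in_prob_def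
proof (intro conjI allI impI X)
  show "(\<lambda>_. 0) \<in> borel_measurable M" by simp
  fix \<epsilon> :: real assume \<epsilon>: "0 < \<epsilon>"
  define \<delta> where "\<delta> = 2 / \<epsilon>"
  have \<delta>: "0 < \<delta>" "2 / \<delta> = \<epsilon>" using \<epsilon> by (auto simp: \<delta>_def)
  define \<phi> where "\<phi> n u = expectation (\<lambda>\<omega>. 1 - cos (u * X n \<omega>))" for n u
  have \<phi>2: "0 \<le> \<phi> n u" "\<phi> n u \<le> 2" for n u
  proof -
    have b: "0 \<le> 1 - cos y" "1 - cos y \<le> 2" for y :: real
      using cos_ge_minus_one[of y] cos_le_one[of y] by linarith+
    show "0 \<le> \<phi> n u" unfolding \<phi>_def by (rule Bochner_Integration.integral_nonneg) (rule b)
    have "\<phi> n u \<le> expectation (\<lambda>_. 2)"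
      unfolding \<phi>_def by (intro integral_mono integrable_one_minus_cos X b) simp
    then show "\<phi> n u \<le> 2" by (simp add: prob_space)
  qed
  have [measurable]: "\<phi> n \<in> borel_measurable borel" for n
  proof -
    have "(\<lambda>u. expectation (\<lambda>\<omega>. 1 - cos (u * X n \<omega>))) \<in> borel_measurable borel" by measurable
    then show ?thesis by (simp add: \<phi>_def[abs_def])
  qed
  have "(\<lambda>n. \<integral>\<^sup>+u. ennreal (\<phi> n u) * indicator {0..\<delta>} u \<partial>lborel) \<longlonglongrightarrow> (\<integral>\<^sup>+u. 0 \<partial>(lborel :: real measure))"
  proof (rule nn_integral_dominated_convergence[where w = "\<lambda>u. 2 * indicator {0..\<delta>} u"])
    show "AE u in lborel. ennreal (\<phi> n u) * indicator {0..\<delta>} u \<le> 2 * indicator {0..\<delta>} u" for n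
      using \<phi>2(2)[of n] by (auto simp: indicator_def intro!: ennreal_leI[of _ 2, simplified])
    show "(\<integral>\<^sup>+u. 2 * indicator {0..\<delta>} u \<partial>(lborel :: real measure)) < \<infinity>"
      using \<delta> by (subst nn_integral_cmult_indicator) (auto simp: ennreal_mult_less_top)
    show "AE u in lborel. (\<lambda>n. ennreal (\<phi> n u) * indicator {0..\<delta>} u) \<longlonglongrightarrow> 0"
    proof (rule AE_I2)
      fix u :: real
      have "(\<lambda>n. ennreal (\<phi> n u)) \<longlonglongrightarrow> ennreal 0" unfolding \<phi>_def by (intro tendsto_ennrealI lim)
      then show "(\<lambda>n. ennreal (\<phi> n u) * indicator {0..\<delta>} u) \<longlonglongrightarrow> 0"
        by (cases "u \<in> {0..\<delta>}") auto
    qed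
  qed auto
  then have lim: "(\<lambda>n. \<integral>\<^sup>+u. ennreal (\<phi> n u) * indicator {0..\<delta>} u \<partial>lborel) \<longlonglongrightarrow> 0" by simp
  have "(\<lambda>n. ennreal (\<delta> / 2 * prob {\<omega>\<in>space M. \<bar>X n \<omega>\<bar> > \<epsilon>})) \<longlonglongrightarrow> 0"
  proof (rule tendsto_sandwich[OF _ _ tendsto_const lim])
    show "\<forall>\<^sub>F n in sequentially. ennreal (\<delta> / 2 * prob {\<omega>\<in>space M. \<bar>X n \<omega>\<bar> > \<epsilon>})
        \<le> (\<integral>\<^sup>+u. ennreal (\<phi> n u) * indicator {0..\<delta>} u \<partial>lborel)"
    proof (rule always_eventually, rule allI)
      fix n
      show "ennreal (\<delta> / 2 * prob {\<omega>\<in>space M. \<bar>X n \<omega>\<bar> > \<epsilon>})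
          \<le> (\<integral>\<^sup>+u. ennreal (\<phi> n u) * indicator {0..\<delta>} u \<partial>lborel)"
        using tail_le_integral_cos[OF X \<delta>(1), of n] \<delta>
        by (simp add: emeasure_eq_measure \<phi>_def ennreal_mult[symmetric] del: times_divide_eq_left)
    qed
  qed auto
  then have "(\<lambda>n. \<delta> / 2 * prob {\<omega>\<in>space M. \<bar>X n \<omega>\<bar> > \<epsilon>}) \<longlonglongrightarrow> 0"
    using \<delta> by (subst (asm) ennreal_tendsto_0_iff) auto
  then have "(\<lambda>n. 2 / \<delta> * (\<delta> / 2 * prob {\<omega>\<in>space M. \<bar>X n \<omega>\<bar> > \<epsilon>})) \<longlonglongrightarrow> 2 / \<delta> * 0"
    by (intro tendsto_intros)
  moreover have "2 / \<delta> * (\<delta> / 2 * p) = p" for p using \<delta>(1) by simp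
  ultimately show "(\<lambda>n. prob {\<omega>\<in>space M. \<bar>X n \<omega> - 0\<bar> > \<epsilon>}) \<longlonglongrightarrow> 0"
    by (simp only: diff_0_right mult_zero_right)
qed

section \<open>Simple integrals of sequences that vanish almost everywhere\<close>

context symmetric_noise
begin

lemma integral_simple_cells:
  fixes g :: "'b \<Rightarrow> real"
  assumes V: "simple_function vol V"
  shows "(LINT y|vol. g (V y)) = (\<Sum>v\<in>V ` D. g v * measure vol (cell V v))"
proof -
  have fin: "finite (V ` D)" using V by (rule simple_finite)
  have "(LINT y|vol. g (V y)) = (LINT y|vol. (\<Sum>v\<in>V ` D. g v * indicator (cell V v) y))"
  proof (rule Bochner_Integration.integral_cong)
    fix y assume y: "y \<in> space vol"
    have "(\<Sum>v\<in>V ` D. g v * indicator (cell V v) y) = (\<Sum>v\<in>V ` D. if v = V y then g v else 0)"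
      using y by (intro sum.cong refl) (auto simp: indicator_def)
    then show "g (V y) = (\<Sum>v\<in>V ` D. g v * indicator (cell V v) y)"
      using y fin by simp
  qed simp
  also have "\<dots> = (\<Sum>v\<in>V ` D. g v * measure vol (cell V v))"
  proof (subst Bochner_Integration.integral_sum)
    fix v
    have "integrable vol (indicator (cell V v) :: _ \<Rightarrow> real)"
      using cell_in_vol[OF V D_in_vol] by (intro integrable_real_indicator) (auto simp: vol.emeasure_eq_measure)
    then show "integrable vol (\<lambda>y. g v * indicator (cell V v) y)" by simp
  next
    have "{y\<in>D. V y = v} \<inter> D = {y\<in>D. V y = v}" for v by auto
    then show "(\<Sum>v\<in>V ` D. LINT y|vol. g v * indicator (cell V v) y)
        = (\<Sum>v\<in>V ` D. g v * measure vol (cell V v))"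
      by (simp add: Int_commute)
  qed
  finally show ?thesis .
qed

lemma integrable_simple: "simple_function vol f \<Longrightarrow> integrable vol (f :: _ \<Rightarrow> real)"
  by (intro vol.integrable_const_bound[where B = "Max (abs ` f ` D)"])
     (auto simp: simple_finite intro!: Max_ge AE_I2 borel_measurable_simple_function)

text \<open>Centring by the drift of the whole integrand leaves a weighted sum of independent
  centred increments, whose exponents add up to an integral of \<psi> over \<open>D\<close>.\<close>

lemma char_centered_simple:
  assumes f: "simple_function vol f"
  shows "char (distr M borel (\<lambda>\<omega>. SI f D \<omega> - b * (LINT y|vol. f y))) u
    = complex_of_real (exp (- (LINT y|vol. \<psi> (u * f y))))"
proof -
  obtain N :: nat and e where e: "bij_betw e {..<N} (f ` D)"
    and cells: "\<And>n. cell f (e n) \<in> sets vol" "disjoint_family_on (\<lambda>n. cell f (e n)) {..<N}"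
    using ex_cell_enumeration[OF f] by blast
  have r: "(\<Sum>n<N. h (e n)) = (\<Sum>v\<in>f ` D. h v)" for h :: "real \<Rightarrow> real"
    by (rule sum.reindex_bij_betw[OF e])
  have "SI f D \<omega> - b * (LINT y|vol. f y) = (\<Sum>n<N. e n * \<eta> (cell f (e n)) \<omega>)" for \<omega>
  proof -
    have "(LINT y|vol. f y) = (\<Sum>v\<in>f ` D. v * measure vol (cell f v))"
      using integral_simple_cells[OF f, of "\<lambda>v. v"] .
    then have "SI f D \<omega> - b * (LINT y|vol. f y)
        = (\<Sum>v\<in>f ` D. v * \<eta> (cell f v) \<omega>)"
      using cell_in_vol[OF f D_in_vol]
      by (simp add: simple_stoch_integral_def \<eta>_def measure_vol sum_distrib_left right_diff_distrib sum_subtractf mult_ac)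
    then show ?thesis using r[of "\<lambda>v. v * \<eta> (cell f v) \<omega>"] by simp
  qed
  then have "char (distr M borel (\<lambda>\<omega>. SI f D \<omega> - b * (LINT y|vol. f y))) u
      = char (distr M borel (\<lambda>\<omega>. \<Sum>n<N. e n * \<eta> (cell f (e n)) \<omega>)) u" by simp
  also have "\<dots> = complex_of_real (exp (- (\<Sum>n<N. measure vol (cell f (e n)) * \<psi> (u * e n))))"
    using cells by (intro char_sum_eta) auto
  also have "(\<Sum>n<N. measure vol (cell f (e n)) * \<psi> (u * e n)) = (LINT y|vol. \<psi> (u * f y))"
    unfolding integral_simple_cells[OF f, of "\<lambda>v. \<psi> (u * v)"]
    using r[of "\<lambda>v. \<psi> (u * v) * measure vol (cell f v)"] by (simp add: mult.commute)
  finally show ?thesis .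
qed

text \<open>Smallness in probability of a simple integral bounds the real part of its characteristic
  function from below, whereas the modulus does not see the drift.\<close>

lemma exp_psi_ge:
  assumes f: "simple_function vol f"
  shows "1 - 2 * max 1 \<bar>u\<bar> * enn2real (prob_size (SI f D)) \<le> exp (- (LINT y|vol. \<psi> (u * f y)))"
proof -
  let ?X = "SI f D"
  have X[measurable]: "?X \<in> borel_measurable M" by (rule simple_stoch_integral_measurable[OF f D_in_vol])
  let ?r = "b * (LINT y|vol. f y)"
  have "char (distr M borel ?X) u = (CLINT \<omega>|M. iexp (u * ?X \<omega>))"
    by (simp add: char_def integral_distr)
  also have "\<dots> = (CLINT \<omega>|M. iexp (u * ?r) * iexp (u * (?X \<omega> - ?r)))"
    by (simp add: exp_add[symmetric] algebra_simps)
  also have "\<dots> = iexp (u * ?r) * (CLINT \<omega>|M. iexp (u * (?X \<omega> - ?r)))"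
    by (rule integral_mult_right_zero)
  also have "(CLINT \<omega>|M. iexp (u * (?X \<omega> - ?r))) = char (distr M borel (\<lambda>\<omega>. ?X \<omega> - ?r)) u"
    by (simp add: char_def integral_distr)
  finally have "cmod (char (distr M borel ?X) u) = exp (- (LINT y|vol. \<psi> (u * f y)))"
    unfolding char_centered_simple[OF f] by (simp add: norm_mult del: of_real_exp)
  then have "Re (char (distr M borel ?X) u) \<le> exp (- (LINT y|vol. \<psi> (u * f y)))"
    using complex_Re_le_cmod by metis
  then have 1: "1 - expectation (\<lambda>\<omega>. 1 - cos (u * ?X \<omega>)) \<le> exp (- (LINT y|vol. \<psi> (u * f y)))"
    by (simp add: cos_eq_Re_char[OF X])
  have int: "integrable M (\<lambda>\<omega>. min 1 \<bar>?X \<omega>\<bar>)"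
    by (rule integrable_const_bound[where B = 1]) auto
  have "1 - cos (u * x) \<le> 2 * max 1 \<bar>u\<bar> * min 1 \<bar>x\<bar>" for x
  proof (cases "\<bar>u * x\<bar> \<le> 1")
    case True
    have m: "\<bar>u * x\<bar> \<le> max 1 \<bar>u\<bar> * \<bar>x\<bar>" unfolding abs_mult by (intro mult_right_mono) auto
    have "1 - cos (u * x) \<le> \<bar>u * x\<bar>\<^sup>2 / 2" using one_minus_cos_le_square[of "u * x"] by simp
    also have "\<dots> \<le> \<bar>u * x\<bar> / 2"
      using mult_left_mono[OF True, of "\<bar>u * x\<bar>"] by (simp add: power2_eq_square)
    finally have "1 - cos (u * x) \<le> \<bar>u * x\<bar>" by simp
    moreover have "\<bar>u * x\<bar> \<le> max 1 \<bar>u\<bar> * 1" using True by simp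
    ultimately show ?thesis using m by (cases "1 \<le> \<bar>x\<bar>"; simp add: min_def; linarith)
  next
    case False
    have "1 - cos (u * x) \<le> 2" using cos_ge_minus_one[of "u * x"] by linarith
    moreover have "1 \<le> max 1 \<bar>u\<bar> * min 1 \<bar>x\<bar>"
    proof (cases "\<bar>x\<bar> \<le> 1")
      case True
      then show ?thesis using False mult_right_mono[of "\<bar>u\<bar>" "max 1 \<bar>u\<bar>" "\<bar>x\<bar>"] by (simp add: abs_mult)
    qed auto
    ultimately show ?thesis unfolding mult.assoc by linarith
  qed
  then have "expectation (\<lambda>\<omega>. 1 - cos (u * ?X \<omega>)) \<le> expectation (\<lambda>\<omega>. 2 * max 1 \<bar>u\<bar> * min 1 \<bar>?X \<omega>\<bar>)"
    using int by (intro integral_mono integrable_one_minus_cos X) auto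
  also have "\<dots> = 2 * max 1 \<bar>u\<bar> * expectation (\<lambda>\<omega>. min 1 \<bar>?X \<omega>\<bar>)" by simp
  also have "expectation (\<lambda>\<omega>. min 1 \<bar>?X \<omega>\<bar>) = enn2real (prob_size ?X)"
    unfolding prob_size_def by (rule integral_eq_nn_integral) auto
  finally show ?thesis using 1 by linarith
qed

text \<open>Convergence in probability makes the integrals Cauchy, which bounds the integral of
  \<psi> at \<open>u * (H n y - H k y)\<close> uniformly in large \<open>n\<close> and
  \<open>k\<close>. As \<open>k\<close> tends to infinity, \<open>H k\<close> vanishes almost
  everywhere and Fatou's lemma bounds the integral of \<psi> at \<open>u * H n y\<close>. The limit
  \<open>Z\<close> remains unidentified at this stage.\<close>

lemma centered_null_sequence:
  assumes H: "\<And>n. simple_function vol (H n)" and null: "AE y in vol. (\<lambda>n. H n y) \<longlonglongrightarrow> 0"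
    and conv: "tendsto_in_prob M (\<lambda>n. SI (H n) D) Z"
  shows "tendsto_in_prob M (\<lambda>n \<omega>. SI (H n) D \<omega> - b * (LINT y|vol. H n y)) (\<lambda>_. 0)"
proof (rule in_prob_0_of_cos)
  let ?X = "\<lambda>n. SI (H n) D"
  have X[measurable]: "?X n \<in> borel_measurable M" for n by (rule simple_stoch_integral_measurable[OF H D_in_vol])
  have Z[measurable]: "Z \<in> borel_measurable M" using conv by (simp add: tendsto_in_prob_def)
  have Hm[measurable]: "H n \<in> borel_measurable vol" for n using H by (rule borel_measurable_simple_function)
  have pm[measurable]: "\<psi> \<in> borel_measurable borel" using psi_cont by (rule borel_measurable_continuous_onI)
  show "(\<lambda>\<omega>. ?X n \<omega> - b * (LINT y|vol. H n y)) \<in> borel_measurable M" for n by measurable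
  fix u :: real
  define s where "s n = enn2real (prob_size (\<lambda>\<omega>. ?X n \<omega> - Z \<omega>))" for n
  have fin: "prob_size Y < \<top>" for Y using prob_size_le_1[of Y] by (simp add: order_le_less_trans)
  have s: "s \<longlonglongrightarrow> 0"
  proof -
    have "(\<lambda>n. prob_size (\<lambda>\<omega>. ?X n \<omega> - Z \<omega>)) \<longlonglongrightarrow> 0" using conv by (subst (asm) tendsto_in_prob_iff) auto
    then have "(\<lambda>n. enn2real (prob_size (\<lambda>\<omega>. ?X n \<omega> - Z \<omega>))) \<longlonglongrightarrow> enn2real 0"
      by (intro tendsto_enn2real) auto
    then show ?thesis by (simp add: s_def[abs_def])
  qed
  define m where "m = 2 * max 1 \<bar>u\<bar>"
  have m: "2 \<le> m" by (simp add: m_def)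
  have pair: "1 - m * (s n + s k) \<le> exp (- (LINT y|vol. \<psi> (u * (H n y - H k y))))" for n k
  proof -
    have "prob_size (SI (\<lambda>y. H n y - H k y) D) = prob_size (\<lambda>\<omega>. ?X n \<omega> - ?X k \<omega>)"
      by (intro prob_size_cong_AE simple_stoch_integral_diff H D_in_vol)
    also have "\<dots> \<le> prob_size (\<lambda>\<omega>. ?X n \<omega> - Z \<omega>) + prob_size (\<lambda>\<omega>. ?X k \<omega> - Z \<omega>)"
      using prob_size_triangle[OF X[of n] Z X[of k]] by (simp add: prob_size_minus[of Z])
    finally have "enn2real (prob_size (SI (\<lambda>y. H n y - H k y) D)) \<le> s n + s k"
      unfolding s_def using fin by (subst enn2real_plus[symmetric]) (auto intro!: enn2real_mono)
    then have "1 - m * (s n + s k) \<le> 1 - m * enn2real (prob_size (SI (\<lambda>y. H n y - H k y) D))"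
      using m by (intro diff_left_mono mult_left_mono) auto
    also have "\<dots> \<le> exp (- (LINT y|vol. \<psi> (u * (H n y - H k y))))"
      unfolding m_def using H by (intro exp_psi_ge simple_function_diff)
    finally show ?thesis .
  qed
  have int_psi: "integrable vol (\<lambda>y. \<psi> (u * f y))" if "simple_function vol f" for f
    using simple_function_compose1[OF that, of "\<lambda>x. \<psi> (u * x)"] by (rule integrable_simple)
  have lower: "1 - 2 * m * \<epsilon> \<le> exp (- (LINT y|vol. \<psi> (u * H n y)))"
    if \<epsilon>: "0 < \<epsilon>" "2 * m * \<epsilon> < 1" and N: "\<And>k. k \<ge> N \<Longrightarrow> s k \<le> \<epsilon>" and n: "n \<ge> N" for n N \<epsilon>
  proof -
    \<comment> \<open>The bound is passed from the exponentials to the exponents, since Fatou's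
      lemma acts on the integrals of \<psi>.\<close>
    define L where "L = - ln (1 - 2 * m * \<epsilon>)"
    have L: "0 \<le> L" using \<epsilon> m by (simp add: L_def)
    have bound: "(LINT y|vol. \<psi> (u * (H n y - H k y))) \<le> L" if k: "k \<ge> N" for k
    proof -
      have "1 - 2 * m * \<epsilon> \<le> 1 - m * (s n + s k)"
        using mult_left_mono[of "s n + s k" "\<epsilon> + \<epsilon>" m] N[OF n] N[OF k] m by simp
      also note pair
      finally have "ln (1 - 2 * m * \<epsilon>) \<le> ln (exp (- (LINT y|vol. \<psi> (u * (H n y - H k y)))))"
        using \<epsilon> by (subst ln_le_cancel_iff) auto
      then show ?thesis by (simp add: L_def)
    qed
    have "ennreal (LINT y|vol. \<psi> (u * H n y)) = (\<integral>\<^sup>+y. ennreal (\<psi> (u * H n y)) \<partial>vol)"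
      using H psi_nonneg by (intro nn_integral_eq_integral[symmetric] int_psi) auto
    also have "\<dots> = (\<integral>\<^sup>+y. liminf (\<lambda>k. ennreal (\<psi> (u * (H n y - H k y)))) \<partial>vol)"
    proof (rule nn_integral_cong_AE, use null in eventually_elim)
      case (elim y)
      have "(\<lambda>k. u * (H n y - H k y)) \<longlonglongrightarrow> u * (H n y - 0)" by (intro tendsto_intros elim)
      moreover have "isCont \<psi> (u * (H n y - 0))" using psi_cont by (simp add: continuous_on_eq_continuous_at)
      ultimately have "(\<lambda>k. \<psi> (u * (H n y - H k y))) \<longlonglongrightarrow> \<psi> (u * (H n y - 0))"
        by (rule isCont_tendsto_compose[rotated])
      then have "(\<lambda>k. ennreal (\<psi> (u * (H n y - H k y)))) \<longlonglongrightarrow> ennreal (\<psi> (u * H n y))"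
        by (intro tendsto_ennrealI) simp
      then show ?case using lim_imp_Liminf[OF sequentially_bot] by metis
    qed
    also have "\<dots> \<le> liminf (\<lambda>k. \<integral>\<^sup>+y. ennreal (\<psi> (u * (H n y - H k y))) \<partial>vol)"
      by (rule nn_integral_liminf) measurable
    also have "\<dots> \<le> ennreal L"
    proof (rule Liminf_le)
      show "\<forall>\<^sub>F k in sequentially. (\<integral>\<^sup>+y. ennreal (\<psi> (u * (H n y - H k y))) \<partial>vol) \<le> ennreal L"
        using eventually_ge_at_top[of N]
      proof eventually_elim
        case (elim k)
        have "(\<integral>\<^sup>+y. ennreal (\<psi> (u * (H n y - H k y))) \<partial>vol) = ennreal (LINT y|vol. \<psi> (u * (H n y - H k y)))"
          using H psi_nonneg by (intro nn_integral_eq_integral int_psi simple_function_diff) auto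
        then show ?case using bound[OF elim] by (simp add: ennreal_leI)
      qed
    qed simp
    finally have "(LINT y|vol. \<psi> (u * H n y)) \<le> L" using L by simp
    then have "exp (- L) \<le> exp (- (LINT y|vol. \<psi> (u * H n y)))" by simp
    then show ?thesis using \<epsilon> by (simp add: L_def)
  qed
  have eq: "expectation (\<lambda>\<omega>. 1 - cos (u * (?X n \<omega> - b * (LINT y|vol. H n y)))) = 1 - exp (- (LINT y|vol. \<psi> (u * H n y)))" for n
    by (subst cos_eq_Re_char) (auto simp: char_centered_simple[OF H] simp del: of_real_exp)
  show "(\<lambda>n. expectation (\<lambda>\<omega>. 1 - cos (u * (?X n \<omega> - b * (LINT y|vol. H n y))))) \<longlonglongrightarrow> 0"
    unfolding eq
  proof (rule LIMSEQ_I)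
    fix r :: real assume r: "0 < r"
    define \<epsilon> where "\<epsilon> = min r 1 / (4 * m)"
    have \<epsilon>: "0 < \<epsilon>" "2 * m * \<epsilon> < 1" "2 * m * \<epsilon> < r" using r m by (auto simp: \<epsilon>_def min_def)
    obtain N where N: "\<And>k. k \<ge> N \<Longrightarrow> s k \<le> \<epsilon>"
      using order_tendstoD(2)[OF s \<epsilon>(1)] by (auto simp: eventually_sequentially intro: less_imp_le)
    show "\<exists>N. \<forall>n\<ge>N. norm (1 - exp (- (LINT y|vol. \<psi> (u * H n y))) - 0) < r"
    proof (intro exI[of _ N] allI impI)
      fix n assume n: "N \<le> n"
      have "0 \<le> (LINT y|vol. \<psi> (u * H n y))" using psi_nonneg by (intro Bochner_Integration.integral_nonneg)
      then have "exp (- (LINT y|vol. \<psi> (u * H n y))) \<le> 1" by simp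
      then show "norm (1 - exp (- (LINT y|vol. \<psi> (u * H n y))) - 0) < r"
        using lower[OF \<epsilon>(1,2) N n] \<epsilon>(3) by simp
    qed
  qed
qed

text \<open>The centred integrals vanish in the limit, so whatever the integrals converge to is the
  limit of their drifts, a sequence of constants.\<close>

lemma drift_tendsto_in_prob:
  assumes H: "\<And>n. simple_function vol (H n)" and null: "AE y in vol. (\<lambda>n. H n y) \<longlonglongrightarrow> 0"
    and conv: "tendsto_in_prob M (\<lambda>n. SI (H n) D) Z"
  shows "tendsto_in_prob M (\<lambda>n _. b * (LINT y|vol. H n y)) Z"
  using tendsto_in_prob_diff[OF conv centered_null_sequence[OF H null conv]] by simp

text \<open>If two members of the sequence are each within \<open>e / 3\<close> of \<open>Z\<close>
  with probability above 1/2, both are so at some common point.\<close>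

lemma convergent_of_const_in_prob:
  assumes "tendsto_in_prob M (\<lambda>n _. r n) Z"
  shows "convergent r"
proof -
  have Z[measurable]: "Z \<in> borel_measurable M" using assms by (simp add: tendsto_in_prob_def)
  have "Cauchy r"
  proof (rule metric_CauchyI)
    fix e :: real assume e: "0 < e"
    have "0 < e / 3" using e by simp
    then have "(\<lambda>n. prob {\<omega>\<in>space M. \<bar>r n - Z \<omega>\<bar> > e / 3}) \<longlonglongrightarrow> 0"
      using assms unfolding tendsto_in_prob_def by blast
    then have "\<forall>\<^sub>F n in sequentially. prob {\<omega>\<in>space M. \<bar>r n - Z \<omega>\<bar> > e / 3} < 1 / 2"
      by (intro order_tendstoD) auto
    then obtain N where N: "\<And>n. n \<ge> N \<Longrightarrow> prob {\<omega>\<in>space M. \<bar>r n - Z \<omega>\<bar> > e / 3} < 1 / 2"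
      by (auto simp: eventually_sequentially)
    have "dist (r n) (r k) < e" if nk: "n \<ge> N" "k \<ge> N" for n k
    proof (rule ccontr)
      assume far: "\<not> dist (r n) (r k) < e"
      have "space M \<subseteq> {\<omega>\<in>space M. \<bar>r n - Z \<omega>\<bar> > e / 3} \<union> {\<omega>\<in>space M. \<bar>r k - Z \<omega>\<bar> > e / 3}"
      proof
        fix \<omega> assume "\<omega> \<in> space M"
        moreover have "\<bar>r n - Z \<omega>\<bar> > e / 3 \<or> \<bar>r k - Z \<omega>\<bar> > e / 3"
          using far e unfolding dist_real_def by linarith
        ultimately show "\<omega> \<in> {\<omega>\<in>space M. \<bar>r n - Z \<omega>\<bar> > e / 3} \<union> {\<omega>\<in>space M. \<bar>r k - Z \<omega>\<bar> > e / 3}" by auto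
      qed
      then have "prob (space M) \<le> prob ({\<omega>\<in>space M. \<bar>r n - Z \<omega>\<bar> > e / 3} \<union> {\<omega>\<in>space M. \<bar>r k - Z \<omega>\<bar> > e / 3})"
        by (intro finite_measure_mono) auto
      also have "\<dots> \<le> prob {\<omega>\<in>space M. \<bar>r n - Z \<omega>\<bar> > e / 3} + prob {\<omega>\<in>space M. \<bar>r k - Z \<omega>\<bar> > e / 3}"
        by (intro measure_Un_le) auto
      also have "\<dots> < 1" using N[OF nk(1)] N[OF nk(2)] by simp
      finally show False by (simp add: prob_space)
    qed
    then show "\<exists>N. \<forall>m\<ge>N. \<forall>n\<ge>N. dist (r m) (r n) < e" by blast
  qed
  then show ?thesis by (rule Cauchy_convergent)
qed

text \<open>For nonzero \<open>b\<close> the means of \<open>H n\<close> over every set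
  \<open>A\<close> converge, because the integrals do; this is the hypothesis of the gliding hump,
  and the point at which the definition's demand on all sets \<open>A\<close> matters. Convergence
  almost everywhere alone would not make the means vanish.\<close>

lemma null_sequence_limit:
  assumes H: "\<And>n. simple_function vol (H n)" and null: "AE y in vol. (\<lambda>n. H n y) \<longlonglongrightarrow> 0"
    and conv: "\<And>A. A \<in> sets vol \<Longrightarrow> \<exists>Z. tendsto_in_prob M (\<lambda>n. SI (H n) A) Z"
    and Z: "tendsto_in_prob M (\<lambda>n. SI (H n) D) Z"
  shows "AE \<omega> in M. Z \<omega> = 0"
proof -
  have "(\<lambda>n. b * (LINT y|vol. H n y)) \<longlonglongrightarrow> 0"
  proof (cases "b = 0")
    case False
    have "(\<lambda>n. LINT y|vol. H n y) \<longlonglongrightarrow> 0"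
    proof (rule vol.gliding_hump)
      show "integrable vol (H n)" for n using H by (rule integrable_simple)
      show "\<exists>K. \<forall>x\<in>space vol. \<bar>H n x\<bar> \<le> K" for n
        using simple_finite[OF H, of n] by (intro exI[of _ "Max (abs ` H n ` D)"]) (auto intro!: Max_ge)
      fix A assume A: "A \<in> sets vol"
      have HA: "simple_function vol (\<lambda>y. H n y * indicator A y)" for n
        using H A by (intro simple_function_mult simple_function_indicator) auto
      obtain Z' where Z': "tendsto_in_prob M (\<lambda>n. SI (H n) A) Z'" using conv[OF A] by blast
      have "tendsto_in_prob M (\<lambda>n. SI (\<lambda>y. H n y * indicator A y) D) Z'"
      proof (rule tendsto_in_prob_AE_cong[OF Z'])
        show "Z' \<in> borel_measurable M" using Z' by (simp add: tendsto_in_prob_def)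
      qed (intro simple_stoch_integral_restrict H A simple_stoch_integral_measurable HA D_in_vol | simp)+
      then have "tendsto_in_prob M (\<lambda>n _. b * (LINT y|vol. H n y * indicator A y)) Z'"
        using null by (intro drift_tendsto_in_prob HA) (auto elim!: eventually_mono intro: tendsto_mult_left_zero)
      then have "convergent (\<lambda>n. b * (LINT y|vol. H n y * indicator A y))" by (rule convergent_of_const_in_prob)
      then show "convergent (\<lambda>n. LINT y|vol. H n y * indicator A y)"
        using False by (simp only: convergent_mult_const_iff simp_thms)
    qed (rule null)
    then show ?thesis by (rule tendsto_mult_right_zero)
  qed simp
  then have "tendsto_in_prob M (\<lambda>n _. b * (LINT y|vol. H n y)) (\<lambda>_. 0)" by (intro AE_tendsto_imp_in_prob) auto
  then show ?thesis
    using tendsto_in_prob_unique[OF drift_tendsto_in_prob[OF H null Z]] by auto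
qed

lemma AE_vol_iff: "(AE x in lborel. x \<in> D \<longrightarrow> P x) \<longleftrightarrow> (AE x in vol. P x)"
  using D_borel by (subst vol_def, subst AE_restrict_space_iff) auto

lemma has_stoch_integral_vol_iff:
  "has_stoch_integral M D \<xi> f Y \<longleftrightarrow> f \<in> borel_measurable vol \<and>
     (\<exists>F. (\<forall>n. simple_function vol (F n)) \<and> (AE x in vol. (\<lambda>n. F n x) \<longlonglongrightarrow> f x) \<and>
          (\<forall>A\<in>sets vol. \<exists>Z. tendsto_in_prob M (\<lambda>n. SI (F n) A) Z) \<and>
          tendsto_in_prob M (\<lambda>n. SI (F n) D) Y)"
  unfolding has_stoch_integral_def AE_vol_iff measurable_vol_iff simple_function_vol_iff sets_vol ..

lemma has_stoch_integral_unique: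
  assumes "has_stoch_integral M D \<xi> f Y" "has_stoch_integral M D \<xi> f Y'"
  shows "AE \<omega> in M. Y \<omega> = Y' \<omega>"
proof -
  obtain F where F: "\<And>n. simple_function vol (F n)" "AE x in vol. (\<lambda>n. F n x) \<longlonglongrightarrow> f x"
      "\<And>A. A \<in> sets vol \<Longrightarrow> \<exists>Z. tendsto_in_prob M (\<lambda>n. SI (F n) A) Z"
      "tendsto_in_prob M (\<lambda>n. SI (F n) D) Y"
    using assms(1) unfolding has_stoch_integral_vol_iff by blast
  obtain F' where F': "\<And>n. simple_function vol (F' n)" "AE x in vol. (\<lambda>n. F' n x) \<longlonglongrightarrow> f x"
      "\<And>A. A \<in> sets vol \<Longrightarrow> \<exists>Z. tendsto_in_prob M (\<lambda>n. SI (F' n) A) Z"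
      "tendsto_in_prob M (\<lambda>n. SI (F' n) D) Y'"
    using assms(2) unfolding has_stoch_integral_vol_iff by blast
  have diff: "tendsto_in_prob M (\<lambda>n. SI (\<lambda>y. F n y - F' n y) A) (\<lambda>\<omega>. Z \<omega> - Z' \<omega>)"
    if A: "A \<in> sets vol" and Z: "tendsto_in_prob M (\<lambda>n. SI (F n) A) Z"
      "tendsto_in_prob M (\<lambda>n. SI (F' n) A) Z'" for A Z Z'
  proof (rule tendsto_in_prob_AE_cong[OF tendsto_in_prob_diff[OF Z]])
    show "AE \<omega> in M. SI (F n) A \<omega> - SI (F' n) A \<omega>
        = SI (\<lambda>y. F n y - F' n y) A \<omega>" for n
      using simple_stoch_integral_diff[OF F(1) F'(1) A, of n n] by (auto elim!: eventually_mono)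
    show "SI (\<lambda>y. F n y - F' n y) A \<in> borel_measurable M" for n
      by (intro simple_stoch_integral_measurable simple_function_diff F F' A)
    show "(\<lambda>\<omega>. Z \<omega> - Z' \<omega>) \<in> borel_measurable M" using Z by (auto simp: tendsto_in_prob_def)
  qed simp
  have "AE \<omega> in M. Y \<omega> - Y' \<omega> = 0"
  proof (rule null_sequence_limit[OF _ _ _ diff[OF D_in_vol F(4) F'(4)]])
    show "simple_function vol (\<lambda>y. F n y - F' n y)" for n by (intro simple_function_diff F F')
    show "AE y in vol. (\<lambda>n. F n y - F' n y) \<longlonglongrightarrow> 0"
      using F(2) F'(2) by eventually_elim (auto intro: tendsto_eq_intros)
    show "\<exists>Z. tendsto_in_prob M (\<lambda>n. SI (\<lambda>y. F n y - F' n y) A) Z" if A: "A \<in> sets vol" for A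
      using diff[OF A] F(3)[OF A] F'(3)[OF A] by blast
  qed
  then show ?thesis by simp
qed

end

section \<open>Existence of the stochastic integral\<close>

definition grid_cell :: "nat \<Rightarrow> real^'d \<Rightarrow> int^'d" where
  "grid_cell m y = (\<chi> i. \<lfloor>real (Suc m) * y $ i\<rfloor>)"

text \<open>Indexing a countable family of step functions by \<open>k\<close> is what allows an approximation of \<open>G x\<close> to be
  selected measurably in \<open>x\<close>.\<close>

definition grid_step :: "nat \<Rightarrow> real^'d \<Rightarrow> real" where
  "grid_step k y = (case from_nat k :: nat \<times> ((int^'d) \<times> rat) list of
     (m, l) \<Rightarrow> (case map_of l (grid_cell m y) of None \<Rightarrow> 0 | Some r \<Rightarrow> of_rat r))"

lemma grid_cell_measurable [measurable]: "(grid_cell m :: real^'d \<Rightarrow> int^'d) \<in> measurable borel (count_space UNIV)"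
proof (subst measurable_count_space_eq2_countable)
  have "{y. grid_cell m y = a} \<in> sets borel" for a :: "int^'d"
  proof -
    have [measurable]: "(\<lambda>y::real^'d. y $ i) \<in> borel_measurable borel" for i
      by (intro borel_measurable_continuous_onI continuous_intros)
    have "{y. grid_cell m y = a} = {y\<in>space borel. \<forall>i. \<lfloor>real (Suc m) * y $ i\<rfloor> = a $ i}"
      by (auto simp: grid_cell_def vec_eq_iff)
    also have "\<dots> \<in> sets borel" by measurable
    finally show ?thesis .
  qed
  note cells = this
  show "grid_cell m \<in> space (borel :: (real^'d) measure) \<rightarrow> (UNIV :: (int^'d) set) \<and>
      (\<forall>a::int^'d\<in>UNIV. grid_cell m -` {a} \<inter> space borel \<in> sets borel)"
  proof (intro conjI ballI)
    fix a :: "int^'d"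
    have "grid_cell m -` {a} \<inter> space borel = {y. grid_cell m y = a}" by auto
    then show "grid_cell m -` {a} \<inter> space borel \<in> sets borel" using cells[of a] by (simp only:)
  qed simp
qed

lemma grid_step_measurable [measurable]: "(grid_step k :: real^'d \<Rightarrow> real) \<in> borel_measurable borel"
  unfolding grid_step_def[abs_def] by (cases "from_nat k :: nat \<times> ((int^'d) \<times> rat) list") simp

lemma grid_step_finite: "finite (range (grid_step k :: real^'d \<Rightarrow> real))"
proof (cases "from_nat k :: nat \<times> ((int^'d) \<times> rat) list")
  case (Pair m l)
  have "range (grid_step k :: real^'d \<Rightarrow> real) \<subseteq> insert 0 (of_rat ` snd ` set l)"
    using Pair by (auto simp: grid_step_def split: option.splits dest!: map_of_SomeD) force
  then show ?thesis by (rule finite_subset) simp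
qed

lemma ex_grid_step:
  fixes r :: "int^'d \<Rightarrow> rat"
  assumes "finite A"
  shows "\<exists>k. \<forall>y. grid_cell m y \<in> A \<longrightarrow> grid_step k y = of_rat (r (grid_cell m y))"
proof -
  obtain as where as: "set as = A" using finite_list[OF assms] by blast
  have "map_of (map (\<lambda>a. (a, r a)) as) x = Some (r x)" if "x \<in> A" for x
    using that as by (simp add: map_of_map_restrict)
  then show ?thesis
    by (intro exI[of _ "to_nat (m, map (\<lambda>a. (a, r a)) as)"]) (auto simp: grid_step_def)
qed

lemma grid_cell_finite:
  fixes D :: "(real^'d) set"
  assumes "bounded D"
  shows "finite (grid_cell m ` D)"
proof -
  obtain R where R: "\<And>y. y \<in> D \<Longrightarrow> norm y \<le> R" using assms bounded_iff by metis
  define N where "N = \<lceil>real (Suc m) * R\<rceil>"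
  have "grid_cell m y $ i \<in> {- N - 1..N}" if "y \<in> D" for y i
  proof -
    have "\<bar>y $ i\<bar> \<le> R" using component_le_norm_cart[of y i] R[OF that] by simp
    then have "real (Suc m) * \<bar>y $ i\<bar> \<le> real (Suc m) * R" by (intro mult_left_mono) auto
    then have "\<bar>real (Suc m) * y $ i\<bar> \<le> real (Suc m) * R" by (simp add: abs_mult)
    then have "\<bar>real (Suc m) * y $ i\<bar> \<le> of_int N" unfolding N_def using le_of_int_ceiling order_trans by blast
    then show ?thesis unfolding grid_cell_def by (simp add: le_floor_iff floor_le_iff abs_le_iff del: of_nat_Suc)
  qed
  then have "grid_cell m ` D \<subseteq> vec_lambda ` (UNIV \<rightarrow>\<^sub>E {- N - 1..N})"
    by (auto intro!: image_eqI[of _ vec_lambda "\<lambda>i. grid_cell m _ $ i"])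
  moreover have "finite (vec_lambda ` ((UNIV :: 'd set) \<rightarrow>\<^sub>E {- N - 1..N}))"
    by (intro finite_imageI finite_PiE) auto
  ultimately show ?thesis by (rule finite_subset)
qed

lemma grid_point_tendsto: "(\<lambda>m. (\<chi> i. of_int (grid_cell m y $ i) / real (Suc m)) :: real^'d) \<longlonglongrightarrow> y"
proof (rule vec_tendstoI)
  fix i
  have lim: "(\<lambda>m. y $ i - 1 / real (Suc m)) \<longlonglongrightarrow> y $ i"
    using tendsto_diff[OF tendsto_const LIMSEQ_inverse_real_of_nat, of "y $ i"] by (simp add: inverse_eq_divide)
  show "(\<lambda>m. (\<chi> i. of_int (grid_cell m y $ i) / real (Suc m)) $ i) \<longlonglongrightarrow> y $ i"
  proof (rule tendsto_sandwich[OF _ _ lim tendsto_const])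
    have "y $ i - 1 / real (Suc m) \<le> of_int \<lfloor>real (Suc m) * y $ i\<rfloor> / real (Suc m)" for m
    proof -
      have "real (Suc m) * y $ i - 1 \<le> of_int \<lfloor>real (Suc m) * y $ i\<rfloor>" by linarith
      then have "(real (Suc m) * y $ i - 1) / real (Suc m) \<le> of_int \<lfloor>real (Suc m) * y $ i\<rfloor> / real (Suc m)"
        by (intro divide_right_mono) auto
      then show ?thesis by (simp add: diff_divide_distrib)
    qed
    then show "\<forall>\<^sub>F m in sequentially. y $ i - 1 / real (Suc m) \<le> (\<chi> i. of_int (grid_cell m y $ i) / real (Suc m)) $ i"
      by (simp add: grid_cell_def)
    have "of_int \<lfloor>real (Suc m) * y $ i\<rfloor> / real (Suc m) \<le> y $ i" for m
    proof -
      have "of_int \<lfloor>real (Suc m) * y $ i\<rfloor> / real (Suc m) \<le> (real (Suc m) * y $ i) / real (Suc m)"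
        by (intro divide_right_mono of_int_floor_le) auto
      then show ?thesis by simp
    qed
    then show "\<forall>\<^sub>F m in sequentially. (\<chi> i. of_int (grid_cell m y $ i) / real (Suc m)) $ i \<le> y $ i"
      by (simp add: grid_cell_def)
  qed
qed

text \<open>The sum is at most twice the larger term, and \<open>2 powr q\<close> is at most
  4.\<close>

lemma abs_add_powr_le:
  fixes a b q :: real
  assumes "1 \<le> q" "q \<le> 2"
  shows "\<bar>a + b\<bar> powr q \<le> 4 * (\<bar>a\<bar> powr q + \<bar>b\<bar> powr q)"
proof -
  let ?m = "max \<bar>a\<bar> \<bar>b\<bar>"
  have "\<bar>a + b\<bar> powr q \<le> (2 * ?m) powr q" using assms by (intro powr_mono2) auto
  also have "\<dots> = 2 powr q * ?m powr q" by (simp add: powr_mult)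
  also have "\<dots> \<le> 4 * ?m powr q" using assms powr_mono[of q 2 2] by (intro mult_right_mono) auto
  also have "?m powr q \<le> \<bar>a\<bar> powr q + \<bar>b\<bar> powr q" by (simp add: max_def)
  finally show ?thesis by simp
qed

locale bounded_noise = noise_with_moments M D \<xi> b \<psi> q
  for M :: "'w measure" and D :: "(real^'d) set" and \<xi> b \<psi> q +
  assumes D_bounded: "bounded D"
begin

text \<open>This is the \<open>q\<close>-th power of the \<open>L^q\<close> norm over
  \<open>D\<close>, without the root. It obeys the triangle inequality up to a factor 4 only, which
  is the origin of the errors with denominator 8 below.\<close>

definition Nq :: "(real^'d \<Rightarrow> real) \<Rightarrow> ennreal" where
  "Nq f = (\<integral>\<^sup>+y. ennreal (\<bar>f y\<bar> powr q) \<partial>vol)"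

lemma Nq_mono: "(\<And>y. y \<in> D \<Longrightarrow> \<bar>f y\<bar> \<le> \<bar>g y\<bar>) \<Longrightarrow> Nq f \<le> Nq g"
  unfolding Nq_def using q by (intro nn_integral_mono ennreal_leI powr_mono2) auto

lemma Nq_minus: "Nq (\<lambda>y. f y - g y) = Nq (\<lambda>y. g y - f y)"
  unfolding Nq_def by (simp add: abs_minus_commute)

lemma Nq_add:
  assumes [measurable]: "f \<in> borel_measurable vol" "g \<in> borel_measurable vol"
  shows "Nq (\<lambda>y. f y + g y) \<le> 4 * (Nq f + Nq g)"
proof -
  have "Nq (\<lambda>y. f y + g y) \<le> (\<integral>\<^sup>+y. 4 * (ennreal (\<bar>f y\<bar> powr q) + ennreal (\<bar>g y\<bar> powr q)) \<partial>vol)"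
    unfolding Nq_def
  proof (rule nn_integral_mono)
    fix y
    have "ennreal (\<bar>f y + g y\<bar> powr q) \<le> ennreal (4 * (\<bar>f y\<bar> powr q + \<bar>g y\<bar> powr q))"
      by (intro ennreal_leI abs_add_powr_le q)
    then show "ennreal (\<bar>f y + g y\<bar> powr q) \<le> 4 * (ennreal (\<bar>f y\<bar> powr q) + ennreal (\<bar>g y\<bar> powr q))"
      by (simp add: ennreal_mult)
  qed
  also have "\<dots> = 4 * (Nq f + Nq g)"
    unfolding Nq_def by (subst nn_integral_cmult) (auto simp: nn_integral_add)
  finally show ?thesis .
qed

lemma Nq_triangle:
  assumes "f \<in> borel_measurable vol" "g \<in> borel_measurable vol" "h \<in> borel_measurable vol"
  shows "Nq (\<lambda>y. f y - h y) \<le> 4 * (Nq (\<lambda>y. f y - g y) + Nq (\<lambda>y. g y - h y))"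
  using Nq_add[of "\<lambda>y. f y - g y" "\<lambda>y. g y - h y"] assms by simp

lemma Nq_bounded_finite:
  assumes "\<And>y. y \<in> D \<Longrightarrow> \<bar>f y\<bar> \<le> K"
  shows "Nq f < \<infinity>"
proof -
  have "Nq f \<le> Nq (\<lambda>_. K)" 
  proof (rule Nq_mono)
    show "\<bar>f y\<bar> \<le> \<bar>K\<bar>" if "y \<in> D" for y using assms[OF that] by linarith
  qed
  also have "\<dots> < \<infinity>" by (simp add: Nq_def vol.emeasure_eq_measure ennreal_mult_less_top)
  finally show ?thesis .
qed

lemma Nq_dominated:
  assumes [measurable]: "\<And>n. F n \<in> borel_measurable vol" "f \<in> borel_measurable vol" "w \<in> borel_measurable vol"
    and lim: "AE y in vol. (\<lambda>n. F n y) \<longlonglongrightarrow> f y"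
    and dom: "\<And>n y. y \<in> D \<Longrightarrow> \<bar>f y - F n y\<bar> \<le> w y" and fin: "Nq w < \<infinity>"
  shows "(\<lambda>n. Nq (\<lambda>y. f y - F n y)) \<longlonglongrightarrow> 0"
proof -
  have "(\<lambda>n. Nq (\<lambda>y. f y - F n y)) \<longlonglongrightarrow> (\<integral>\<^sup>+y. 0 \<partial>vol)"
    unfolding Nq_def
  proof (rule nn_integral_dominated_convergence[where w = "\<lambda>y. ennreal (\<bar>w y\<bar> powr q)"])
    show "AE y in vol. ennreal (\<bar>f y - F n y\<bar> powr q) \<le> ennreal (\<bar>w y\<bar> powr q)" for n
    proof (rule AE_I2)
      fix y assume "y \<in> space vol"
      then have "\<bar>f y - F n y\<bar> \<le> \<bar>w y\<bar>" using dom[of y n] by simp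
      then show "ennreal (\<bar>f y - F n y\<bar> powr q) \<le> ennreal (\<bar>w y\<bar> powr q)"
        using q by (intro ennreal_leI powr_mono2) auto
    qed
    show "AE y in vol. (\<lambda>n. ennreal (\<bar>f y - F n y\<bar> powr q)) \<longlonglongrightarrow> 0"
      using lim
    proof eventually_elim
      case (elim y)
      have "(\<lambda>n. \<bar>f y - F n y\<bar> powr q) \<longlonglongrightarrow> \<bar>f y - f y\<bar> powr q"
        using q by (intro tendsto_powr' tendsto_intros elim) auto
      then show ?case using q by (auto simp: ennreal_0[symmetric] simp del: ennreal_0 intro!: tendsto_ennrealI)
    qed
  qed (use fin in \<open>auto simp: Nq_def\<close>)
  then show ?thesis by simp
qed

lemma borel_measurable_vol: "f \<in> borel_measurable borel \<Longrightarrow> f \<in> borel_measurable vol"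
  unfolding measurable_vol_iff by (rule measurable_restrict_space1)

lemma grid_step_simple: "simple_function vol (grid_step k)"
  using borel_measurable_vol[OF grid_step_measurable]
  by (subst simple_function_iff_borel_measurable) (auto intro: finite_subset[OF _ grid_step_finite[of k]])

lemma grid_step_vol [measurable]: "grid_step k \<in> borel_measurable vol"
  by (rule borel_measurable_vol) simp

definition approximable :: "(real^'d \<Rightarrow> real) \<Rightarrow> bool" where
  "approximable f \<longleftrightarrow> (\<forall>\<epsilon>>0. \<exists>k. Nq (\<lambda>y. f y - grid_step k y) < \<epsilon>)"

lemma approximable_limit:
  assumes [measurable]: "\<And>n. F n \<in> borel_measurable vol" "f \<in> borel_measurable vol"
    and app: "\<And>n. approximable (F n)" and lim: "(\<lambda>n. Nq (\<lambda>y. f y - F n y)) \<longlonglongrightarrow> 0"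
  shows "approximable f"
  unfolding approximable_def
proof (intro allI impI)
  fix \<epsilon> :: ennreal assume \<epsilon>: "0 < \<epsilon>"
  then have \<epsilon>8: "0 < \<epsilon> / 8" by (simp add: ennreal_zero_less_divide)
  obtain n where n: "Nq (\<lambda>y. f y - F n y) < \<epsilon> / 8"
    using order_tendstoD(2)[OF lim \<epsilon>8] by (auto simp: eventually_sequentially)
  obtain k where k: "Nq (\<lambda>y. F n y - grid_step k y) < \<epsilon> / 8"
    using app[of n] \<epsilon>8 unfolding approximable_def by blast
  have "Nq (\<lambda>y. f y - grid_step k y) \<le> 4 * (Nq (\<lambda>y. f y - F n y) + Nq (\<lambda>y. F n y - grid_step k y))"
    by (rule Nq_triangle) auto
  also have "\<dots> < 4 * (\<epsilon> / 8 + \<epsilon> / 8)"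
    using n k by (intro ennreal_mult_strict_left_mono add_strict_mono) auto
  also have "4 * (\<epsilon> / 8 + \<epsilon> / 8) = \<epsilon>"
  proof -
    have "4 * (\<epsilon> / 8 + \<epsilon> / 8) = 4 * (\<epsilon> + \<epsilon>) / 8"
      by (simp only: add_divide_distrib_ennreal[symmetric] ennreal_times_divide)
    also have "4 * (\<epsilon> + \<epsilon>) = (4 * 2) * \<epsilon>" by (simp only: mult_2[symmetric] mult.assoc)
    also have "(4 * 2) * \<epsilon> = \<epsilon> * 8" by (simp add: mult.commute)
    also have "\<epsilon> * 8 / 8 = \<epsilon>" by (rule mult_divide_eq_ennreal) auto
    finally show ?thesis .
  qed
  finally show "\<exists>k. Nq (\<lambda>y. f y - grid_step k y) < \<epsilon>" by blast
qed

text \<open>On a grid cell the step takes a rational value close to the value of \<open>g\<close> at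
  the lower corner \<open>pt m\<close> of the cell. Corners converge to the point as the grid is
  refined, and boundedness of \<open>g\<close> supplies domination.\<close>

lemma approximable_continuous:
  assumes g: "continuous_on UNIV g" and L: "\<And>y. \<bar>g y\<bar> \<le> L"
  shows "approximable g"
proof -
  have gm[measurable]: "g \<in> borel_measurable vol"
    by (intro borel_measurable_vol borel_measurable_continuous_onI g)
  define pt where "pt m a = (\<chi> i. of_int (a $ i) / real (Suc m))" for m and a :: "int^'d"
  have "\<exists>r::rat. \<bar>of_rat r - g (pt m a)\<bar> < 1 / real (Suc m)" for m a
  proof -
    obtain x where "x \<in> \<rat>" "g (pt m a) - 1 / real (Suc m) < x" "x < g (pt m a) + 1 / real (Suc m)"
      using Rats_dense_in_real[of "g (pt m a) - 1 / real (Suc m)" "g (pt m a) + 1 / real (Suc m)"] by auto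
    moreover then obtain r where "x = of_rat r" by (auto elim: Rats_cases)
    ultimately show ?thesis by (intro exI[of _ r]) (simp only: abs_less_iff, linarith)
  qed
  then obtain r :: "nat \<Rightarrow> int^'d \<Rightarrow> rat" where r: "\<And>m a. \<bar>of_rat (r m a) - g (pt m a)\<bar> < 1 / real (Suc m)"
    by metis
  have "\<exists>k. \<forall>y. grid_cell m y \<in> grid_cell m ` D \<longrightarrow> grid_step k y = of_rat (r m (grid_cell m y))" for m
    by (rule ex_grid_step) (rule grid_cell_finite[OF D_bounded])
  then obtain k where k: "\<And>m y. y \<in> D \<Longrightarrow> grid_step (k m) y = of_rat (r m (grid_cell m y))" by (metis image_eqI)
  have close: "\<bar>grid_step (k m) y - g (pt m (grid_cell m y))\<bar> < 1 / real (Suc m)" if "y \<in> D" for m y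
    using r k[OF that] by simp
  have "(\<lambda>m. Nq (\<lambda>y. g y - grid_step (k m) y)) \<longlonglongrightarrow> 0"
  proof (rule Nq_dominated[where w = "\<lambda>_. 2 * L + 1"])
    show "AE y in vol. (\<lambda>m. grid_step (k m) y) \<longlonglongrightarrow> g y"
    proof (rule AE_I2)
      fix y assume y: "y \<in> space vol"
      have 1: "(\<lambda>m. g (pt m (grid_cell m y))) \<longlonglongrightarrow> g y"
        using g grid_point_tendsto[of y] unfolding pt_def
        by (intro isCont_tendsto_compose[of y g]) (auto simp: continuous_on_eq_continuous_at)
      have "(\<lambda>m. grid_step (k m) y - g (pt m (grid_cell m y))) \<longlonglongrightarrow> 0"
        using close y by (intro LIMSEQ_norm_0) (auto simp del: of_nat_Suc)
      from tendsto_add[OF this 1] show "(\<lambda>m. grid_step (k m) y) \<longlonglongrightarrow> g y" by simp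
    qed
    fix m y assume y: "y \<in> D"
    have "1 / real (Suc m) \<le> 1" by simp
    then show "\<bar>g y - grid_step (k m) y\<bar> \<le> 2 * L + 1"
      using close[OF y, of m] L[of y] L[of "pt m (grid_cell m y)"] by linarith
  next
    show "Nq (\<lambda>_. 2 * L + 1) < \<infinity>" by (rule Nq_bounded_finite) (rule order_refl)
  qed auto
  note lim = this
  show ?thesis
    unfolding approximable_def
  proof (intro allI impI)
    fix \<epsilon> :: ennreal assume "0 < \<epsilon>"
    then have "\<forall>\<^sub>F m in sequentially. Nq (\<lambda>y. g y - grid_step (k m) y) < \<epsilon>"
      by (rule order_tendstoD(2)[OF lim])
    then obtain m where "Nq (\<lambda>y. g y - grid_step (k m) y) < \<epsilon>"
      unfolding eventually_sequentially by (meson order_refl)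
    then show "\<exists>k. Nq (\<lambda>y. g y - grid_step k y) < \<epsilon>" by (rule exI[of _ "k m"])
  qed
qed

text \<open>Measurable functions are limits almost everywhere of continuous ones, but without
  control of their size. Clipping at level \<open>L\<close> supplies a dominating constant; the
  clipping is then removed under domination by \<open>\<bar>f y\<bar>\<close> itself.\<close>

lemma approximable_Nq_finite:
  assumes f[measurable]: "f \<in> borel_measurable vol" and fin: "Nq f < \<infinity>"
  shows "approximable f"
proof -
  define clip :: "nat \<Rightarrow> real \<Rightarrow> real" where "clip L x = max (- real L) (min (real L) x)" for L x
  have clip_cont: "continuous_on UNIV (clip L)" for L
    unfolding clip_def by (intro continuous_intros)
  have clip_meas[measurable]: "clip L \<in> borel_measurable borel" for L
    by (intro borel_measurable_continuous_onI clip_cont)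
  have clip_bd: "\<bar>clip L x\<bar> \<le> real L" for L x by (auto simp: clip_def)
  have "approximable (\<lambda>y. clip L (f y))" for L
  proof -
    \<comment> \<open>Extension by zero to the whole space, where approximation by continuous
      functions is available.\<close>
    define f0 where "f0 y = (if y \<in> D then f y else 0)" for y
    have "f0 \<in> borel_measurable borel"
    proof -
      have "(\<lambda>y. indicator D y *\<^sub>R f y) \<in> borel_measurable borel"
        using f D_borel unfolding measurable_vol_iff by (subst (asm) borel_measurable_restrict_space_iff) auto
      moreover have "(\<lambda>y. indicator D y *\<^sub>R f y) = f0" by (auto simp: f0_def fun_eq_iff)
      ultimately show ?thesis by simp
    qed
    then have "f0 \<in> borel_measurable lborel" by (simp only: measurable_lborel2)
    then have "f0 \<in> borel_measurable lebesgue" by (rule measurable_completion)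
    then have "f0 measurable_on UNIV" by (rule lebesgue_measurable_imp_measurable_on) simp
    then obtain N g where N: "negligible N" and g: "\<And>n. continuous_on UNIV (g n)"
      and lim: "\<And>y. y \<notin> N \<Longrightarrow> (\<lambda>n. g n y) \<longlonglongrightarrow> f0 y"
      unfolding measurable_on_def by auto
    have gm[measurable]: "g n \<in> borel_measurable vol" for n by (intro borel_measurable_vol borel_measurable_continuous_onI g)
    show ?thesis
    proof (rule approximable_limit)
      show "approximable (\<lambda>y. clip L (g n y))" for n
        by (rule approximable_continuous[OF continuous_on_compose2[OF clip_cont g] clip_bd]) simp
      show "(\<lambda>n. Nq (\<lambda>y. clip L (f y) - clip L (g n y))) \<longlonglongrightarrow> 0"
      proof (rule Nq_dominated[where w = "\<lambda>_. 2 * real L"])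
        have "AE y in lebesgue. y \<notin> N" using N unfolding negligible_iff_null_sets by (rule AE_not_in)
        then have "AE y in lborel. y \<notin> N" by (simp add: AE_completion_iff)
        then have "AE y in lborel. y \<in> D \<longrightarrow> (\<lambda>n. clip L (g n y)) \<longlonglongrightarrow> clip L (f y)"
        proof eventually_elim
          case (elim y)
          have "isCont (clip L) (f0 y)" using clip_cont by (simp add: continuous_on_eq_continuous_at)
          from isCont_tendsto_compose[OF this lim[OF elim]] show ?case by (auto simp: f0_def)
        qed
        then show "AE y in vol. (\<lambda>n. clip L (g n y)) \<longlonglongrightarrow> clip L (f y)" by (simp add: AE_vol_iff)
        show "\<bar>clip L (f y) - clip L (g n y)\<bar> \<le> 2 * real L" for n y
          using clip_bd[of L "f y"] clip_bd[of L "g n y"] by linarith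
        show "Nq (\<lambda>_. 2 * real L) < \<infinity>" by (rule Nq_bounded_finite) (rule order_refl)
      qed auto
    qed auto
  qed
  note app = this
  show ?thesis
  proof (rule approximable_limit)
    show "approximable (\<lambda>y. clip n (f y))" for n by (rule app)
    show "(\<lambda>n. Nq (\<lambda>y. f y - clip n (f y))) \<longlonglongrightarrow> 0"
    proof (rule Nq_dominated[where w = "\<lambda>y. \<bar>f y\<bar>"])
      show "AE y in vol. (\<lambda>n. clip n (f y)) \<longlonglongrightarrow> f y"
      proof (rule AE_I2)
        fix y
        have "\<forall>\<^sub>F n in sequentially. f y = clip n (f y)"
          using eventually_ge_at_top[of "nat \<lceil>\<bar>f y\<bar>\<rceil>"]
        proof eventually_elim
          case (elim n)
          then have "\<bar>f y\<bar> \<le> real n" by linarith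
          then show ?case by (auto simp: clip_def)
        qed
        then show "(\<lambda>n. clip n (f y)) \<longlonglongrightarrow> f y" using Lim_transform_eventually[OF tendsto_const] by fast
      qed
      show "\<bar>f y - clip n (f y)\<bar> \<le> \<bar>f y\<bar>" for n y by (auto simp: clip_def)
      show "Nq (\<lambda>y. \<bar>f y\<bar>) < \<infinity>" using fin by (simp add: Nq_def)
    qed auto
  qed auto
qed

text \<open>A threshold for \<open>Nq\<close> at level \<open>(1/2) ^ n\<close> exists because the
  constant in the bound for simple integrals depends on the accepted error only. Monotonicity comes
  from running minima and is used when consecutive approximations are compared.\<close>

lemma ex_rates:
  obtains \<rho> :: "nat \<Rightarrow> real" where "\<And>n. 0 < \<rho> n" "\<And>n. \<rho> (Suc n) \<le> \<rho> n" "\<And>n. \<rho> n \<le> (1/2) ^ n"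
    "\<And>n f A. simple_function vol f \<Longrightarrow> A \<in> sets vol \<Longrightarrow> Nq f \<le> ennreal (\<rho> n) \<Longrightarrow>
      prob_size (SI f A) \<le> ennreal ((1/2) ^ n)"
proof -
  have "\<exists>r>0. \<forall>f A. simple_function vol f \<longrightarrow> A \<in> sets vol \<longrightarrow> Nq f \<le> ennreal r \<longrightarrow>
      prob_size (SI f A) \<le> ennreal ((1/2) ^ n)" for n
  proof -
    have e: "0 < (1/2::real) ^ n / 2" by simp
    obtain K where K: "0 \<le> K" and bd: "\<And>f A. simple_function vol f \<Longrightarrow> A \<in> sets vol \<Longrightarrow>
      prob_size (SI f A) \<le> ennreal ((1/2) ^ n / 2) + ennreal K * Nq f"
      unfolding Nq_def by (rule simple_integral_bound[OF e]) (rule that[unfolded Nq_def])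
    define r where "r = (1/2::real) ^ n / 2 / (K + 1)"
    have r: "0 < r" using K by (simp add: r_def)
    have Kr: "K * r \<le> (1/2) ^ n / 2"
    proof -
      have "K * r \<le> (K + 1) * r" using r by simp
      also have "(K + 1) * r = (1/2) ^ n / 2"
      proof -
        have "(K + 1) * (x / (K + 1)) = x" for x using K by simp
        then show ?thesis unfolding r_def .
      qed
      finally show ?thesis .
    qed
    have "prob_size (SI f A) \<le> ennreal ((1/2) ^ n)"
      if "simple_function vol f" "A \<in> sets vol" "Nq f \<le> ennreal r" for f A
    proof -
      have "prob_size (SI f A) \<le> ennreal ((1/2) ^ n / 2) + ennreal K * ennreal r"
        by (rule order_trans[OF bd]) (use that in \<open>auto intro!: add_left_mono mult_left_mono\<close>)
      also have "\<dots> = ennreal ((1/2) ^ n / 2 + K * r)" using K r by (simp add: ennreal_mult)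
      also have "\<dots> \<le> ennreal ((1/2) ^ n)" using Kr by (intro ennreal_leI) simp
      finally show ?thesis .
    qed
    with r show ?thesis by blast
  qed
  then obtain r where r: "\<And>n. 0 < r n" "\<And>n f A. simple_function vol f \<Longrightarrow> A \<in> sets vol \<Longrightarrow> Nq f \<le> ennreal (r n) \<Longrightarrow>
      prob_size (SI f A) \<le> ennreal ((1/2) ^ n)"
    by metis
  define \<rho> where "\<rho> n = min ((1/2) ^ n) (Min (r ` {..n}))" for n
  show thesis
  proof (rule that[of \<rho>])
    show "0 < \<rho> n" for n using r(1) by (simp add: \<rho>_def)
    show "\<rho> n \<le> (1/2) ^ n" for n by (simp add: \<rho>_def)
    show "\<rho> (Suc n) \<le> \<rho> n" for n
    proof -
      have "Min (r ` {..Suc n}) \<le> Min (r ` {..n})" by (intro Min_antimono) auto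
      moreover have "(1/2::real) ^ Suc n \<le> (1/2) ^ n" by simp
      ultimately show ?thesis unfolding \<rho>_def by linarith
    qed
    fix n f A assume *: "simple_function vol f" "A \<in> sets vol" "Nq f \<le> ennreal (\<rho> n)"
    have "\<rho> n \<le> r n" unfolding \<rho>_def by (intro min.coboundedI2 Min_le) auto
    then have "Nq f \<le> ennreal (r n)" using *(3) ennreal_leI order_trans by blast
    then show "prob_size (SI f A) \<le> ennreal ((1/2) ^ n)" using r(2) * by blast
  qed
qed

definition rate :: "nat \<Rightarrow> real" where
  "rate = (SOME \<rho>. (\<forall>n. 0 < \<rho> n) \<and> (\<forall>n. \<rho> (Suc n) \<le> \<rho> n) \<and> (\<forall>n. \<rho> n \<le> (1/2) ^ n) \<and>
    (\<forall>n f A. simple_function vol f \<longrightarrow> A \<in> sets vol \<longrightarrow> Nq f \<le> ennreal (\<rho> n) \<longrightarrow>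
      prob_size (SI f A) \<le> ennreal ((1/2) ^ n)))"

lemma rate:
  shows rate_pos: "0 < rate n" and rate_antimono: "rate (Suc n) \<le> rate n" and rate_le: "rate n \<le> (1/2) ^ n"
    and rate_bound: "simple_function vol f \<Longrightarrow> A \<in> sets vol \<Longrightarrow> Nq f \<le> ennreal (rate n) \<Longrightarrow>
      prob_size (SI f A) \<le> ennreal ((1/2) ^ n)"
proof -
  have "\<exists>\<rho>. (\<forall>n. 0 < \<rho> n) \<and> (\<forall>n. \<rho> (Suc n) \<le> \<rho> n) \<and> (\<forall>n. \<rho> n \<le> (1/2) ^ n) \<and>
    (\<forall>n f A. simple_function vol f \<longrightarrow> A \<in> sets vol \<longrightarrow> Nq f \<le> ennreal (\<rho> n) \<longrightarrow>
      prob_size (SI f A) \<le> ennreal ((1/2) ^ n))"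
    by (rule ex_rates) blast
  from someI_ex[OF this, folded rate_def] show "0 < rate n" "rate (Suc n) \<le> rate n" "rate n \<le> (1/2) ^ n"
    "simple_function vol f \<Longrightarrow> A \<in> sets vol \<Longrightarrow> Nq f \<le> ennreal (rate n) \<Longrightarrow>
      prob_size (SI f A) \<le> ennreal ((1/2) ^ n)"
    by blast+
qed

lemma simple_integral_tendsto_0:
  assumes h: "\<And>n. simple_function vol (h n)" and A: "A \<in> sets vol" and lim: "(\<lambda>n. Nq (h n)) \<longlonglongrightarrow> 0"
  shows "(\<lambda>n. prob_size (SI (h n) A)) \<longlonglongrightarrow> 0"
proof (rule order_tendstoI)
  fix a :: ennreal assume a: "0 < a"
  have "(\<lambda>j. ennreal ((1/2) ^ j)) \<longlonglongrightarrow> ennreal 0" by (intro tendsto_ennrealI LIMSEQ_power_zero) simp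
  then obtain j where j: "ennreal ((1/2) ^ j) < a"
    using order_tendstoD(2)[of _ "ennreal 0" sequentially a] a by (auto simp: eventually_sequentially)
  have "\<forall>\<^sub>F n in sequentially. Nq (h n) < ennreal (rate j)"
    using rate_pos[of j] by (intro order_tendstoD[OF lim]) simp
  then show "\<forall>\<^sub>F n in sequentially. prob_size (SI (h n) A) < a"
  proof eventually_elim
    case (elim n)
    then have "prob_size (SI (h n) A) \<le> ennreal ((1/2) ^ j)"
      by (intro rate_bound h A) simp
    then show ?case using j by simp
  qed
qed simp

text \<open>Errors of \<open>rate n / 8\<close> make consecutive differences at most
  \<open>rate n\<close> in \<open>Nq\<close>, so the integrals over every set converge almost surely
  and not merely in probability. The limit is kept as an explicit \<open>lim\<close>, a form in
  which measurability in a parameter can be read off.\<close>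

lemma has_stoch_integral_of_fast_approx:
  assumes f[measurable]: "f \<in> borel_measurable vol" and F: "\<And>n. simple_function vol (F n)"
    and fast: "\<And>n. Nq (\<lambda>y. f y - F n y) \<le> ennreal (rate n / 8)"
  shows "AE \<omega> in M. convergent (\<lambda>n. SI (F n) D \<omega>)"
    and "has_stoch_integral M D \<xi> f (\<lambda>\<omega>. lim (\<lambda>n. SI (F n) D \<omega>))"
proof -
  have Fm[measurable]: "F n \<in> borel_measurable vol" for n using F by (rule borel_measurable_simple_function)
  have conv: "AE \<omega> in M. convergent (\<lambda>n. SI (F n) A \<omega>)" if A: "A \<in> sets vol" for A
  proof (rule fast_Cauchy_convergent)
    show "SI (F n) A \<in> borel_measurable M" for n by (intro simple_stoch_integral_measurable F A)
    fix n
    have "Nq (\<lambda>y. F (Suc n) y - F n y) \<le> 4 * (Nq (\<lambda>y. F (Suc n) y - f y) + Nq (\<lambda>y. f y - F n y))"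
      by (rule Nq_triangle) auto
    also have "\<dots> \<le> 4 * (ennreal (rate (Suc n) / 8) + ennreal (rate n / 8))"
      unfolding Nq_minus[of "F (Suc n)"] by (intro mult_left_mono add_mono fast) auto
    also have "\<dots> = ennreal (4 * (rate (Suc n) / 8 + rate n / 8))"
      using rate_pos[of n] rate_pos[of "Suc n"] by (subst ennreal_mult) auto
    also have "\<dots> \<le> ennreal (rate n)" using rate_antimono[of n] by (intro ennreal_leI) simp
    finally have "prob_size (SI (\<lambda>y. F (Suc n) y - F n y) A) \<le> ennreal ((1/2) ^ n)"
      by (intro rate_bound simple_function_diff F A)
    moreover have "prob_size (SI (\<lambda>y. F (Suc n) y - F n y) A)
        = prob_size (\<lambda>\<omega>. SI (F (Suc n)) A \<omega> - SI (F n) A \<omega>)"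
      by (intro prob_size_cong_AE simple_stoch_integral_diff F A)
    ultimately show "prob_size (\<lambda>\<omega>. SI (F (Suc n)) A \<omega> - SI (F n) A \<omega>)
        \<le> ennreal ((1/2) ^ n)" by simp
  qed
  show "AE \<omega> in M. convergent (\<lambda>n. SI (F n) D \<omega>)" by (rule conv) simp
  have prob: "tendsto_in_prob M (\<lambda>n. SI (F n) A) (\<lambda>\<omega>. lim (\<lambda>n. SI (F n) A \<omega>))"
    if A: "A \<in> sets vol" for A
  proof (rule AE_tendsto_imp_in_prob)
    show m: "SI (F n) A \<in> borel_measurable M" for n by (intro simple_stoch_integral_measurable F A)
    show "(\<lambda>\<omega>. lim (\<lambda>n. SI (F n) A \<omega>)) \<in> borel_measurable M"
      using m by (rule borel_measurable_lim_metric)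
    show "AE \<omega> in M. (\<lambda>n. SI (F n) A \<omega>) \<longlonglongrightarrow> lim (\<lambda>n. SI (F n) A \<omega>)"
      using conv[OF A] by (simp add: convergent_LIMSEQ_iff)
  qed
  have "(\<integral>\<^sup>+y. (\<Sum>n. ennreal (\<bar>f y - F n y\<bar> powr q)) \<partial>vol) = (\<Sum>n. Nq (\<lambda>y. f y - F n y))"
    unfolding Nq_def by (rule nn_integral_suminf) measurable
  also have "\<dots> \<le> (\<Sum>n. ennreal ((1/2) ^ n))"
  proof (rule suminf_le)
    show "Nq (\<lambda>y. f y - F n y) \<le> ennreal ((1/2) ^ n)" for n
      using rate_le[of n] rate_pos[of n] by (intro order_trans[OF fast] ennreal_leI) linarith
  qed auto
  also have "\<dots> = ennreal (\<Sum>n. (1/2) ^ n)" by (intro suminf_ennreal2) (auto intro: summable_geometric)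
  also have "\<dots> < \<infinity>" by simp
  finally have "AE y in vol. (\<Sum>n. ennreal (\<bar>f y - F n y\<bar> powr q)) \<noteq> \<infinity>"
    by (intro nn_integral_PInf_AE) auto
  \<comment> \<open>Besides convergence of the integrals the definition asks for convergence of the
    step functions almost everywhere; it follows because the errors are summable.\<close>
  then have "AE y in vol. (\<lambda>n. F n y) \<longlonglongrightarrow> f y"
  proof eventually_elim
    case (elim y)
    have "summable (\<lambda>n. \<bar>f y - F n y\<bar> powr q)" using elim by (intro summable_suminf_not_top) auto
    then have "(\<lambda>n. \<bar>f y - F n y\<bar> powr q) \<longlonglongrightarrow> 0" by (rule summable_LIMSEQ_zero)
    then have "(\<lambda>n. (\<bar>f y - F n y\<bar> powr q) powr (1 / q)) \<longlonglongrightarrow> 0 powr (1 / q)"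
      using q by (intro tendsto_powr' tendsto_intros) auto
    then have "(\<lambda>n. \<bar>f y - F n y\<bar>) \<longlonglongrightarrow> 0" using q by (simp add: powr_powr)
    then have "(\<lambda>n. f y - F n y) \<longlonglongrightarrow> 0" by (rule tendsto_rabs_zero_cancel)
    then have "(\<lambda>n. f y - (f y - F n y)) \<longlonglongrightarrow> f y - 0" by (intro tendsto_intros)
    then show ?case by simp
  qed
  then show "has_stoch_integral M D \<xi> f (\<lambda>\<omega>. lim (\<lambda>n. SI (F n) D \<omega>))"
    unfolding has_stoch_integral_vol_iff using F prob by (intro conjI f exI[of _ F]) auto
qed

lemma ex_grid_step_near:
  assumes "f \<in> borel_measurable vol" "Nq f < \<infinity>" "0 < \<epsilon>"
  shows "\<exists>k. Nq (\<lambda>y. f y - grid_step k y) \<le> ennreal \<epsilon>"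
  using approximable_Nq_finite[OF assms(1,2)] assms(3) unfolding approximable_def
  by (metis ennreal_less_zero_iff less_imp_le)

lemma ex_has_stoch_integral:
  assumes f: "f \<in> borel_measurable vol" and fin: "Nq f < \<infinity>"
  shows "\<exists>Y. has_stoch_integral M D \<xi> f Y"
proof -
  have "\<exists>k. Nq (\<lambda>y. f y - grid_step k y) \<le> ennreal (rate n / 8)" for n
    using rate_pos[of n] by (intro ex_grid_step_near f fin) simp
  then obtain k where "\<And>n. Nq (\<lambda>y. f y - grid_step (k n) y) \<le> ennreal (rate n / 8)" by metis
  from has_stoch_integral_of_fast_approx(2)[OF f grid_step_simple this] show ?thesis by blast
qed

text \<open>Here \<open>h\<close> approaches \<open>f\<close> in \<open>L^q\<close> and perhaps not
  almost everywhere, so it may fail to be an approximating sequence in the sense of the definition.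
  It is compared with a fast grid approximation, whose integrals tend to \<open>Y\<close> by
  uniqueness.\<close>

lemma simple_integrals_tendsto:
  assumes f[measurable]: "f \<in> borel_measurable vol" and fin: "Nq f < \<infinity>" and Y: "has_stoch_integral M D \<xi> f Y"
    and h: "\<And>n. simple_function vol (h n)" and lim: "(\<lambda>n. Nq (\<lambda>y. f y - h n y)) \<longlonglongrightarrow> 0"
  shows "tendsto_in_prob M (\<lambda>n. SI (h n) D) Y"
proof -
  have hm[measurable]: "h n \<in> borel_measurable vol" for n using h by (rule borel_measurable_simple_function)
  have "\<exists>k. Nq (\<lambda>y. f y - grid_step k y) \<le> ennreal (rate n / 8)" for n
    using rate_pos[of n] by (intro ex_grid_step_near f fin) simp
  then obtain k where k: "\<And>n. Nq (\<lambda>y. f y - grid_step (k n) y) \<le> ennreal (rate n / 8)" by metis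
  let ?F = "\<lambda>n. SI (grid_step (k n)) D"
  let ?Y = "\<lambda>\<omega>. lim (\<lambda>n. ?F n \<omega>)"
  have Fm[measurable]: "?F n \<in> borel_measurable M" for n by (intro simple_stoch_integral_measurable grid_step_simple D_in_vol)
  have Hm[measurable]: "SI (h n) D \<in> borel_measurable M" for n
    by (intro simple_stoch_integral_measurable h D_in_vol)
  have Ym[measurable]: "?Y \<in> borel_measurable M" by (intro borel_measurable_lim_metric Fm)
  have YM[measurable]: "Y \<in> borel_measurable M" using Y by (auto simp: has_stoch_integral_def tendsto_in_prob_def)
  have YY: "AE \<omega> in M. ?Y \<omega> = Y \<omega>"
    by (rule has_stoch_integral_unique[OF has_stoch_integral_of_fast_approx(2)[OF f grid_step_simple k] Y])
  have FY: "tendsto_in_prob M ?F ?Y"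
    using has_stoch_integral_of_fast_approx(1)[OF f grid_step_simple k]
    by (intro AE_tendsto_imp_in_prob Fm Ym) (simp add: convergent_LIMSEQ_iff)
  have rate0: "(\<lambda>n. ennreal (rate n / 8)) \<longlonglongrightarrow> 0"
  proof -
    have z: "(\<lambda>n. (1/2::real) ^ n) \<longlonglongrightarrow> 0" by (intro LIMSEQ_power_zero) simp
    have "(\<lambda>n. rate n / 8) \<longlonglongrightarrow> 0"
    proof (rule tendsto_sandwich[OF _ _ tendsto_const z])
      show "\<forall>\<^sub>F n in sequentially. 0 \<le> rate n / 8" using rate_pos by (simp add: less_imp_le)
      have "rate n / 8 \<le> (1/2) ^ n" for n using rate_pos[of n] rate_le[of n] by linarith
      then show "\<forall>\<^sub>F n in sequentially. rate n / 8 \<le> (1/2) ^ n" by simp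
    qed
    then have "(\<lambda>n. ennreal (rate n / 8)) \<longlonglongrightarrow> ennreal 0" by (rule tendsto_ennrealI)
    then show ?thesis by simp
  qed
  have "(\<lambda>n. Nq (\<lambda>y. h n y - grid_step (k n) y)) \<longlonglongrightarrow> 0"
  proof (rule tendsto_sandwich[OF _ _ tendsto_const])
    have "(\<lambda>n. 4 * (Nq (\<lambda>y. f y - h n y) + ennreal (rate n / 8))) \<longlonglongrightarrow> 4 * (0 + 0)"
      by (intro ennreal_tendsto_cmult tendsto_add lim rate0) simp
    then show "(\<lambda>n. 4 * (Nq (\<lambda>y. f y - h n y) + ennreal (rate n / 8))) \<longlonglongrightarrow> 0" by simp
    have "Nq (\<lambda>y. h n y - grid_step (k n) y) \<le> 4 * (Nq (\<lambda>y. f y - h n y) + ennreal (rate n / 8))" for n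
    proof -
      have "Nq (\<lambda>y. h n y - grid_step (k n) y) \<le> 4 * (Nq (\<lambda>y. h n y - f y) + Nq (\<lambda>y. f y - grid_step (k n) y))"
        by (rule Nq_triangle) auto
      also have "\<dots> \<le> 4 * (Nq (\<lambda>y. f y - h n y) + ennreal (rate n / 8))"
        unfolding Nq_minus[of "h n" f] by (intro mult_left_mono add_left_mono k) auto
      finally show ?thesis .
    qed
    then show "\<forall>\<^sub>F n in sequentially. Nq (\<lambda>y. h n y - grid_step (k n) y) \<le> 4 * (Nq (\<lambda>y. f y - h n y) + ennreal (rate n / 8))"
      by simp
  qed auto
  then have "(\<lambda>n. prob_size (SI (\<lambda>y. h n y - grid_step (k n) y) D)) \<longlonglongrightarrow> 0"
    by (intro simple_integral_tendsto_0 simple_function_diff h grid_step_simple D_in_vol)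
  moreover have "prob_size (SI (\<lambda>y. h n y - grid_step (k n) y) D)
      = prob_size (\<lambda>\<omega>. SI (h n) D \<omega> - ?F n \<omega>)" for n
    by (intro prob_size_cong_AE simple_stoch_integral_diff h grid_step_simple D_in_vol)
  ultimately have HF: "(\<lambda>n. prob_size (\<lambda>\<omega>. SI (h n) D \<omega> - ?F n \<omega>)) \<longlonglongrightarrow> 0" by simp
  have "(\<lambda>n. prob_size (\<lambda>\<omega>. SI (h n) D \<omega> - ?Y \<omega>)) \<longlonglongrightarrow> 0"
  proof (rule tendsto_sandwich[OF _ _ tendsto_const])
    have "(\<lambda>n. prob_size (\<lambda>\<omega>. ?F n \<omega> - ?Y \<omega>)) \<longlonglongrightarrow> 0"
      using FY by (subst (asm) tendsto_in_prob_iff) auto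
    from tendsto_add[OF HF this]
    show "(\<lambda>n. prob_size (\<lambda>\<omega>. SI (h n) D \<omega> - ?F n \<omega>) + prob_size (\<lambda>\<omega>. ?F n \<omega> - ?Y \<omega>)) \<longlonglongrightarrow> 0"
      by simp
    show "\<forall>\<^sub>F n in sequentially. prob_size (\<lambda>\<omega>. SI (h n) D \<omega> - ?Y \<omega>)
        \<le> prob_size (\<lambda>\<omega>. SI (h n) D \<omega> - ?F n \<omega>) + prob_size (\<lambda>\<omega>. ?F n \<omega> - ?Y \<omega>)"
      by (intro always_eventually allI prob_size_triangle Hm Fm Ym)
  qed auto
  then have "tendsto_in_prob M (\<lambda>n. SI (h n) D) ?Y"
    by (subst tendsto_in_prob_iff) auto
  then show ?thesis
    by (rule tendsto_in_prob_AE_cong) (auto intro: YY Hm YM)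
qed

end

section \<open>Mild solutions and the stochastic Fubini theorem\<close>

primrec best_index :: "(nat \<Rightarrow> 'a::linorder) \<Rightarrow> nat \<Rightarrow> nat" where
  "best_index d 0 = 0"
| "best_index d (Suc n) = (if d (Suc n) < d (best_index d n) then Suc n else best_index d n)"

lemma best_index_le: "best_index d n \<le> n"
  by (induction n) auto

lemma best_index_minimal: "k \<le> n \<Longrightarrow> d (best_index d n) \<le> d k"
proof (induction n)
  case (Suc n)
  then show ?case by (cases "k \<le> n") (force simp: not_le le_Suc_eq)+
qed simp

lemma best_index_measurable [measurable]:
  fixes d :: "'a \<Rightarrow> nat \<Rightarrow> ennreal"
  assumes d[measurable]: "\<And>k. (\<lambda>x. d x k) \<in> borel_measurable M"
  shows "(\<lambda>x. best_index (d x) n) \<in> measurable M (count_space UNIV)"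
proof (induction n)
  case (Suc n)
  have [measurable]: "(\<lambda>x. d x (best_index (d x) n)) \<in> borel_measurable M"
    by (rule measurable_compose_countable[OF d Suc.IH])
  show ?case unfolding best_index.simps using Suc.IH by measurable
qed simp

lemma abs_le_one_plus_powr:
  fixes t q :: real
  assumes "1 \<le> q"
  shows "\<bar>t\<bar> \<le> 1 + \<bar>t\<bar> powr q"
proof (cases "\<bar>t\<bar> \<le> 1")
  case False
  then have "\<bar>t\<bar> powr 1 \<le> \<bar>t\<bar> powr q" using assms by (intro powr_mono) auto
  then show ?thesis using False by simp
qed (simp add: add_increasing2)

context bounded_noise
begin

lemma integrable_of_powr:
  assumes f[measurable]: "f \<in> borel_measurable vol" and fin: "(\<integral>\<^sup>+x. ennreal (\<bar>f x\<bar> powr q) \<partial>vol) < \<infinity>"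
  shows "integrable vol f" "integrable vol (\<lambda>x. \<bar>f x\<bar> powr q)"
proof -
  show p: "integrable vol (\<lambda>x. \<bar>f x\<bar> powr q)" using fin by (intro integrableI_nonneg) auto
  show "integrable vol f"
    by (rule Bochner_Integration.integrable_bound[where f = "\<lambda>x. 1 + \<bar>f x\<bar> powr q"])
       (use p abs_le_one_plus_powr[OF q(1)] in auto)
qed

text \<open>By homogeneity the bound \<open>t \<le> 1 + t\<^sup>q\<close> replaces Jensen's inequality, at the price of a constant.\<close>

lemma powr_integral_le:
  assumes f[measurable]: "f \<in> borel_measurable vol"
  shows "ennreal (\<bar>LINT x|vol. f x\<bar> powr q)
    \<le> ennreal ((measure vol D + 1) powr q) * (\<integral>\<^sup>+x. ennreal (\<bar>f x\<bar> powr q) \<partial>vol)"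
proof (cases "(\<integral>\<^sup>+x. ennreal (\<bar>f x\<bar> powr q) \<partial>vol) < \<infinity>")
  case False
  then have "(\<integral>\<^sup>+x. ennreal (\<bar>f x\<bar> powr q) \<partial>vol) = \<infinity>" by (simp add: less_top[symmetric])
  moreover have "0 < (measure vol D + 1) powr q" by (simp add: add_nonneg_eq_0_iff)
  ultimately show ?thesis by (simp add: ennreal_mult_top)
next
  case True
  note int = integrable_of_powr[OF f True]
  define N where "N = (LINT x|vol. \<bar>f x\<bar> powr q)"
  have N: "(\<integral>\<^sup>+x. ennreal (\<bar>f x\<bar> powr q) \<partial>vol) = ennreal N" "0 \<le> N"
    unfolding N_def using int by (auto intro: nn_integral_eq_integral)
  have "\<bar>LINT x|vol. f x\<bar> powr q \<le> (measure vol D + 1) powr q * N"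
  proof (cases "N = 0")
    case True
    have "AE x in vol. \<bar>f x\<bar> powr q = 0"
      using True int(2) unfolding N_def by (subst (asm) integral_nonneg_eq_0_iff_AE) auto
    then have "AE x in vol. f x = 0" by eventually_elim auto
    then have "(LINT x|vol. f x) = (LINT x|vol. 0)" by (intro integral_cong_AE) auto
    then show ?thesis using q True by simp
  next
    case False
    then have Np: "0 < N" using N by simp
    define l where "l = N powr (1 / q)"
    have l: "0 < l" "l powr q = N" using Np q by (auto simp: l_def powr_powr)
    have "\<bar>LINT x|vol. f x\<bar> \<le> (LINT x|vol. \<bar>f x\<bar>)" by (rule integral_abs_bound)
    also have "\<dots> \<le> (LINT x|vol. l * (1 + \<bar>f x\<bar> powr q / N))"
    proof (rule integral_mono)
      fix x
      have "\<bar>f x / l\<bar> \<le> 1 + \<bar>f x / l\<bar> powr q" by (rule abs_le_one_plus_powr[OF q(1)])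
      also have "\<bar>f x / l\<bar> powr q = \<bar>f x\<bar> powr q / N" using l by (simp add: abs_divide powr_divide)
      finally show "\<bar>f x\<bar> \<le> l * (1 + \<bar>f x\<bar> powr q / N)" using l by (simp add: abs_divide field_simps)
    qed (use int in auto)
    also have "\<dots> = l * (measure vol D + 1)"
      using int Np by (simp add: N_def[symmetric])
    finally have "\<bar>LINT x|vol. f x\<bar> powr q \<le> (l * (measure vol D + 1)) powr q"
      using q by (intro powr_mono2) auto
    also have "\<dots> = (measure vol D + 1) powr q * N" using l by (simp add: powr_mult)
    finally show ?thesis .
  qed
  then show ?thesis unfolding N(1) using N(2) by (simp add: ennreal_mult[symmetric] ennreal_leI)
qed

lemma has_stoch_integral_AE_cong:
  assumes "has_stoch_integral M D \<xi> f Y" "AE \<omega> in M. Y \<omega> = Y' \<omega>" "Y' \<in> borel_measurable M"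
    "AE y in vol. f y = g y" "g \<in> borel_measurable vol"
  shows "has_stoch_integral M D \<xi> g Y'"
proof -
  obtain F where F: "\<And>n. simple_function vol (F n)" "AE x in vol. (\<lambda>n. F n x) \<longlonglongrightarrow> f x"
      "\<And>A. A \<in> sets vol \<Longrightarrow> \<exists>Z. tendsto_in_prob M (\<lambda>n. SI (F n) A) Z"
      "tendsto_in_prob M (\<lambda>n. SI (F n) D) Y"
    using assms(1) unfolding has_stoch_integral_vol_iff by blast
  have "AE x in vol. (\<lambda>n. F n x) \<longlonglongrightarrow> g x" using F(2) assms(4) by eventually_elim simp
  moreover have "tendsto_in_prob M (\<lambda>n. SI (F n) D) Y'"
    by (rule tendsto_in_prob_AE_cong[OF F(4) _ assms(2) _ assms(3)])
       (auto intro: simple_stoch_integral_measurable F)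
  ultimately show ?thesis unfolding has_stoch_integral_vol_iff using F assms(5) by blast
qed

lemma pair_vol_measurable_iff:
  "f \<in> borel_measurable (M \<Otimes>\<^sub>M restrict_space borel D) \<longleftrightarrow> f \<in> borel_measurable (M \<Otimes>\<^sub>M vol)"
  using measurable_cong_sets[OF sets_pair_measure_cong[OF refl sets_vol] refl] by blast

text \<open>The list of the first \<open>n\<close> grid steps labels a common refinement of their
  partitions, and its entries recover the individual step functions.\<close>

lemma simple_function_list:
  "simple_function vol (\<lambda>y. map (\<lambda>k. grid_step k y) [0..<n])"
proof (induction n)
  case (Suc n)
  have eq: "(\<lambda>y::real^'d. map (\<lambda>k. grid_step k y) [0..<Suc n]) = (\<lambda>y. map (\<lambda>k. grid_step k y) [0..<n] @ [grid_step n y])"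
    by simp
  show ?case
    unfolding eq by (rule simple_function_compose2[OF Suc grid_step_simple[of n], of "\<lambda>l t. l @ [t]"])
qed (simp add: simple_function_const)

context
  fixes G :: "real^'d \<Rightarrow> real^'d \<Rightarrow> real"
  assumes G[measurable]: "(\<lambda>(x, y). G x y) \<in> borel_measurable (vol \<Otimes>\<^sub>M vol)"
begin

lemma kernel_section [measurable]: "x \<in> D \<Longrightarrow> G x \<in> borel_measurable vol"
  using measurable_compose[OF measurable_Pair1' G, of x] by simp

definition step_dist :: "real^'d \<Rightarrow> nat \<Rightarrow> ennreal" where
  "step_dist x k = Nq (\<lambda>y. G x y - grid_step k y)"

lemma step_dist_measurable [measurable]: "(\<lambda>x. step_dist x k) \<in> borel_measurable vol"
proof -
  have [measurable]: "(\<lambda>(x, y). \<bar>G x y - grid_step k y\<bar> powr q) \<in> borel_measurable (vol \<Otimes>\<^sub>M vol)" by measurable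
  show ?thesis unfolding step_dist_def[abs_def] Nq_def by measurable
qed

lemma simple_integral_index_measurable:
  assumes "\<kappa> \<in> measurable vol (count_space UNIV)"
  shows "(\<lambda>(\<omega>, x). SI (grid_step (\<kappa> x)) D \<omega>) \<in> borel_measurable (M \<Otimes>\<^sub>M vol)"
  unfolding split_beta'
proof (rule measurable_compose_countable)
  show "(\<lambda>z. SI (grid_step i) D (fst z)) \<in> borel_measurable (M \<Otimes>\<^sub>M vol)" for i
    by (rule measurable_compose[OF measurable_fst simple_stoch_integral_measurable[OF grid_step_simple D_in_vol]])
  show "(\<lambda>z. \<kappa> (snd z)) \<in> measurable (M \<Otimes>\<^sub>M vol) (count_space UNIV)"
    by (rule measurable_compose[OF measurable_snd assms])
qed

text \<open>The least admissible index depends measurably on \<open>x\<close>, and the approximating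
  integrals are jointly measurable because the index ranges over a countable set. The limit is taken
  pointwise, so \<open>u\<close> inherits joint measurability.\<close>

lemma ex_mild_solution:
  assumes fin: "\<And>x. x \<in> D \<Longrightarrow> Nq (G x) < \<infinity>"
  shows "\<exists>u. mild_solution M D G \<xi> u"
proof -
  define \<kappa> where "\<kappa> n x = (LEAST k. step_dist x k \<le> ennreal (rate n / 8))" for n x
  have \<kappa>m: "\<kappa> n \<in> measurable vol (count_space UNIV)" for n unfolding \<kappa>_def[abs_def] by measurable
  have \<kappa>: "step_dist x (\<kappa> n x) \<le> ennreal (rate n / 8)" if "x \<in> D" for x n
  proof -
    have "\<exists>k. step_dist x k \<le> ennreal (rate n / 8)"
      unfolding step_dist_def using rate_pos[of n] that by (intro ex_grid_step_near kernel_section fin) auto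
    then show ?thesis unfolding \<kappa>_def by (rule LeastI_ex)
  qed
  define u where "u x \<omega> = lim (\<lambda>n. SI (grid_step (\<kappa> n x)) D \<omega>)" for x \<omega>
  have "(\<lambda>(\<omega>, x). u x \<omega>) \<in> borel_measurable (M \<Otimes>\<^sub>M vol)"
    unfolding u_def split_beta'
    by (rule borel_measurable_lim_metric)
       (use simple_integral_index_measurable[OF \<kappa>m] in \<open>simp add: split_beta'\<close>)
  moreover have "has_stoch_integral M D \<xi> (G x) (u x)" if x: "x \<in> D" for x
    unfolding u_def[abs_def]
    by (rule has_stoch_integral_of_fast_approx(2)[OF kernel_section[OF x] grid_step_simple])
       (use \<kappa>[OF x] in \<open>simp add: step_dist_def\<close>)
  ultimately show ?thesis unfolding mild_solution_def pair_vol_measurable_iff by blast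
qed

lemma mild_solution_unique:
  assumes "mild_solution M D G \<xi> u" "mild_solution M D G \<xi> v" "x \<in> D"
  shows "AE \<omega> in M. u x \<omega> = v x \<omega>"
  using assms unfolding mild_solution_def by (blast intro: has_stoch_integral_unique)

section \<open>Approximation of a mild solution in the mean over \<open>D\<close>\<close>

context
  fixes B :: real and u :: "real^'d \<Rightarrow> 'w \<Rightarrow> real"
  assumes B: "\<And>x. x \<in> D \<Longrightarrow> Nq (G x) \<le> ennreal B"
    and mild: "mild_solution M D G \<xi> u"
begin

text \<open>Unlike the least index with a prescribed error, the best index among the first ones is
  at most \<open>n\<close> for all \<open>x\<close> at once. The approximate solution at stage
  \<open>n\<close> thus lives on a single finite partition, as the kernel bound demands.\<close>

definition best_step :: "nat \<Rightarrow> real^'d \<Rightarrow> nat" where "best_step n x = best_index (step_dist x) n"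

definition step_solution :: "nat \<Rightarrow> real^'d \<Rightarrow> 'w \<Rightarrow> real" where
  "step_solution n x = SI (grid_step (best_step n x)) D"

text \<open>The \<open>q\<close>-th power of the \<open>L^q\<close> distance over
  \<open>D \<times> D\<close> between the kernel and its step approximation.\<close>

definition defect :: "nat \<Rightarrow> ennreal" where "defect n = (\<integral>\<^sup>+x. step_dist x (best_step n x) \<partial>vol)"

lemma best_step_measurable [measurable]: "best_step n \<in> measurable vol (count_space UNIV)"
  unfolding best_step_def[abs_def] by measurable

lemma best_step_le: "best_step n x \<le> n"
  unfolding best_step_def by (rule best_index_le)

lemma u_measurable [measurable]: "(\<lambda>(\<omega>, x). u x \<omega>) \<in> borel_measurable (M \<Otimes>\<^sub>M vol)"
  using mild unfolding mild_solution_def pair_vol_measurable_iff by blast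

lemma step_solution_measurable [measurable]: "(\<lambda>(\<omega>, x). step_solution n x \<omega>) \<in> borel_measurable (M \<Otimes>\<^sub>M vol)"
  unfolding step_solution_def by (rule simple_integral_index_measurable) measurable

lemma Nq_G_finite: "x \<in> D \<Longrightarrow> Nq (G x) < \<infinity>"
  using B[of x] by (simp add: order_le_less_trans)

lemma step_dist_tendsto: assumes x: "x \<in> D" shows "(\<lambda>n. step_dist x (best_step n x)) \<longlonglongrightarrow> 0"
proof (rule order_tendstoI)
  fix a :: ennreal assume "0 < a"
  then obtain k where k: "step_dist x k < a"
    using approximable_Nq_finite[OF kernel_section[OF x] Nq_G_finite[OF x]]
    unfolding approximable_def step_dist_def by blast
  show "\<forall>\<^sub>F n in sequentially. step_dist x (best_step n x) < a"
    using eventually_ge_at_top[of k]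
  proof eventually_elim
    case (elim n)
    then show ?case using best_index_minimal[of k n "step_dist x"] k unfolding best_step_def by simp
  qed
qed simp

lemma step_dist_best_step_measurable [measurable]: "(\<lambda>x. step_dist x (best_step n x)) \<in> borel_measurable vol"
  by (rule measurable_compose_countable[OF step_dist_measurable best_step_measurable])

text \<open>Index 0 competes at every stage, so the errors are dominated by those of one fixed step
  function; that these are bounded in \<open>x\<close> is due to the uniform bound on the sections
  \<open>G x\<close>.\<close>

lemma defect_tendsto: "defect \<longlonglongrightarrow> 0" and defect_finite: "defect n < \<infinity>"
proof -
  have s0: "Nq (\<lambda>y. 0 - grid_step 0 y) < \<infinity>"
  proof (rule Nq_bounded_finite)
    fix y :: "real^'d"
    show "\<bar>0 - grid_step 0 y\<bar> \<le> Max (abs ` range (grid_step 0 :: real^'d \<Rightarrow> real))"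
      using grid_step_finite[of 0] by (intro Max_ge) auto
  qed
  define C where "C = 4 * (ennreal B + Nq (\<lambda>y. 0 - grid_step 0 y))"
  have C: "C < \<infinity>" using s0 by (simp add: C_def ennreal_mult_less_top)
  have bd: "step_dist x (best_step n x) \<le> C" if "x \<in> D" for x n
  proof -
    have "step_dist x (best_step n x) \<le> step_dist x 0" unfolding best_step_def by (rule best_index_minimal) simp
    also have "\<dots> \<le> 4 * (Nq (\<lambda>y. G x y - 0) + Nq (\<lambda>y. 0 - grid_step 0 y))"
      unfolding step_dist_def using that by (intro Nq_triangle kernel_section) auto
    also have "\<dots> \<le> C" unfolding C_def using B[OF that] by (intro mult_left_mono add_right_mono) auto
    finally show ?thesis .
  qed
  have Cint: "(\<integral>\<^sup>+x. C \<partial>vol) < \<infinity>"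
    using C by (simp add: vol.emeasure_eq_measure ennreal_mult_less_top)
  have "defect n \<le> (\<integral>\<^sup>+x. C \<partial>vol)" unfolding defect_def by (intro nn_integral_mono bd) simp
  then show "defect n < \<infinity>" using Cint by (rule order_le_less_trans)
  have "defect \<longlonglongrightarrow> (\<integral>\<^sup>+x. 0 \<partial>vol)"
    unfolding defect_def[abs_def]
    by (rule nn_integral_dominated_convergence[where w = "\<lambda>_. C"])
       (use Cint bd step_dist_tendsto in \<open>auto intro!: AE_I2\<close>)
  then show "defect \<longlonglongrightarrow> 0" by simp
qed

lemma step_solution_tendsto: "x \<in> D \<Longrightarrow> tendsto_in_prob M (\<lambda>n. step_solution n x) (u x)"
  unfolding step_solution_def
  using step_dist_tendsto[of x] mild unfolding step_dist_def mild_solution_def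
  by (intro simple_integrals_tendsto[of "G x"] kernel_section Nq_G_finite grid_step_simple) auto

text \<open>Both stages are written over the partition labelled by lists of grid steps, with
  coefficients that read off the entries selected at \<open>x\<close>. The kernel bound then
  controls their \<open>L^1\<close> distance over \<open>D\<close>, truncated at 1, by the two
  defects.\<close>

lemma step_solution_Cauchy:
  assumes \<epsilon>: "0 < \<epsilon>"
  obtains K where "\<And>n m. (\<integral>\<^sup>+\<omega>. min 1 (\<integral>\<^sup>+x. ennreal \<bar>step_solution n x \<omega> - step_solution m x \<omega>\<bar> \<partial>vol) \<partial>M)
    \<le> ennreal \<epsilon> + ennreal K * (defect n + defect m)"
proof -
  obtain K where K: "0 \<le> K" and bd: "\<And>(V :: real^'d \<Rightarrow> real list) c. simple_function vol V \<Longrightarrow>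
      \<forall>l\<in>V ` D. (\<lambda>x. c x l) \<in> borel_measurable vol \<Longrightarrow>
      (\<integral>\<^sup>+\<omega>. min 1 (\<integral>\<^sup>+x. ennreal \<bar>\<Sum>l\<in>V ` D. c x l * \<xi> (cell V l) \<omega>\<bar> \<partial>vol) \<partial>M)
        \<le> ennreal \<epsilon> + ennreal K * (\<integral>\<^sup>+x. \<integral>\<^sup>+y. ennreal (\<bar>c x (V y)\<bar> powr q) \<partial>vol \<partial>vol)"
    using kernel_sum_bound[OF \<epsilon>, where 'b = "real list"] by blast
  show thesis
  proof (rule that)
    fix n m
    \<comment> \<open>The list must contain the positions \<open>n\<close> and \<open>m\<close>
      themselves, hence the successor.\<close>
    define L where "L = Suc (max n m)"
    define V :: "real^'d \<Rightarrow> real list" where "V y = map (\<lambda>k. grid_step k y) [0..<L]" for y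
    have V: "simple_function vol V" unfolding V_def[abs_def] by (rule simple_function_list)
    have Vk: "V y ! k = grid_step k y" if "k < L" for k y using that by (simp add: V_def)
    have lt: "best_step n x < L" "best_step m x < L" for x using best_step_le[of n x] best_step_le[of m x] by (auto simp: L_def)
    define c where "c x l = l ! best_step n x - l ! best_step m x" for x and l :: "real list"
    have c: "(\<lambda>x. c x l) \<in> borel_measurable vol" for l
    proof -
      have "(\<lambda>x. l ! best_step j x) \<in> borel_measurable vol" for j
        by (rule measurable_compose[OF best_step_measurable]) simp
      then show ?thesis unfolding c_def by measurable
    qed
    \<comment> \<open>Finitely many step functions occur, so one null set serves all
      \<open>x\<close>; a null set chosen separately for each \<open>x\<close> would be of no help
      in the integral over \<open>D\<close>.\<close>
    have "AE \<omega> in M. \<forall>k\<in>{..<L}. SI (grid_step k) D \<omega>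
        = (\<Sum>l\<in>V ` D. l ! k * \<xi> (cell V l) \<omega>)"
      by (intro AE_finite_allI simple_stoch_integral_rep[OF V D_in_vol]) (auto simp: Vk)
    then have ae: "AE \<omega> in M. \<forall>x. step_solution n x \<omega> - step_solution m x \<omega> = (\<Sum>l\<in>V ` D. c x l * \<xi> (cell V l) \<omega>)"
    proof eventually_elim
      case (elim \<omega>)
      show ?case
      proof
        fix x
        show "step_solution n x \<omega> - step_solution m x \<omega> = (\<Sum>l\<in>V ` D. c x l * \<xi> (cell V l) \<omega>)"
          unfolding step_solution_def using elim lt[of x] by (simp add: c_def left_diff_distrib sum_subtractf)
      qed
    qed
    have "(\<integral>\<^sup>+\<omega>. min 1 (\<integral>\<^sup>+x. ennreal \<bar>step_solution n x \<omega> - step_solution m x \<omega>\<bar> \<partial>vol) \<partial>M)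
        = (\<integral>\<^sup>+\<omega>. min 1 (\<integral>\<^sup>+x. ennreal \<bar>\<Sum>l\<in>V ` D. c x l * \<xi> (cell V l) \<omega>\<bar> \<partial>vol) \<partial>M)"
      by (rule nn_integral_cong_AE) (use ae in \<open>eventually_elim, simp only:\<close>)
    also have "\<dots> \<le> ennreal \<epsilon> + ennreal K * (\<integral>\<^sup>+x. \<integral>\<^sup>+y. ennreal (\<bar>c x (V y)\<bar> powr q) \<partial>vol \<partial>vol)"
      by (intro bd V ballI c)
    also have "\<dots> \<le> ennreal \<epsilon> + ennreal K * (\<integral>\<^sup>+x. 4 * (step_dist x (best_step n x) + step_dist x (best_step m x)) \<partial>vol)"
    proof (intro add_left_mono mult_left_mono nn_integral_mono)
      fix x assume "x \<in> space vol"
      then have x: "x \<in> D" by simp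
      have "(\<integral>\<^sup>+y. ennreal (\<bar>c x (V y)\<bar> powr q) \<partial>vol) = Nq (\<lambda>y. grid_step (best_step n x) y - grid_step (best_step m x) y)"
        unfolding Nq_def by (simp add: c_def Vk lt)
      also have "\<dots> \<le> 4 * (Nq (\<lambda>y. grid_step (best_step n x) y - G x y) + Nq (\<lambda>y. G x y - grid_step (best_step m x) y))"
        using x by (intro Nq_triangle kernel_section grid_step_vol)
      also have "\<dots> = 4 * (step_dist x (best_step n x) + step_dist x (best_step m x))"
        unfolding step_dist_def by (simp only: Nq_minus[of "grid_step (best_step n x)"])
      finally show "(\<integral>\<^sup>+y. ennreal (\<bar>c x (V y)\<bar> powr q) \<partial>vol) \<le> 4 * (step_dist x (best_step n x) + step_dist x (best_step m x))" .
    qed simp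
    also have "(\<integral>\<^sup>+x. 4 * (step_dist x (best_step n x) + step_dist x (best_step m x)) \<partial>vol) = 4 * (defect n + defect m)"
      unfolding defect_def by (subst nn_integral_cmult) (auto simp: nn_integral_add)
    also have "ennreal \<epsilon> + ennreal K * (4 * (defect n + defect m)) = ennreal \<epsilon> + ennreal (K * 4) * (defect n + defect m)"
      using K by (simp add: ennreal_mult mult.assoc)
    finally show "(\<integral>\<^sup>+\<omega>. min 1 (\<integral>\<^sup>+x. ennreal \<bar>step_solution n x \<omega> - step_solution m x \<omega>\<bar> \<partial>vol) \<partial>M)
      \<le> ennreal \<epsilon> + ennreal (K * 4) * (defect n + defect m)" .
  qed
qed

text \<open>For each \<open>x\<close> the approximations converge in probability. Tonelli and
  dominated convergence over \<open>D\<close> carry this over to the double integral, through the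
  inequality \<open>min L t \<le> L * min 1 t\<close> for \<open>L \<ge> 1\<close>.\<close>

lemma truncated_limit:
  "(\<lambda>m. \<integral>\<^sup>+\<omega>. \<integral>\<^sup>+x. ennreal (min (real (Suc L)) \<bar>step_solution m x \<omega> - u x \<omega>\<bar>) \<partial>vol \<partial>M) \<longlonglongrightarrow> 0"
proof -
  interpret P: pair_sigma_finite M vol ..
  have [measurable]: "(\<lambda>x. prob_size (\<lambda>\<omega>. step_solution m x \<omega> - u x \<omega>)) \<in> borel_measurable vol" for m
  proof -
    have [measurable]: "(\<lambda>(x, \<omega>). ennreal (min 1 \<bar>step_solution m x \<omega> - u x \<omega>\<bar>)) \<in> borel_measurable (vol \<Otimes>\<^sub>M M)"
      by (subst measurable_pair_swap_iff) measurable
    show ?thesis unfolding prob_size_def by measurable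
  qed
  have um: "u x \<in> borel_measurable M" "step_solution m x \<in> borel_measurable M" if "x \<in> D" for x m
    using step_solution_tendsto[OF that] by (auto simp: tendsto_in_prob_def)
  have lim: "(\<lambda>m. \<integral>\<^sup>+x. prob_size (\<lambda>\<omega>. step_solution m x \<omega> - u x \<omega>) \<partial>vol) \<longlonglongrightarrow> (\<integral>\<^sup>+x. 0 \<partial>vol)"
  proof (rule nn_integral_dominated_convergence[where w = "\<lambda>_. 1"])
    show "AE x in vol. (\<lambda>m. prob_size (\<lambda>\<omega>. step_solution m x \<omega> - u x \<omega>)) \<longlonglongrightarrow> 0"
      using step_solution_tendsto um by (intro AE_I2) (simp add: tendsto_in_prob_iff)
  qed (auto simp: vol.emeasure_eq_measure prob_size_le_1)
  have "(\<lambda>m. ennreal (real (Suc L)) * (\<integral>\<^sup>+x. prob_size (\<lambda>\<omega>. step_solution m x \<omega> - u x \<omega>) \<partial>vol)) \<longlonglongrightarrow> ennreal (real (Suc L)) * (\<integral>\<^sup>+x. 0 \<partial>vol)"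
    by (intro ennreal_tendsto_cmult lim) simp
  then have lim': "(\<lambda>m. ennreal (real (Suc L)) * (\<integral>\<^sup>+x. prob_size (\<lambda>\<omega>. step_solution m x \<omega> - u x \<omega>) \<partial>vol)) \<longlonglongrightarrow> 0" by simp
  show ?thesis
  proof (rule tendsto_sandwich[OF _ _ tendsto_const lim'])
    show "\<forall>\<^sub>F m in sequentially. (\<integral>\<^sup>+\<omega>. \<integral>\<^sup>+x. ennreal (min (real (Suc L)) \<bar>step_solution m x \<omega> - u x \<omega>\<bar>) \<partial>vol \<partial>M)
        \<le> ennreal (real (Suc L)) * (\<integral>\<^sup>+x. prob_size (\<lambda>\<omega>. step_solution m x \<omega> - u x \<omega>) \<partial>vol)"
    proof (rule always_eventually, rule allI)
      fix m
      have "(\<integral>\<^sup>+\<omega>. \<integral>\<^sup>+x. ennreal (min (real (Suc L)) \<bar>step_solution m x \<omega> - u x \<omega>\<bar>) \<partial>vol \<partial>M)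
          = (\<integral>\<^sup>+x. \<integral>\<^sup>+\<omega>. ennreal (min (real (Suc L)) \<bar>step_solution m x \<omega> - u x \<omega>\<bar>) \<partial>M \<partial>vol)"
        by (rule P.Fubini'[symmetric]) measurable
      also have "\<dots> \<le> (\<integral>\<^sup>+x. ennreal (real (Suc L)) * prob_size (\<lambda>\<omega>. step_solution m x \<omega> - u x \<omega>) \<partial>vol)"
      proof (rule nn_integral_mono)
        fix x assume "x \<in> space vol"
        then have [measurable]: "u x \<in> borel_measurable M" "step_solution m x \<in> borel_measurable M" using um by auto
        have "min (real (Suc L)) t \<le> real (Suc L) * min 1 t" if "0 \<le> t" for t :: real
          using that mult_right_mono[of 1 "real (Suc L)" t] by (auto simp: min_def)
        then have "(\<integral>\<^sup>+\<omega>. ennreal (min (real (Suc L)) \<bar>step_solution m x \<omega> - u x \<omega>\<bar>) \<partial>M)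
            \<le> (\<integral>\<^sup>+\<omega>. ennreal (real (Suc L)) * ennreal (min 1 \<bar>step_solution m x \<omega> - u x \<omega>\<bar>) \<partial>M)"
          by (intro nn_integral_mono) (simp add: ennreal_mult[symmetric] ennreal_leI del: of_nat_Suc)
        also have "\<dots> = ennreal (real (Suc L)) * prob_size (\<lambda>\<omega>. step_solution m x \<omega> - u x \<omega>)"
          unfolding prob_size_def by (rule nn_integral_cmult) measurable
        finally show "(\<integral>\<^sup>+\<omega>. ennreal (min (real (Suc L)) \<bar>step_solution m x \<omega> - u x \<omega>\<bar>) \<partial>M)
            \<le> ennreal (real (Suc L)) * prob_size (\<lambda>\<omega>. step_solution m x \<omega> - u x \<omega>)" .
      qed
      also have "\<dots> = ennreal (real (Suc L)) * (\<integral>\<^sup>+x. prob_size (\<lambda>\<omega>. step_solution m x \<omega> - u x \<omega>) \<partial>vol)"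
        by (rule nn_integral_cmult) measurable
      finally show "(\<integral>\<^sup>+\<omega>. \<integral>\<^sup>+x. ennreal (min (real (Suc L)) \<bar>step_solution m x \<omega> - u x \<omega>\<bar>) \<partial>vol \<partial>M)
        \<le> ennreal (real (Suc L)) * (\<integral>\<^sup>+x. prob_size (\<lambda>\<omega>. step_solution m x \<omega> - u x \<omega>) \<partial>vol)" .
    qed
  qed auto
qed

definition gap :: "nat \<Rightarrow> 'w \<Rightarrow> ennreal" where
  "gap n \<omega> = (\<integral>\<^sup>+x. ennreal \<bar>step_solution n x \<omega> - u x \<omega>\<bar> \<partial>vol)"

lemma gap_measurable [measurable]: "gap n \<in> borel_measurable M"
  unfolding gap_def[abs_def] by measurable

text \<open>Truncating at level \<open>L\<close> makes the passage \<open>m \<rightarrow> \<infinity>\<close> in the Cauchy estimate a matter of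
  dominated convergence; \<open>L\<close> is then removed by monotone convergence.\<close>

lemma gap_bound:
  assumes W: "\<And>m. m \<ge> N \<Longrightarrow> (\<integral>\<^sup>+\<omega>. min 1 (\<integral>\<^sup>+x. ennreal \<bar>step_solution n x \<omega> - step_solution m x \<omega>\<bar> \<partial>vol) \<partial>M) \<le> c"
  shows "(\<integral>\<^sup>+\<omega>. min 1 (gap n \<omega>) \<partial>M) \<le> c"
proof -
  have trunc: "(\<integral>\<^sup>+\<omega>. min 1 (\<integral>\<^sup>+x. ennreal (min (real (Suc L)) \<bar>step_solution n x \<omega> - u x \<omega>\<bar>) \<partial>vol) \<partial>M) \<le> c" for L
  proof -
    let ?e = "\<lambda>m. \<integral>\<^sup>+\<omega>. \<integral>\<^sup>+x. ennreal (min (real (Suc L)) \<bar>step_solution m x \<omega> - u x \<omega>\<bar>) \<partial>vol \<partial>M"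
    have le: "(\<integral>\<^sup>+\<omega>. min 1 (\<integral>\<^sup>+x. ennreal (min (real (Suc L)) \<bar>step_solution n x \<omega> - u x \<omega>\<bar>) \<partial>vol) \<partial>M) \<le> c + ?e m" if m: "m \<ge> N" for m
    proof -
      have "(\<integral>\<^sup>+\<omega>. min 1 (\<integral>\<^sup>+x. ennreal (min (real (Suc L)) \<bar>step_solution n x \<omega> - u x \<omega>\<bar>) \<partial>vol) \<partial>M)
          \<le> (\<integral>\<^sup>+\<omega>. min 1 (\<integral>\<^sup>+x. ennreal \<bar>step_solution n x \<omega> - step_solution m x \<omega>\<bar> \<partial>vol)
              + (\<integral>\<^sup>+x. ennreal (min (real (Suc L)) \<bar>step_solution m x \<omega> - u x \<omega>\<bar>) \<partial>vol) \<partial>M)"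
      proof (rule nn_integral_mono)
        fix \<omega> assume \<omega>[measurable]: "\<omega> \<in> space M"
        have [measurable]: "(\<lambda>x. u x \<omega>) \<in> borel_measurable vol" "(\<lambda>x. step_solution n x \<omega>) \<in> borel_measurable vol"
          "(\<lambda>x. step_solution m x \<omega>) \<in> borel_measurable vol"
          using measurable_compose[OF measurable_Pair1'[OF \<omega>] u_measurable]
            measurable_compose[OF measurable_Pair1'[OF \<omega>] step_solution_measurable] by auto
        have "(\<integral>\<^sup>+x. ennreal (min (real (Suc L)) \<bar>step_solution n x \<omega> - u x \<omega>\<bar>) \<partial>vol)
            \<le> (\<integral>\<^sup>+x. ennreal \<bar>step_solution n x \<omega> - step_solution m x \<omega>\<bar> + ennreal (min (real (Suc L)) \<bar>step_solution m x \<omega> - u x \<omega>\<bar>) \<partial>vol)"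
        proof (rule nn_integral_mono)
          fix x
          have "min (real (Suc L)) \<bar>step_solution n x \<omega> - u x \<omega>\<bar> \<le> \<bar>step_solution n x \<omega> - step_solution m x \<omega>\<bar> + min (real (Suc L)) \<bar>step_solution m x \<omega> - u x \<omega>\<bar>"
            by (auto simp: min_def)
          then show "ennreal (min (real (Suc L)) \<bar>step_solution n x \<omega> - u x \<omega>\<bar>)
              \<le> ennreal \<bar>step_solution n x \<omega> - step_solution m x \<omega>\<bar> + ennreal (min (real (Suc L)) \<bar>step_solution m x \<omega> - u x \<omega>\<bar>)"
            by (simp add: ennreal_plus[symmetric] ennreal_leI del: ennreal_plus of_nat_Suc)
        qed
        also have "\<dots> = (\<integral>\<^sup>+x. ennreal \<bar>step_solution n x \<omega> - step_solution m x \<omega>\<bar> \<partial>vol) + (\<integral>\<^sup>+x. ennreal (min (real (Suc L)) \<bar>step_solution m x \<omega> - u x \<omega>\<bar>) \<partial>vol)"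
          by (rule nn_integral_add) measurable
        finally have "min 1 (\<integral>\<^sup>+x. ennreal (min (real (Suc L)) \<bar>step_solution n x \<omega> - u x \<omega>\<bar>) \<partial>vol)
            \<le> min 1 ((\<integral>\<^sup>+x. ennreal \<bar>step_solution n x \<omega> - step_solution m x \<omega>\<bar> \<partial>vol) + (\<integral>\<^sup>+x. ennreal (min (real (Suc L)) \<bar>step_solution m x \<omega> - u x \<omega>\<bar>) \<partial>vol))"
          by (rule min.mono[OF order_refl])
        also have "\<dots> \<le> min 1 (\<integral>\<^sup>+x. ennreal \<bar>step_solution n x \<omega> - step_solution m x \<omega>\<bar> \<partial>vol) + (\<integral>\<^sup>+x. ennreal (min (real (Suc L)) \<bar>step_solution m x \<omega> - u x \<omega>\<bar>) \<partial>vol)"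
          by (simp add: min_def add_increasing2)
        finally show "min 1 (\<integral>\<^sup>+x. ennreal (min (real (Suc L)) \<bar>step_solution n x \<omega> - u x \<omega>\<bar>) \<partial>vol)
            \<le> min 1 (\<integral>\<^sup>+x. ennreal \<bar>step_solution n x \<omega> - step_solution m x \<omega>\<bar> \<partial>vol) + (\<integral>\<^sup>+x. ennreal (min (real (Suc L)) \<bar>step_solution m x \<omega> - u x \<omega>\<bar>) \<partial>vol)" .
      qed
      also have "\<dots> = (\<integral>\<^sup>+\<omega>. min 1 (\<integral>\<^sup>+x. ennreal \<bar>step_solution n x \<omega> - step_solution m x \<omega>\<bar> \<partial>vol) \<partial>M) + ?e m"
        by (rule nn_integral_add) measurable
      also have "\<dots> \<le> c + ?e m" by (intro add_right_mono W m)
      finally show ?thesis .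
    qed
    have "(\<lambda>m. c + ?e m) \<longlonglongrightarrow> c + 0" by (intro tendsto_add tendsto_const truncated_limit)
    then show ?thesis using le by (intro LIMSEQ_le_const[of _ "c"]) auto
  qed
  define f where "f L \<omega> = (\<integral>\<^sup>+x. ennreal (min (real (Suc L)) \<bar>step_solution n x \<omega> - u x \<omega>\<bar>) \<partial>vol)" for L \<omega>
  have f_meas[measurable]: "f L \<in> borel_measurable M" for L unfolding f_def[abs_def] by measurable
  have f_mono: "f L \<omega> \<le> f L' \<omega>" if "L \<le> L'" for L L' \<omega>
    unfolding f_def using that by (intro nn_integral_mono ennreal_leI min.mono) auto
  have gap_SUP: "gap n \<omega> = (SUP L. f L \<omega>)" if \<omega>: "\<omega> \<in> space M" for \<omega>
  proof -
    have [measurable]: "(\<lambda>x. u x \<omega>) \<in> borel_measurable vol" "(\<lambda>x. step_solution n x \<omega>) \<in> borel_measurable vol"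
      using measurable_compose[OF measurable_Pair1'[OF \<omega>] u_measurable]
        measurable_compose[OF measurable_Pair1'[OF \<omega>] step_solution_measurable] by auto
    have "ennreal t = (SUP L. ennreal (min (real (Suc L)) t))" if t: "0 \<le> t" for t
    proof (rule antisym)
      obtain L where "t \<le> real L" using real_arch_simple by blast
      then have "min (real (Suc L)) t = t" by simp
      then show "ennreal t \<le> (SUP L. ennreal (min (real (Suc L)) t))" by (intro SUP_upper2[of L]) auto
      show "(SUP L. ennreal (min (real (Suc L)) t)) \<le> ennreal t" by (intro SUP_least ennreal_leI) simp
    qed
    note SUP_trunc = this
    have "gap n \<omega> = (\<integral>\<^sup>+x. (SUP L. ennreal (min (real (Suc L)) \<bar>step_solution n x \<omega> - u x \<omega>\<bar>)) \<partial>vol)"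
      unfolding gap_def by (intro nn_integral_cong SUP_trunc) (rule abs_ge_zero)
    also have "\<dots> = (SUP L. f L \<omega>)"
      unfolding f_def
      by (intro nn_integral_monotone_convergence_SUP) (auto simp: incseq_def le_fun_def intro!: ennreal_leI min.mono)
    finally show ?thesis .
  qed
  have "(\<integral>\<^sup>+\<omega>. min 1 (gap n \<omega>) \<partial>M) = (\<integral>\<^sup>+\<omega>. (SUP L. min 1 (f L \<omega>)) \<partial>M)"
    by (intro nn_integral_cong) (simp add: gap_SUP inf_min[symmetric] inf_SUP)
  also have "\<dots> = (SUP L. \<integral>\<^sup>+\<omega>. min 1 (f L \<omega>) \<partial>M)"
    by (intro nn_integral_monotone_convergence_SUP) (auto simp: incseq_def le_fun_def intro: min.coboundedI2 f_mono)
  also have "\<dots> \<le> c" using trunc by (intro SUP_least) (simp add: f_def)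
  finally show ?thesis .
qed

lemma gap_tendsto: "(\<lambda>n. \<integral>\<^sup>+\<omega>. min 1 (gap n \<omega>) \<partial>M) \<longlonglongrightarrow> 0"
proof (rule order_tendstoI)
  fix a :: ennreal assume a: "0 < a"
  obtain e :: real where e: "0 < e" "ennreal e < a"
    using a by (metis ennreal_less_zero_iff ennreal_neg ennreal_zero_less_top dense not_le less_le ennreal_cases neq_top_trans top.not_eq_extremum)
  have e2: "0 < e / 2" using e by simp
  obtain K where K: "\<And>n m. (\<integral>\<^sup>+\<omega>. min 1 (\<integral>\<^sup>+x. ennreal \<bar>step_solution n x \<omega> - step_solution m x \<omega>\<bar> \<partial>vol) \<partial>M)
    \<le> ennreal (e / 2) + ennreal K * (defect n + defect m)"
    using step_solution_Cauchy[OF e2] by blast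
  \<comment> \<open>Half of \<open>e\<close> is left for the defects,
    \<open>\<bar>K\<bar> * (r + r) \<le> e / 2\<close>. The absolute value is taken because the sign
    of \<open>K\<close> is not recorded, and the summand 1 keeps the denominator positive.\<close>
  define r where "r = e / (4 * (\<bar>K\<bar> + 1))"
  have r: "0 < r" using e by (simp add: r_def)
  have Kr: "\<bar>K\<bar> * (r + r) \<le> e / 2"
  proof -
    have "\<bar>K\<bar> * (r + r) \<le> (\<bar>K\<bar> + 1) * (r + r)" using r by (intro mult_right_mono) auto
    also have "\<dots> = e / 2"
    proof -
      have "k * (e / (4 * k)) = e / 4" if "k \<noteq> 0" for k using that by simp
      then have "(\<bar>K\<bar> + 1) * r = e / 4" unfolding r_def by (metis abs_ge_zero add_nonneg_eq_0_iff zero_le_one zero_neq_one)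
      then show ?thesis unfolding distrib_left[of "\<bar>K\<bar> + 1"] by linarith
    qed
    finally show ?thesis .
  qed
  obtain N where N: "\<And>n. n \<ge> N \<Longrightarrow> defect n < ennreal r"
    using order_tendstoD(2)[OF defect_tendsto, of "ennreal r"] r by (auto simp: eventually_sequentially)
  show "\<forall>\<^sub>F n in sequentially. (\<integral>\<^sup>+\<omega>. min 1 (gap n \<omega>) \<partial>M) < a"
    using eventually_ge_at_top[of N]
  proof eventually_elim
    case (elim n)
    have "(\<integral>\<^sup>+\<omega>. min 1 (gap n \<omega>) \<partial>M) \<le> ennreal e"
    proof (rule gap_bound)
      fix m assume m: "N \<le> m"
      have "ennreal K * (defect n + defect m) \<le> ennreal \<bar>K\<bar> * (ennreal r + ennreal r)"
        using N[OF elim] N[OF m] by (intro mult_mono add_mono ennreal_leI) auto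
      also have "\<dots> = ennreal \<bar>K\<bar> * ennreal (r + r)" using r by (simp only: ennreal_plus less_imp_le)
      also have "\<dots> = ennreal (\<bar>K\<bar> * (r + r))" using r by (intro ennreal_mult[symmetric]) auto
      also have "\<dots> \<le> ennreal (e / 2)" using Kr by (rule ennreal_leI)
      finally have "ennreal (e / 2) + ennreal K * (defect n + defect m) \<le> ennreal (e / 2) + ennreal (e / 2)"
        by (rule add_left_mono)
      also have "\<dots> = ennreal e" using e by (subst ennreal_plus[symmetric]) auto
      finally show "(\<integral>\<^sup>+\<omega>. min 1 (\<integral>\<^sup>+x. ennreal \<bar>step_solution n x \<omega> - step_solution m x \<omega>\<bar> \<partial>vol) \<partial>M) \<le> ennreal e"
        using K[of n m] by (rule order_trans[rotated])
    qed
    then show ?case using e by simp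
  qed
qed simp

lemma sections_measurable:
  assumes \<omega>: "\<omega> \<in> space M"
  shows "(\<lambda>x. u x \<omega>) \<in> borel_measurable vol" "(\<lambda>x. step_solution n x \<omega>) \<in> borel_measurable vol"
  using measurable_compose[OF measurable_Pair1'[OF \<omega>] u_measurable]
    measurable_compose[OF measurable_Pair1'[OF \<omega>] step_solution_measurable] by auto

lemma step_solution_integrable:
  assumes \<omega>: "\<omega> \<in> space M"
  shows "integrable vol (\<lambda>x. step_solution n x \<omega>)"
proof (rule vol.integrable_const_bound)
  show "AE x in vol. norm (step_solution n x \<omega>) \<le> (\<Sum>k\<le>n. \<bar>SI (grid_step k) D \<omega>\<bar>)"
  proof (rule AE_I2)
    fix x
    show "norm (step_solution n x \<omega>) \<le> (\<Sum>k\<le>n. \<bar>SI (grid_step k) D \<omega>\<bar>)"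
      unfolding step_solution_def real_norm_def using best_step_le[of n x]
      by (intro member_le_sum[of "best_step n x" "{..n}" "\<lambda>k. \<bar>SI (grid_step k) D \<omega>\<bar>"]) auto
  qed
qed (rule sections_measurable[OF \<omega>])

text \<open>Almost surely some \<open>gap n\<close> is below 1, since the probability that none is
  does not exceed any of the means of \<open>min 1 (gap n \<omega>)\<close>. For such an
  \<open>n\<close> the solution differs by an integrable function from one that is bounded in
  \<open>x\<close>.\<close>

lemma u_integrable: "AE \<omega> in M. integrable vol (\<lambda>x. u x \<omega>)"
proof -
  let ?bad = "{\<omega>\<in>space M. \<forall>n. 1 \<le> gap n \<omega>}"
  have "emeasure M ?bad \<le> (\<integral>\<^sup>+\<omega>. min 1 (gap n \<omega>) \<partial>M)" for n
  proof -
    have "emeasure M ?bad = (\<integral>\<^sup>+\<omega>. indicator ?bad \<omega> \<partial>M)" by simp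
    also have "\<dots> \<le> (\<integral>\<^sup>+\<omega>. min 1 (gap n \<omega>) \<partial>M)"
      by (intro nn_integral_mono) (auto simp: indicator_def)
    finally show ?thesis .
  qed
  then have "emeasure M ?bad \<le> 0" by (intro LIMSEQ_le_const[OF gap_tendsto]) auto
  then have "AE \<omega> in M. \<omega> \<notin> ?bad" by (intro AE_not_in null_setsI) auto
  then show ?thesis
  proof (rule AE_mp, intro AE_I2 impI)
    fix \<omega> assume \<omega>: "\<omega> \<in> space M" and "\<omega> \<notin> ?bad"
    then obtain n where n: "gap n \<omega> < 1" by (auto simp: not_le)
    note [measurable] = sections_measurable[OF \<omega>]
    have "integrable vol (\<lambda>x. step_solution n x \<omega> - u x \<omega>)"
      using n unfolding gap_def by (intro integrableI_bounded) (auto simp: order_less_trans[OF _ ennreal_one_less_top])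
    then have "integrable vol (\<lambda>x. step_solution n x \<omega> - (step_solution n x \<omega> - u x \<omega>))"
      by (rule Bochner_Integration.integrable_diff[OF step_solution_integrable[OF \<omega>]])
    moreover have "(\<lambda>x. step_solution n x \<omega> - (step_solution n x \<omega> - u x \<omega>)) = (\<lambda>x. u x \<omega>)" by (simp add: fun_eq_iff)
    ultimately show "integrable vol (\<lambda>x. u x \<omega>)" by (simp only:)
  qed
qed

section \<open>Pairing with a bounded weight\<close>

context
  fixes \<phi> :: "real^'d \<Rightarrow> real" and C :: real
  assumes \<phi>[measurable]: "\<phi> \<in> borel_measurable vol" and \<phi>_bd: "\<And>x. x \<in> D \<Longrightarrow> \<bar>\<phi> x\<bar> \<le> C"
begin

lemma integrable_mult_phi: "integrable vol f \<Longrightarrow> integrable vol (\<lambda>x. f x * \<phi> x)"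
proof -
  assume f: "integrable vol f"
  note [measurable] = borel_measurable_integrable[OF f]
  show ?thesis
  proof (rule Bochner_Integration.integrable_bound[where f = "\<lambda>x. C * f x"])
    show "AE x in vol. norm (f x * \<phi> x) \<le> norm (C * f x)"
    proof (rule AE_I2)
      fix x assume "x \<in> space vol"
      then have "\<bar>\<phi> x\<bar> \<le> \<bar>C\<bar>" using \<phi>_bd[of x] by simp
      then show "norm (f x * \<phi> x) \<le> norm (C * f x)"
        by (simp add: abs_mult mult.commute[of "\<bar>f x\<bar>"] mult_right_mono)
    qed
  qed (use f in auto)
qed

definition weighted :: "nat \<Rightarrow> real^'d \<Rightarrow> real" where
  "weighted n y = (LINT x|vol. grid_step (best_step n x) y * \<phi> x)"

definition coeff :: "nat \<Rightarrow> nat \<Rightarrow> real" where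
  "coeff n k = (LINT x|vol. indicator {k} (best_step n x) * \<phi> x)"

text \<open>At stage \<open>n\<close> the index takes finitely many values, so integration in
  \<open>x\<close> becomes a finite combination. The identity serves twice, with \<open>g k\<close>
  the value of a step function and with \<open>g k\<close> its stochastic integral.\<close>

lemma integral_indexed:
  fixes g :: "nat \<Rightarrow> real"
  shows "(LINT x|vol. g (best_step n x) * \<phi> x) = (\<Sum>k\<le>n. coeff n k * g k)"
proof -
  have eq: "g (best_step n x) * \<phi> x = (\<Sum>k\<le>n. g k * (indicator {k} (best_step n x) * \<phi> x))" for x
  proof -
    have "(\<Sum>k\<le>n. g k * (indicator {k} (best_step n x) * \<phi> x)) = (\<Sum>k\<le>n. if k = best_step n x then g k * \<phi> x else 0)"
      by (intro sum.cong refl) auto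
    then show ?thesis using best_step_le[of n x] by simp
  qed
  have int: "integrable vol (\<lambda>x. indicator {k} (best_step n x) * \<phi> x)" for k
  proof (rule integrable_mult_phi)
    have "(\<lambda>x. indicator {k} (best_step n x) :: real) \<in> borel_measurable vol"
      by (rule measurable_compose[OF best_step_measurable]) simp
    then show "integrable vol (\<lambda>x. indicator {k} (best_step n x) :: real)"
      by (intro vol.integrable_const_bound[where B = 1]) auto
  qed
  show ?thesis unfolding eq coeff_def using int
    by (subst Bochner_Integration.integral_sum) (auto simp: mult.commute)
qed

lemma weighted_eq: "weighted n y = (\<Sum>k\<le>n. coeff n k * grid_step k y)"
  unfolding weighted_def by (rule integral_indexed)

lemma weighted_simple: "simple_function vol (weighted n)"
  unfolding weighted_eq[abs_def]
  by (intro simple_function_sum simple_function_mult simple_function_const grid_step_simple)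

text \<open>For a step kernel the interchange of the two integrals is an exchange of finite sums,
  outside the null sets on which simple integrals fail to be linear.\<close>

lemma integral_step_solution_eq: "AE \<omega> in M. (LINT x|vol. step_solution n x \<omega> * \<phi> x) = SI (weighted n) D \<omega>"
proof -
  define V :: "real^'d \<Rightarrow> real list" where "V y = map (\<lambda>k. grid_step k y) [0..<Suc n]" for y
  have V: "simple_function vol V" unfolding V_def[abs_def] by (rule simple_function_list)
  have Vk: "V y ! k = grid_step k y" if "k \<le> n" for k y
    unfolding V_def using that by (subst nth_map) (auto simp del: upt_Suc)
  have "AE \<omega> in M. \<forall>k\<in>{..n}. SI (grid_step k) D \<omega>
      = (\<Sum>l\<in>V ` D. l ! k * \<xi> (cell V l) \<omega>)"
    by (intro AE_finite_allI simple_stoch_integral_rep[OF V D_in_vol]) (auto simp: Vk)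
  moreover have "AE \<omega> in M. SI (weighted n) D \<omega>
      = (\<Sum>l\<in>V ` D. (\<Sum>k\<le>n. coeff n k * l ! k) * \<xi> (cell V l) \<omega>)"
    by (rule simple_stoch_integral_rep[OF V D_in_vol]) (simp add: weighted_eq Vk)
  ultimately show ?thesis
  proof eventually_elim
    case (elim \<omega>)
    have "(LINT x|vol. step_solution n x \<omega> * \<phi> x) = (\<Sum>k\<le>n. coeff n k * SI (grid_step k) D \<omega>)"
      unfolding step_solution_def by (rule integral_indexed)
    also have "\<dots> = (\<Sum>k\<le>n. \<Sum>l\<in>V ` D. coeff n k * l ! k * \<xi> (cell V l) \<omega>)"
      using elim(1) by (simp add: sum_distrib_left mult.assoc)
    also have "\<dots> = SI (weighted n) D \<omega>"
      unfolding elim(2) by (subst sum.swap) (simp add: sum_distrib_right)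
    finally show ?case .
  qed
qed

text \<open>Integration runs over the first argument of the kernel, so this is the operator with the
  transposed kernel.\<close>

definition potential :: "real^'d \<Rightarrow> real" where "potential y = (LINT x|vol. G x y * \<phi> x)"

lemma potential_measurable [measurable]: "potential \<in> borel_measurable vol"
proof -
  have [measurable]: "(\<lambda>(y, x). G x y) \<in> borel_measurable (vol \<Otimes>\<^sub>M vol)"
    by (subst measurable_pair_swap_iff) measurable
  show ?thesis unfolding potential_def[abs_def] by measurable
qed

lemma kernel_step_measurable [measurable]:
  "(\<lambda>(x, y). G x y - grid_step (best_step n x) y) \<in> borel_measurable (vol \<Otimes>\<^sub>M vol)"
proof -
  have "(\<lambda>z. grid_step (best_step n (fst z)) (snd z)) \<in> borel_measurable (vol \<Otimes>\<^sub>M vol)"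
    by (rule measurable_compose_countable[where f = "\<lambda>i z. grid_step i (snd z)" and g = "\<lambda>z. best_step n (fst z)"]) measurable
  then show ?thesis using G unfolding split_beta' by measurable
qed

text \<open>For fixed \<open>y\<close> the power is moved inside the integral over \<open>x\<close>
  by \<open>powr_integral_le\<close>; after integration over \<open>y\<close>, Tonelli recognises
  the defect.\<close>

lemma potential_approx:
  "Nq (\<lambda>y. potential y - weighted n y) \<le> ennreal ((measure vol D + 1) powr q * \<bar>C\<bar> powr q) * defect n"
proof -
  interpret P: pair_sigma_finite vol vol ..
  let ?g = "\<lambda>x y. G x y - grid_step (best_step n x) y"
  let ?c = "ennreal ((measure vol D + 1) powr q * \<bar>C\<bar> powr q)"
  have swap: "(\<integral>\<^sup>+y. \<integral>\<^sup>+x. ennreal (\<bar>?g x y\<bar> powr q) \<partial>vol \<partial>vol) = defect n"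
    unfolding defect_def step_dist_def Nq_def
    by (rule P.Fubini') (use kernel_step_measurable in measurable)
  have sec: "(\<lambda>x. ?g x y) \<in> borel_measurable vol" if "y \<in> D" for y
    using measurable_compose[OF measurable_Pair2'[of y vol vol] kernel_step_measurable[of n]] that by simp
  have [measurable]: "(\<lambda>y. \<integral>\<^sup>+x. ennreal (\<bar>?g x y\<bar> powr q) \<partial>vol) \<in> borel_measurable vol"
  proof -
    have "(\<lambda>(y, x). ?g x y) \<in> borel_measurable (vol \<Otimes>\<^sub>M vol)"
      by (subst measurable_pair_swap_iff) (use kernel_step_measurable in \<open>simp add: split_beta'\<close>)
    then show ?thesis by measurable
  qed
  \<comment> \<open>The bound on the kernel concerns the sections \<open>G x\<close>. In the other
    variable integrability is drawn from the finite defect, and holds for almost every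
    \<open>y\<close>.\<close>
  have "AE y in vol. (\<integral>\<^sup>+x. ennreal (\<bar>?g x y\<bar> powr q) \<partial>vol) \<noteq> \<infinity>"
    using swap defect_finite[of n] by (intro nn_integral_PInf_AE) auto
  then have "AE y in vol. ennreal (\<bar>potential y - weighted n y\<bar> powr q) \<le> ?c * (\<integral>\<^sup>+x. ennreal (\<bar>?g x y\<bar> powr q) \<partial>vol)"
  proof (rule AE_mp, intro AE_I2 impI)
    fix y assume "y \<in> space vol" and fin: "(\<integral>\<^sup>+x. ennreal (\<bar>?g x y\<bar> powr q) \<partial>vol) \<noteq> \<infinity>"
    then have y: "y \<in> D" by simp
    note [measurable] = sec[OF y]
    have int: "integrable vol (\<lambda>x. ?g x y)"
      using fin by (intro integrable_of_powr) (auto simp: less_top[symmetric])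
    have int_s: "integrable vol (\<lambda>x. grid_step (best_step n x) y)"
    proof (rule vol.integrable_const_bound)
      show "AE x in vol. norm (grid_step (best_step n x) y) \<le> (\<Sum>k\<le>n. \<bar>grid_step k y\<bar>)"
        using best_step_le by (intro AE_I2) (auto intro!: member_le_sum[of "best_step n _" "{..n}" "\<lambda>k. \<bar>grid_step k y\<bar>"])
      show "(\<lambda>x. grid_step (best_step n x) y) \<in> borel_measurable vol"
        by (rule measurable_compose[OF best_step_measurable]) simp
    qed
    have int_G: "integrable vol (\<lambda>x. G x y)"
      using Bochner_Integration.integrable_add[OF int int_s] by simp
    have "potential y - weighted n y = (LINT x|vol. ?g x y * \<phi> x)"
      unfolding potential_def weighted_def left_diff_distrib
      by (rule Bochner_Integration.integral_diff[symmetric]) (intro integrable_mult_phi int_G int_s)+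
    then have "ennreal (\<bar>potential y - weighted n y\<bar> powr q)
        \<le> ennreal ((measure vol D + 1) powr q) * (\<integral>\<^sup>+x. ennreal (\<bar>?g x y * \<phi> x\<bar> powr q) \<partial>vol)"
      using powr_integral_le[of "\<lambda>x. ?g x y * \<phi> x"] by simp
    also have "(\<integral>\<^sup>+x. ennreal (\<bar>?g x y * \<phi> x\<bar> powr q) \<partial>vol) \<le> (\<integral>\<^sup>+x. ennreal (\<bar>C\<bar> powr q) * ennreal (\<bar>?g x y\<bar> powr q) \<partial>vol)"
    proof (rule nn_integral_mono)
      fix x assume "x \<in> space vol"
      then have "\<bar>\<phi> x\<bar> \<le> \<bar>C\<bar>" using \<phi>_bd[of x] by simp
      then have "\<bar>?g x y * \<phi> x\<bar> \<le> \<bar>C\<bar> * \<bar>?g x y\<bar>"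
        by (simp add: abs_mult mult.commute[of _ "\<bar>\<phi> x\<bar>"] mult_right_mono)
      then have "\<bar>?g x y * \<phi> x\<bar> powr q \<le> (\<bar>C\<bar> * \<bar>?g x y\<bar>) powr q" using q by (intro powr_mono2) auto
      also have "\<dots> = \<bar>C\<bar> powr q * \<bar>?g x y\<bar> powr q" by (rule powr_mult)
      finally show "ennreal (\<bar>?g x y * \<phi> x\<bar> powr q) \<le> ennreal (\<bar>C\<bar> powr q) * ennreal (\<bar>?g x y\<bar> powr q)"
        by (simp add: ennreal_mult[symmetric] ennreal_leI)
    qed
    also have "\<dots> = ennreal (\<bar>C\<bar> powr q) * (\<integral>\<^sup>+x. ennreal (\<bar>?g x y\<bar> powr q) \<partial>vol)"
      by (rule nn_integral_cmult) measurable
    finally show "ennreal (\<bar>potential y - weighted n y\<bar> powr q) \<le> ?c * (\<integral>\<^sup>+x. ennreal (\<bar>?g x y\<bar> powr q) \<partial>vol)"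
      by (simp add: ennreal_mult mult.assoc mult_left_mono)
  qed
  then have "Nq (\<lambda>y. potential y - weighted n y) \<le> (\<integral>\<^sup>+y. ?c * (\<integral>\<^sup>+x. ennreal (\<bar>?g x y\<bar> powr q) \<partial>vol) \<partial>vol)"
    unfolding Nq_def by (rule nn_integral_mono_AE)
  also have "\<dots> = ?c * defect n" unfolding swap[symmetric] by (rule nn_integral_cmult) measurable
  finally show ?thesis .
qed

text \<open>The pairings of the approximate solutions with the weight have two limits in
  probability: the stochastic integral of the potential, through the \<open>L^q\<close>
  approximation, and the pairing of \<open>u\<close> itself, through the gap. They agree almost
  surely, so the latter is a version of the former.\<close>

lemma stochastic_Fubini:
  "(AE \<omega> in M. integrable vol (\<lambda>x. u x \<omega> * \<phi> x)) \<and>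
   has_stoch_integral M D \<xi> potential (\<lambda>\<omega>. LINT x|vol. u x \<omega> * \<phi> x)"
proof
  show "AE \<omega> in M. integrable vol (\<lambda>x. u x \<omega> * \<phi> x)"
    using u_integrable by eventually_elim (rule integrable_mult_phi)
  have wm[measurable]: "weighted n \<in> borel_measurable vol" for n
    using weighted_simple by (rule borel_measurable_simple_function)
  let ?c = "ennreal ((measure vol D + 1) powr q * \<bar>C\<bar> powr q)"
  have approx: "(\<lambda>n. Nq (\<lambda>y. potential y - weighted n y)) \<longlonglongrightarrow> 0"
  proof (rule tendsto_sandwich[OF _ _ tendsto_const])
    have "(\<lambda>n. ?c * defect n) \<longlonglongrightarrow> ?c * 0" by (intro ennreal_tendsto_cmult defect_tendsto) simp
    then show "(\<lambda>n. ?c * defect n) \<longlonglongrightarrow> 0" by simp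
    show "\<forall>\<^sub>F n in sequentially. Nq (\<lambda>y. potential y - weighted n y) \<le> ?c * defect n"
      using potential_approx by simp
  qed auto
  have fin: "Nq potential < \<infinity>"
  proof -
    have w: "Nq (\<lambda>y. weighted 0 y - 0) < \<infinity>"
    proof (rule Nq_bounded_finite)
      show "\<bar>weighted 0 y - 0\<bar> \<le> Max (abs ` weighted 0 ` D)" if "y \<in> D" for y
        using simple_finite[OF weighted_simple, of 0] that by (intro Max_ge) auto
    qed
    have "Nq (\<lambda>y. potential y - 0) \<le> 4 * (Nq (\<lambda>y. potential y - weighted 0 y) + Nq (\<lambda>y. weighted 0 y - 0))"
      by (rule Nq_triangle) auto
    also have "\<dots> \<le> 4 * (?c * defect 0 + Nq (\<lambda>y. weighted 0 y - 0))"
      by (intro mult_left_mono add_right_mono potential_approx) auto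
    also have "\<dots> < \<infinity>" using w defect_finite[of 0] by (simp add: ennreal_mult_less_top)
    finally show ?thesis by simp
  qed
  obtain Y where Y: "has_stoch_integral M D \<xi> potential Y"
    using ex_has_stoch_integral[OF potential_measurable fin] by blast
  have YM[measurable]: "Y \<in> borel_measurable M" using Y by (auto simp: has_stoch_integral_def tendsto_in_prob_def)
  let ?I = "\<lambda>\<omega>. LINT x|vol. u x \<omega> * \<phi> x"
  let ?J = "\<lambda>n \<omega>. LINT x|vol. step_solution n x \<omega> * \<phi> x"
  have Im[measurable]: "?I \<in> borel_measurable M" and Jm[measurable]: "?J n \<in> borel_measurable M" for n
    by measurable
  have 1: "tendsto_in_prob M ?J Y"
  proof (rule tendsto_in_prob_AE_cong)
    show "tendsto_in_prob M (\<lambda>n. SI (weighted n) D) Y"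
      by (rule simple_integrals_tendsto[OF potential_measurable fin Y weighted_simple approx])
    show "AE \<omega> in M. SI (weighted n) D \<omega> = ?J n \<omega>" for n
      using integral_step_solution_eq[of n] by (auto elim: eventually_mono)
  qed (auto intro: YM Jm)
  have 2: "tendsto_in_prob M ?J ?I"
  proof (subst tendsto_in_prob_iff)
    \<comment> \<open>The maximum with 1 lets the factor be pulled out of the truncation: for
      nonnegative \<open>c\<close> and \<open>t\<close>, \<open>min 1 (c * t)\<close> is at most
      \<open>max 1 c * min 1 t\<close>.\<close>
    let ?C = "ennreal (max 1 \<bar>C\<bar>)"
    have "(\<lambda>n. ?C * (\<integral>\<^sup>+\<omega>. min 1 (gap n \<omega>) \<partial>M)) \<longlonglongrightarrow> ?C * 0"
      by (intro ennreal_tendsto_cmult gap_tendsto) simp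
    then have lim: "(\<lambda>n. ?C * (\<integral>\<^sup>+\<omega>. min 1 (gap n \<omega>) \<partial>M)) \<longlonglongrightarrow> 0" by simp
    show "(\<lambda>n. prob_size (\<lambda>\<omega>. ?J n \<omega> - ?I \<omega>)) \<longlonglongrightarrow> 0"
    proof (rule tendsto_sandwich[OF _ _ tendsto_const lim])
      have "prob_size (\<lambda>\<omega>. ?J n \<omega> - ?I \<omega>) \<le> ?C * (\<integral>\<^sup>+\<omega>. min 1 (gap n \<omega>) \<partial>M)" for n
      proof -
        have "AE \<omega> in M. ennreal (min 1 \<bar>?J n \<omega> - ?I \<omega>\<bar>) \<le> ?C * min 1 (gap n \<omega>)"
          using u_integrable
        proof (rule AE_mp, intro AE_I2 impI)
          fix \<omega> assume \<omega>: "\<omega> \<in> space M" and u: "integrable vol (\<lambda>x. u x \<omega>)"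
          note [measurable] = sections_measurable[OF \<omega>]
          note vi = step_solution_integrable[OF \<omega>, of n]
          have "?J n \<omega> - ?I \<omega> = (LINT x|vol. (step_solution n x \<omega> - u x \<omega>) * \<phi> x)"
            unfolding left_diff_distrib
            by (rule Bochner_Integration.integral_diff[symmetric]) (intro integrable_mult_phi vi u)+
          then have "ennreal \<bar>?J n \<omega> - ?I \<omega>\<bar> \<le> (\<integral>\<^sup>+x. ennreal (norm ((step_solution n x \<omega> - u x \<omega>) * \<phi> x)) \<partial>vol)"
            using integral_norm_bound_ennreal[OF integrable_mult_phi[OF Bochner_Integration.integrable_diff[OF vi u]]] by simp
          also have "\<dots> \<le> (\<integral>\<^sup>+x. ?C * ennreal \<bar>step_solution n x \<omega> - u x \<omega>\<bar> \<partial>vol)"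
          proof (rule nn_integral_mono)
            fix x assume "x \<in> space vol"
            then have "\<bar>\<phi> x\<bar> \<le> max 1 \<bar>C\<bar>" using \<phi>_bd[of x] by auto
            then have "\<bar>step_solution n x \<omega> - u x \<omega>\<bar> * \<bar>\<phi> x\<bar> \<le> \<bar>step_solution n x \<omega> - u x \<omega>\<bar> * max 1 \<bar>C\<bar>" by (intro mult_left_mono) auto
            then show "ennreal (norm ((step_solution n x \<omega> - u x \<omega>) * \<phi> x)) \<le> ?C * ennreal \<bar>step_solution n x \<omega> - u x \<omega>\<bar>"
              by (subst ennreal_mult[symmetric]) (auto simp: abs_mult mult.commute intro!: ennreal_leI)
          qed
          also have "\<dots> = ?C * gap n \<omega>" unfolding gap_def by (rule nn_integral_cmult) measurable
          finally have le: "ennreal \<bar>?J n \<omega> - ?I \<omega>\<bar> \<le> ?C * gap n \<omega>" .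
          show "ennreal (min 1 \<bar>?J n \<omega> - ?I \<omega>\<bar>) \<le> ?C * min 1 (gap n \<omega>)"
          proof (cases "gap n \<omega> \<le> 1")
            case True
            have "ennreal (min 1 \<bar>?J n \<omega> - ?I \<omega>\<bar>) \<le> ennreal \<bar>?J n \<omega> - ?I \<omega>\<bar>" by (intro ennreal_leI) simp
            also note le
            finally show ?thesis using True by (simp add: min_absorb2)
          next
            case False
            have "ennreal (min 1 \<bar>?J n \<omega> - ?I \<omega>\<bar>) \<le> ennreal (max 1 \<bar>C\<bar>)" by (intro ennreal_leI) simp
            then show ?thesis using False by (simp add: min_absorb1)
          qed
        qed
        then have "prob_size (\<lambda>\<omega>. ?J n \<omega> - ?I \<omega>) \<le> (\<integral>\<^sup>+\<omega>. ?C * min 1 (gap n \<omega>) \<partial>M)"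
          unfolding prob_size_def by (rule nn_integral_mono_AE)
        also have "\<dots> = ?C * (\<integral>\<^sup>+\<omega>. min 1 (gap n \<omega>) \<partial>M)" by (rule nn_integral_cmult) measurable
        finally show ?thesis .
      qed
      then show "\<forall>\<^sub>F n in sequentially. prob_size (\<lambda>\<omega>. ?J n \<omega> - ?I \<omega>) \<le> ?C * (\<integral>\<^sup>+\<omega>. min 1 (gap n \<omega>) \<partial>M)" by simp
    qed auto
  qed (rule Jm Im)+
  show "has_stoch_integral M D \<xi> potential ?I"
    by (rule has_stoch_integral_AE_cong[OF Y tendsto_in_prob_unique[OF 1 2] Im _ potential_measurable]) simp
qed

end

end

end

end

section \<open>Conclusion\<close>

context bounded_noise
begin

lemma integral_vol: "(LINT x|vol. f x) = (LINT x:D|lborel. f x)" for f :: "real^'d \<Rightarrow> real"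
  using D_borel unfolding vol_def set_lebesgue_integral_def by (intro integral_restrict_space) simp

lemma integrable_vol: "integrable vol f \<longleftrightarrow> set_integrable lborel D f" for f :: "real^'d \<Rightarrow> real"
  using D_borel unfolding vol_def set_integrable_def by (intro integrable_restrict_space) simp

lemma pair_measurable_vol:
  assumes "f \<in> borel_measurable (restrict_space borel (D \<times> D))"
  shows "f \<in> borel_measurable (vol \<Otimes>\<^sub>M vol)"
proof -
  have id: "(\<lambda>x. x) \<in> measurable vol borel"
    unfolding measurable_vol_iff by (rule measurable_restrict_space1) simp
  have "(\<lambda>z. (fst z, snd z)) \<in> measurable (vol \<Otimes>\<^sub>M vol) (borel \<Otimes>\<^sub>M borel)"
    by (intro measurable_Pair measurable_compose[OF measurable_fst id] measurable_compose[OF measurable_snd id])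
  then have "(\<lambda>z. z) \<in> measurable (vol \<Otimes>\<^sub>M vol) (restrict_space borel (D \<times> D))"
    by (intro measurable_restrict_space2) (auto simp: space_pair_measure borel_prod)
  from measurable_compose[OF this assms] show ?thesis .
qed

text \<open>The stochastic Fubini theorem yields the transposed kernel. If the kernel is symmetric,
  both potentials agree almost everywhere, and a stochastic integral is insensitive to changes of
  the integrand on a null set.\<close>

lemma generalized_solution_of_mild:
  fixes G :: "real^'d \<Rightarrow> real^'d \<Rightarrow> real" and u :: "real^'d \<Rightarrow> 'w \<Rightarrow> real"
  assumes G[measurable]: "(\<lambda>(x, y). G x y) \<in> borel_measurable (vol \<Otimes>\<^sub>M vol)"
    and B: "\<And>x. x \<in> D \<Longrightarrow> Nq (G x) \<le> ennreal B" and mild: "mild_solution M D G \<xi> u"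
  shows "generalized_solution M D (green_op D (\<lambda>x y. G y x)) \<xi> u"
    and "symmetric_kernel D G \<Longrightarrow> generalized_solution M D (green_op D G) \<xi> u"
proof -
  have main: "(AE \<omega> in M. set_integrable lborel D (\<lambda>x. u x \<omega> * \<phi> x)) \<and>
      has_stoch_integral M D \<xi> (green_op D (\<lambda>x y. G y x) \<phi>) (\<lambda>\<omega>. LINT x:D|lborel. u x \<omega> * \<phi> x)"
    and \<phi>_meas: "\<phi> \<in> borel_measurable vol" if \<phi>: "test_function D \<phi>" for \<phi>
  proof -
    have "Ck_on 0 UNIV \<phi>" using \<phi> unfolding test_function_def smooth_on_def by blast
    then have cont: "continuous_on UNIV \<phi>" by simp
    show m: "\<phi> \<in> borel_measurable vol"
      by (intro borel_measurable_vol borel_measurable_continuous_onI cont)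
    have "compact (\<phi> ` closure D)"
      using D_bounded by (intro compact_continuous_image continuous_on_subset[OF cont]) (auto simp: compact_closure)
    then obtain C where C: "\<And>t. t \<in> \<phi> ` closure D \<Longrightarrow> norm t \<le> C"
      using compact_imp_bounded bounded_iff by metis
    have bd: "\<bar>\<phi> x\<bar> \<le> C" if "x \<in> D" for x
      using C[of "\<phi> x"] that closure_subset[of D] by auto
    have "green_op D (\<lambda>x y. G y x) \<phi> = potential G \<phi>"
      by (simp add: fun_eq_iff green_op_def potential_def[OF G B mild m bd] integral_vol)
    then show "(AE \<omega> in M. set_integrable lborel D (\<lambda>x. u x \<omega> * \<phi> x)) \<and>
      has_stoch_integral M D \<xi> (green_op D (\<lambda>x y. G y x) \<phi>) (\<lambda>\<omega>. LINT x:D|lborel. u x \<omega> * \<phi> x)"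
      using stochastic_Fubini[OF G B mild m bd] by (simp add: integrable_vol integral_vol)
  qed
  then show "generalized_solution M D (green_op D (\<lambda>x y. G y x)) \<xi> u"
    unfolding generalized_solution_def by blast
  assume sym: "symmetric_kernel D G"
  \<comment> \<open>Symmetry holds off a null set of the product; Fubini passes to almost every
    section, which is what the integral over \<open>y\<close> needs.\<close>
  have "AE z in lborel \<Otimes>\<^sub>M lborel. fst z \<in> D \<and> snd z \<in> D \<longrightarrow> G (fst z) (snd z) = G (snd z) (fst z)"
    using sym unfolding symmetric_kernel_def lborel_prod by (simp add: split_beta')
  from lborel_pair.AE_pair[OF this] have "AE x in lborel. AE y in lborel. x \<in> D \<and> y \<in> D \<longrightarrow> G x y = G y x"
    by simp
  then have "AE x in lborel. x \<in> D \<longrightarrow> (AE y in vol. G x y = G y x)"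
    by eventually_elim (auto simp: AE_vol_iff[symmetric] elim: eventually_mono)
  then have ae: "AE x in vol. AE y in vol. G x y = G y x" by (simp add: AE_vol_iff)
  have "has_stoch_integral M D \<xi> (green_op D G \<phi>) (\<lambda>\<omega>. LINT x:D|lborel. u x \<omega> * \<phi> x)" if \<phi>: "test_function D \<phi>" for \<phi>
  proof (rule has_stoch_integral_AE_cong)
    note [measurable] = \<phi>_meas[OF \<phi>]
    show H: "has_stoch_integral M D \<xi> (green_op D (\<lambda>x y. G y x) \<phi>) (\<lambda>\<omega>. LINT x:D|lborel. u x \<omega> * \<phi> x)"
      by (rule conjunct2[OF main[OF \<phi>]])
    then show "(\<lambda>\<omega>. LINT x:D|lborel. u x \<omega> * \<phi> x) \<in> borel_measurable M"
      unfolding has_stoch_integral_def tendsto_in_prob_def by blast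
    show "green_op D G \<phi> \<in> borel_measurable vol"
    proof -
      have "(\<lambda>(x, y). G x y * \<phi> y) \<in> borel_measurable (vol \<Otimes>\<^sub>M vol)"
        using G unfolding split_beta'
        by (rule borel_measurable_times[OF _ measurable_compose[OF measurable_snd \<phi>_meas[OF \<phi>]]])
      then have "(\<lambda>x. LINT y|vol. G x y * \<phi> y) \<in> borel_measurable vol"
        by (rule vol.borel_measurable_lebesgue_integral)
      then show ?thesis unfolding green_op_def[abs_def] integral_vol .
    qed
    show "AE x in vol. green_op D (\<lambda>x y. G y x) \<phi> x = green_op D G \<phi> x"
      using ae
    proof (rule AE_mp, intro AE_I2 impI)
      fix x assume x: "x \<in> space vol" and eq: "AE y in vol. G x y = G y x"
      have sections: "(\<lambda>y. G x y) \<in> borel_measurable vol" "(\<lambda>y. G y x) \<in> borel_measurable vol"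
        using measurable_compose[OF measurable_Pair1'[OF x] G] measurable_compose[OF measurable_Pair2'[OF x] G]
        by (simp_all only: prod.case)
      have "(LINT y|vol. G y x * \<phi> y) = (LINT y|vol. G x y * \<phi> y)"
      proof (rule integral_cong_AE)
        show "AE y in vol. G y x * \<phi> y = G x y * \<phi> y" using eq by eventually_elim simp
      qed (intro borel_measurable_times sections \<phi>_meas[OF \<phi>])+
      then show "green_op D (\<lambda>x y. G y x) \<phi> x = green_op D G \<phi> x"
        unfolding green_op_def integral_vol .
    qed
  qed simp
  with main show "generalized_solution M D (green_op D G) \<xi> u"
    unfolding generalized_solution_def by blast
qed

text \<open>Positivity turns the one-sided bound into one for \<open>\<bar>G x y\<bar>\<close>, and
  the diagonal, where nothing is assumed, is a null set in each section. The \<open>q\<close>-th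
  power has singularity exponent \<open>\<alpha> * q\<close>, which has to stay below the
  dimension.\<close>

lemma Nq_kernel_bound:
  assumes \<alpha>: "0 \<le> \<alpha>" "\<alpha> * q < real CARD('d)" and K: "0 \<le> K"
    and nonneg: "\<And>x y. x \<in> D \<Longrightarrow> y \<in> D \<Longrightarrow> x \<noteq> y \<Longrightarrow> 0 \<le> G x y"
    and bd: "\<And>x y. x \<in> D \<Longrightarrow> y \<in> D \<Longrightarrow> x \<noteq> y \<Longrightarrow> G x y \<le> K * norm (x - y) powr (- \<alpha>)"
  shows "\<exists>B. \<forall>x\<in>D. Nq (G x) \<le> ennreal B"
proof -
  obtain S where S: "0 \<le> S" "\<And>x. x \<in> D \<Longrightarrow> (\<integral>\<^sup>+y\<in>D. ennreal (norm (x - y) powr (- (\<alpha> * q))) \<partial>lborel) \<le> ennreal S"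
  proof -
    have "0 \<le> \<alpha> * q" using \<alpha> q by simp
    from singular_integral_bound[OF D_bounded D_borel this \<alpha>(2)] show thesis using that by blast
  qed
  have "Nq (G x) \<le> ennreal (K powr q * S)" if x: "x \<in> D" for x
  proof -
    have meas: "(\<lambda>y. norm (x - y) powr (- (\<alpha> * q))) \<in> borel_measurable vol"
      by (intro borel_measurable_vol) measurable
    have "AE y in lborel. y \<noteq> x" by (rule AE_lborel_singleton)
    then have "AE y in vol. y \<noteq> x" by (subst AE_vol_iff[symmetric]) (auto elim: eventually_mono)
    then have "AE y in vol. ennreal (\<bar>G x y\<bar> powr q) \<le> ennreal (K powr q) * ennreal (norm (x - y) powr (- (\<alpha> * q)))"
    proof (rule AE_mp, intro AE_I2 impI)
      fix y assume "y \<in> space vol" and ne: "y \<noteq> x"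
      then have y: "y \<in> D" by simp
      have "\<bar>G x y\<bar> \<le> K * norm (x - y) powr (- \<alpha>)" using nonneg[OF x y] bd[OF x y] ne by auto
      then have "\<bar>G x y\<bar> powr q \<le> (K * norm (x - y) powr (- \<alpha>)) powr q" using q by (intro powr_mono2) auto
      also have "\<dots> = K powr q * norm (x - y) powr (- (\<alpha> * q))" using K by (simp add: powr_mult powr_powr)
      finally show "ennreal (\<bar>G x y\<bar> powr q) \<le> ennreal (K powr q) * ennreal (norm (x - y) powr (- (\<alpha> * q)))"
        by (simp add: ennreal_mult[symmetric] ennreal_leI)
    qed
    then have "Nq (G x) \<le> (\<integral>\<^sup>+y. ennreal (K powr q) * ennreal (norm (x - y) powr (- (\<alpha> * q))) \<partial>vol)"
      unfolding Nq_def by (rule nn_integral_mono_AE)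
    also have "\<dots> = ennreal (K powr q) * (\<integral>\<^sup>+y. ennreal (norm (x - y) powr (- (\<alpha> * q))) \<partial>vol)"
      by (rule nn_integral_cmult[OF measurable_compose[OF meas measurable_ennreal]])
    also have "(\<integral>\<^sup>+y. ennreal (norm (x - y) powr (- (\<alpha> * q))) \<partial>vol) = (\<integral>\<^sup>+y\<in>D. ennreal (norm (x - y) powr (- (\<alpha> * q))) \<partial>lborel)"
      using D_borel unfolding vol_def by (intro nn_integral_restrict_space) simp
    also have "ennreal (K powr q) * \<dots> \<le> ennreal (K powr q) * ennreal S" by (intro mult_left_mono S x) simp
    also have "\<dots> = ennreal (K powr q * S)" using S by (simp add: ennreal_mult)
    finally show ?thesis .
  qed
  then show ?thesis by blast
qed

end

text \<open>There are two regimes. With \<open>q = 2\<close> one frequency per truncation level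
  bounds the moment whatever the growth of the exponent, Gaussian part included. With
  \<open>q < 2\<close> the exponent may grow only like a power \<open>p < q\<close>, which a
  Gaussian part would violate.\<close>

lemma levy_noise_bounded_noise:
  fixes M :: "'w measure" and D :: "(real^'d) set"
  assumes prob: "prob_space M" and D: "open D" "bounded D"
    and noise: "symmetric_levy_white_noise M D b \<sigma> \<nu> \<xi>"
    and q: "q = 2 \<or> (\<sigma> = 0 \<and> 1 \<le> q \<and> q \<le> 2 \<and>
      (\<exists>p. 0 < p \<and> p < q \<and> (\<integral>\<^sup>+ z. ennreal (\<bar>z\<bar> powr p) * indicator {z. \<bar>z\<bar> \<le> 1} z \<partial>\<nu>) < \<infinity>))"
  shows "bounded_noise M D \<xi> b (levy_psi \<sigma> \<nu>) q"
proof -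
  interpret prob_space M by (rule prob)
  have levy: "symmetric_levy_measure \<nu>" and scat: "independently_scattered M D \<xi>"
    and cf: "\<And>A u. A \<in> sets (restrict_space borel D) \<Longrightarrow>
        (CLINT \<omega>|M. exp (\<i> * complex_of_real (u * \<xi> A \<omega>)))
          = exp (complex_of_real (measure lborel A) * levy_exponent b \<sigma> \<nu> u)"
    using noise unfolding symmetric_levy_white_noise_def by auto
  interpret S: symmetric_noise M D \<xi> b "levy_psi \<sigma> \<nu>"
  proof
    show "emeasure lborel D < \<infinity>" using emeasure_bounded_finite[OF D(2)] by simp
    show "levy_psi \<sigma> \<nu> (- u) = levy_psi \<sigma> \<nu> u" for u by (simp add: levy_psi_def)
  qed (use D scat levy_psi_nonneg[OF levy] levy_psi_0[OF levy] continuous_levy_psi[OF levy] cf levy_exponent_eq[OF levy] in auto)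
  have mom: "\<exists>K\<ge>0. \<forall>A\<in>sets (restrict_space borel D).
      (\<integral>\<^sup>+\<omega>. ennreal (\<bar>\<xi> A \<omega> - b * measure lborel A\<bar> powr q) * indicator {..R} \<bar>\<xi> A \<omega> - b * measure lborel A\<bar> \<partial>M)
        \<le> ennreal (K * measure lborel A)" if R: "0 < R" for R
  proof -
    have cos: "expectation (\<lambda>\<omega>. 1 - cos (u * S.\<eta> A \<omega>)) \<le> measure lborel A * levy_psi \<sigma> \<nu> u"
      if "A \<in> sets S.vol" for A u
      using S.one_minus_cos_eta_le[OF that] S.measure_vol[OF that] by simp
    have "\<exists>K\<ge>0. \<forall>A\<in>sets S.vol. (\<integral>\<^sup>+\<omega>. ennreal (\<bar>S.\<eta> A \<omega>\<bar> powr q) * indicator {..R} \<bar>S.\<eta> A \<omega>\<bar> \<partial>M)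
        \<le> ennreal (K * measure lborel A)"
    proof (cases "q = 2")
      case True
      have "(\<integral>\<^sup>+\<omega>. ennreal (\<bar>S.\<eta> A \<omega>\<bar> powr 2) * indicator {..R} \<bar>S.\<eta> A \<omega>\<bar> \<partial>M)
          \<le> ennreal (4 * R\<^sup>2 * levy_psi \<sigma> \<nu> (1 / R) * measure lborel A)" if A: "A \<in> sets S.vol" for A
        by (rule truncated_second_moment[OF S.eta_measurable[OF A] R cos[OF A]])
      then show ?thesis unfolding True
        using levy_psi_nonneg[OF levy] by (intro exI[of _ "4 * R\<^sup>2 * levy_psi \<sigma> \<nu> (1 / R)"]) auto
    next
      case False
      then obtain p where \<sigma>: "\<sigma> = 0" "1 \<le> q" "q \<le> 2" and p: "0 < p" "p < q"
        "(\<integral>\<^sup>+ z. ennreal (\<bar>z\<bar> powr p) * indicator {z. \<bar>z\<bar> \<le> 1} z \<partial>\<nu>) < \<infinity>" using q by blast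
      have p2: "p \<le> 2" using p \<sigma> by simp
      obtain K0 where K0: "0 \<le> K0" "\<And>s. 0 \<le> s \<Longrightarrow> levy_psi 0 \<nu> s \<le> K0 * (1 + s powr p)"
        using levy_psi_growth[OF levy p(1) p2 p(3)] by blast
      obtain K where K: "0 \<le> K" "\<And>X t. X \<in> borel_measurable M \<Longrightarrow> 0 \<le> t \<Longrightarrow>
         (\<forall>u. expectation (\<lambda>\<omega>. 1 - cos (u * X \<omega>)) \<le> t * levy_psi 0 \<nu> u) \<Longrightarrow>
         (\<integral>\<^sup>+\<omega>. ennreal (\<bar>X \<omega>\<bar> powr q) * indicator {..R} \<bar>X \<omega>\<bar> \<partial>M) \<le> ennreal (K * t)"
        using truncated_moment[OF R p(1,2) K0(2,1)] by blast
      show ?thesis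
      proof (intro exI[of _ K] conjI K(1) ballI)
        fix A assume A: "A \<in> sets S.vol"
        show "(\<integral>\<^sup>+\<omega>. ennreal (\<bar>S.\<eta> A \<omega>\<bar> powr q) * indicator {..R} \<bar>S.\<eta> A \<omega>\<bar> \<partial>M) \<le> ennreal (K * measure lborel A)"
          using cos[OF A] unfolding \<sigma>(1) by (intro K(2) S.eta_measurable A) auto
      qed
    qed
    then show ?thesis by (simp add: S.\<eta>_def S.sets_vol)
  qed
  show ?thesis
  proof
    show "1 \<le> q" "q \<le> 2" using q by auto
    show "bounded D" by (rule D)
  qed (rule mom)
qed

theorem theorem3p2:
  fixes M :: "'w measure"
    and D :: "(real^'d) set"
    and a :: "'d \<Rightarrow> 'd \<Rightarrow> real^'d \<Rightarrow> real"
    and bt :: "'d \<Rightarrow> real^'d \<Rightarrow> real"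
    and G GD :: "real^'d \<Rightarrow> real^'d \<Rightarrow> real"
    and C b \<sigma> :: real
    and \<nu> :: "real measure"
    and \<xi> :: "(real^'d) set \<Rightarrow> 'w \<Rightarrow> real"
  assumes prob: "prob_space M" and complete: "complete_measure M"
    and domain: "smooth_bounded_domain D"
    and coeff_a: "\<forall>i j. Linf_on D (a i j)"
    and coeff_b: "\<forall>i. Linf_on D (bt i)"
    and elliptic: "uniformly_elliptic D a"
    and drift_nonneg: "\<forall>i. AE x in lebesgue_on D. 0 \<le> bt i x"
    and green: "green_function D a bt G"
    and C_pos: "C > 0"
    and bound_i: "CARD('d) \<ge> 3 \<Longrightarrow>
          \<forall>x\<in>D. \<forall>y\<in>D. x \<noteq> y \<longrightarrow> G x y \<le> C * norm (x - y) powr (2 - real CARD('d))"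
    and bound_ii: "CARD('d) \<le> 2 \<Longrightarrow>
          laplace_green_function D GD \<and>
          (\<forall>x\<in>D. \<forall>y\<in>D. x \<noteq> y \<longrightarrow> G x y \<le> C * GD x y)"
    and noise: "symmetric_levy_white_noise M D b \<sigma> \<nu> \<xi>"
    and high_dim: "CARD('d) \<ge> 4 \<Longrightarrow>
          \<sigma> = 0 \<and>
          (\<exists>p. 0 < p \<and> p < real CARD('d) / (real CARD('d) - 2) \<and>
             (\<integral>\<^sup>+ z. ennreal (\<bar>z\<bar> powr p) * indicator {z. \<bar>z\<bar> \<le> 1} z \<partial>\<nu>) < \<infinity>)"
  shows "(\<exists>u. mild_solution M D G \<xi> u) \<and>
    (\<forall>u v. mild_solution M D G \<xi> u \<and> mild_solution M D G \<xi> v \<longrightarrow>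
       (\<forall>x\<in>D. AE \<omega> in M. u x \<omega> = v x \<omega>)) \<and>
    (\<forall>u. mild_solution M D G \<xi> u \<longrightarrow>
       generalized_solution M D (green_op D (\<lambda>x y. G y x)) \<xi> u \<and>
       (symmetric_kernel D G \<longrightarrow> generalized_solution M D (green_op D G) \<xi> u))"
proof -
  have D: "open D" "bounded D" using domain unfolding smooth_bounded_domain_def by auto
  have Gm: "(\<lambda>(x, y). G x y) \<in> borel_measurable (restrict_space borel (D \<times> D))"
    and nonneg: "\<And>x y. x \<in> D \<Longrightarrow> y \<in> D \<Longrightarrow> x \<noteq> y \<Longrightarrow> 0 \<le> G x y"
    using green unfolding green_function_def by auto
  define d where "d = real CARD('d)"
  have "\<exists>q \<alpha> K. bounded_noise M D \<xi> b (levy_psi \<sigma> \<nu>) q \<and> 0 \<le> \<alpha> \<and> \<alpha> * q < d \<and> 0 \<le> K \<and>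
      (\<forall>x\<in>D. \<forall>y\<in>D. x \<noteq> y \<longrightarrow> G x y \<le> K * norm (x - y) powr (- \<alpha>))"
  proof -
    consider "CARD('d) \<le> 2" | "CARD('d) = 3" | "CARD('d) \<ge> 4" by linarith
    then show ?thesis
    proof cases
      \<comment> \<open>Here \<open>q = 2\<close> and \<open>\<alpha> = 1/4\<close>, so
        \<open>\<alpha> * q\<close> is below the dimension even on the line.\<close>
      case 1
      have "laplace_green_function D GD" using bound_ii[OF 1] by (rule conjunct1)
      from laplace_green_function_bound[OF D 1 this]
      obtain K where K: "0 \<le> K" "\<forall>x\<in>D. \<forall>y\<in>D. x \<noteq> y \<longrightarrow> GD x y \<le> K * norm (x - y) powr (- (1/4))"
        by (elim exE conjE)
      have "G x y \<le> (C * K) * norm (x - y) powr (- (1/4))" if "x \<in> D" "y \<in> D" "x \<noteq> y" for x y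
      proof -
        have "G x y \<le> C * GD x y" using bound_ii[OF 1] that by blast
        also have "\<dots> \<le> C * (K * norm (x - y) powr (- (1/4)))" using C_pos K(2) that by (intro mult_left_mono) auto
        finally show ?thesis by (simp add: mult.assoc)
      qed
      moreover have "1 / 4 * 2 < d" using zero_less_card_finite[where 'a = 'd] unfolding d_def by linarith
      moreover have "0 \<le> C * K" using C_pos K(1) by simp
      moreover have "bounded_noise M D \<xi> b (levy_psi \<sigma> \<nu>) 2"
        by (rule levy_noise_bounded_noise[OF prob D noise]) simp
      ultimately show ?thesis by (intro exI[of _ 2] exI[of _ "1/4"] exI[of _ "C * K"]) simp
    next
      \<comment> \<open>In dimension three the singularity has exponent 1 and is still square
        integrable, since \<open>2 < 3\<close>.\<close>
      case 2
      moreover have "bounded_noise M D \<xi> b (levy_psi \<sigma> \<nu>) 2"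
        by (rule levy_noise_bounded_noise[OF prob D noise]) simp
      ultimately show ?thesis using bound_i C_pos
        by (intro exI[of _ 2] exI[of _ 1] exI[of _ C]) (simp add: d_def)
    next
      case 3
      then have d4: "4 \<le> d" by (simp add: d_def)
      obtain p where \<sigma>: "\<sigma> = 0" and p: "0 < p" "p < d / (d - 2)"
          "(\<integral>\<^sup>+ z. ennreal (\<bar>z\<bar> powr p) * indicator {z. \<bar>z\<bar> \<le> 1} z \<partial>\<nu>) < \<infinity>"
        using high_dim[OF 3] unfolding d_def by blast
      have d1: "1 < d / (d - 2)" "d / (d - 2) \<le> 2" using d4 by (auto simp: field_simps)
      define e where "e = d / (d - 2)"
      \<comment> \<open>From dimension four on, \<open>q = 2\<close> would violate
        \<open>(d - 2) * q < d\<close>. The exponent is taken halfway between \<open>max p 1\<close>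
        and \<open>d / (d - 2)\<close>: above \<open>p\<close> for the moments of the noise, at
        least 1 for the truncated sums, and below \<open>d / (d - 2)\<close> for the kernel.\<close>
      define q where "q = (max p 1 + e) / 2"
      have "p < e" "1 < e" using p(2) d1(1) by (simp_all add: e_def)
      then have "p < q" "1 \<le> q" "q < e" unfolding q_def by auto
      then have q: "p < q" "1 \<le> q" "q < d / (d - 2)" by (simp_all add: e_def)
      have "(d - 2) * q < d" using q(3) d4 by (simp add: field_simps)
      moreover have "bounded_noise M D \<xi> b (levy_psi \<sigma> \<nu>) q"
        by (rule levy_noise_bounded_noise[OF prob D noise]) (use \<sigma> p q d1 in auto)
      moreover have "\<forall>x\<in>D. \<forall>y\<in>D. x \<noteq> y \<longrightarrow> G x y \<le> C * norm (x - y) powr (- (d - 2))"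
        using bound_i 3 by (simp add: d_def)
      ultimately show ?thesis using C_pos d4
        by (intro exI[of _ q] exI[of _ "d - 2"] exI[of _ C] conjI) auto
    qed
  qed
  then obtain q \<alpha> K where bn: "bounded_noise M D \<xi> b (levy_psi \<sigma> \<nu>) q"
    and \<alpha>: "0 \<le> \<alpha>" "\<alpha> * q < real CARD('d)" and K: "0 \<le> K"
      "\<And>x y. x \<in> D \<Longrightarrow> y \<in> D \<Longrightarrow> x \<noteq> y \<Longrightarrow> G x y \<le> K * norm (x - y) powr (- \<alpha>)"
    unfolding d_def by blast
  interpret bounded_noise M D \<xi> b "levy_psi \<sigma> \<nu>" q by (rule bn)
  note Gv = pair_measurable_vol[OF Gm]
  obtain B where B: "\<And>x. x \<in> D \<Longrightarrow> Nq (G x) \<le> ennreal B"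
    using Nq_kernel_bound[OF \<alpha> K(1) nonneg K(2)] by blast
  have fin: "Nq (G x) < \<infinity>" if "x \<in> D" for x using B[OF that] by (simp add: order_le_less_trans)
  show ?thesis
    using ex_mild_solution[OF Gv fin] mild_solution_unique[OF Gv] generalized_solution_of_mild[OF Gv B]
    by blast
qed

end
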